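(* Let $a,b,\alpha,\beta,s\in\mathbb{C}$ and let $z$ be the variable of the functions below. Suppose that $\Re(b-a)>0$ and $\Re(\alpha-2b)>-\frac{5}{2}$. Then \[ M(a;b;z)=\frac{\binom{b-1}{a}}{\binom{b-\beta-1}{a}}\sum_{i=0}^{\infty}(-1)^{i}L_{i}^{(\beta-i)}(z)\,\frac{\binom{-a}{i}}{\binom{\beta-b}{i}} \] and \[ U(a;b;z)=\frac{(1+\alpha-b)!}{(1+\alpha-b+a)!}\sum_{i=0}^{\infty}L_{i}^{(\alpha)}(z)\,\frac{\binom{-a}{i}}{\binom{b-a-\alpha-2}{i}}; \] moreover, \[ \Gamma(s,z)=z^{s}e^{-z}\sum_{k=0}^{\infty}\frac{L_{k}^{(\alpha)}(z)}{(k+1)\binom{k+1+\alpha-s}{k+1}} \] for $\Re\left(s-\frac{\alpha}{2}\right)<\frac{1}{4}$.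
   Context: For complex $x$, $x!:=\Gamma(x+1)$ and the generalized binomial coefficient is $\binom{x}{y}:=\frac{\Gamma(x+1)}{\Gamma(y+1)\Gamma(x-y+1)}$. Kummer's function of the first kind is $M(a;b;z):=\sum_{i=0}^{\infty}\frac{\binom{a+i-1}{i}}{\binom{b+i-1}{i}}\frac{z^{i}}{i!}$, and Kummer's function of the second kind is $U(a;b;z):=\frac{\Gamma(1-b)}{\Gamma(1-b+a)}M(a;b;z)-\frac{\Gamma(b-1)}{\Gamma(a)}z^{1-b}M(a-b+1;2-b;z)$ (equivalently, where it converges, $U(a;b;z)=\frac{1}{\Gamma(a)}\int_{0}^{\infty}e^{-zt}t^{a-1}(1+t)^{b-a-1}\,dt$). The generalized Laguerre polynomials are $L_{i}^{(\alpha)}(z):=\sum_{j=0}^{i}(-1)^{j}\binom{i+\alpha}{i-j}\frac{z^{j}}{j!}$ for integers $i\ge 0$ and complex $\alpha$. The upper incomplete Gamma function is $\Gamma(s,z):=\int_{z}^{\infty}t^{s-1}e^{-t}\,dt$.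
   Formalization: U has a plus sign before its second term (the minus contradicts the integral) and is a limit at integer b; the U series is for z>0, or any z if a is 0,-1,-2,...; the Γ series for z>0 (off [0,∞) non-terminating series diverge); parameters at poles are excluded. *)

theory Defs
  imports "HOL-Analysis.Analysis"
begin

abbreviation cfact :: "complex \<Rightarrow> complex" where
  "cfact x \<equiv> Gamma (x + 1)"

text \<open>
  The binomial coefficient with complex lower argument. At a pole of the denominator
  \<^term>\<open>Gamma\<close> is 0, so the quotient is 0 there, in agreement with
  $1/\Gamma$ being entire with zeros at the poles of $\Gamma$.
  For a lower argument that is a natural number, \<^term>\<open>(gchoose)\<close> is used instead;
  it is the continuous extension in the upper argument, see the lemma below.
\<close>
definition gen_binomial :: "complex \<Rightarrow> complex \<Rightarrow> complex" where
  "gen_binomial x y = Gamma (x + 1) / (Gamma (y + 1) * Gamma (x - y + 1))"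

lemma gen_binomial_of_nat:
  assumes "x + 1 \<notin> \<int>\<^sub>\<le>\<^sub>0"
  shows "gen_binomial x (of_nat n) = x gchoose n"
  using gbinomial_Gamma[OF assms, of n]
  by (simp add: gen_binomial_def Gamma_fact[symmetric] add_ac)

text \<open>
  The quotient of the binomial coefficients of \<open>x\<close> over \<open>y\<close> and of \<open>x'\<close> over \<open>y\<close>.
  If \<open>y\<close> is a negative integer, both of them vanish because of the common factor
  $1/\Gamma(y+1)$, and the quotient is continued to this removable singularity.
\<close>
definition binomial_quotient :: "complex \<Rightarrow> complex \<Rightarrow> complex \<Rightarrow> complex" where
  "binomial_quotient x x' y =
     (if y + 1 \<in> \<int>\<^sub>\<le>\<^sub>0
      then Lim (at y) (\<lambda>w. gen_binomial x w / gen_binomial x' w)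
      else gen_binomial x y / gen_binomial x' y)"

definition laguerre :: "nat \<Rightarrow> complex \<Rightarrow> complex \<Rightarrow> complex" where
  "laguerre n \<alpha> z =
     (\<Sum>j\<le>n. (-1) ^ j * ((of_nat n + \<alpha>) gchoose (n - j)) * z ^ j / fact j)"

definition kummer_M :: "complex \<Rightarrow> complex \<Rightarrow> complex \<Rightarrow> complex" where
  "kummer_M a b z =
     (\<Sum>i. ((a + of_nat i - 1) gchoose i) / ((b + of_nat i - 1) gchoose i) * z ^ i / fact i)"

text \<open>
  The connection formula for the Kummer function of the second kind makes sense for
  non-integer \<open>b\<close> only; its singularities at the integers are removable. The sign of the
  second summand is the one for which the function agrees with the integral
  $\frac{1}{\Gamma(a)}\int_0^\infty e^{-zt} t^{a-1} (1+t)^{b-a-1}\,dt$.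
\<close>
definition kummer_U_generic :: "complex \<Rightarrow> complex \<Rightarrow> complex \<Rightarrow> complex" where
  "kummer_U_generic a b z =
     Gamma (1 - b) / Gamma (1 - b + a) * kummer_M a b z
     + Gamma (b - 1) / Gamma a * z powr (1 - b) * kummer_M (a - b + 1) (2 - b) z"

definition kummer_U :: "complex \<Rightarrow> complex \<Rightarrow> complex \<Rightarrow> complex" where
  "kummer_U a b z =
     (if b \<in> \<int> then Lim (at b) (\<lambda>c. kummer_U_generic a c z) else kummer_U_generic a b z)"

definition upper_incomplete_Gamma :: "complex \<Rightarrow> real \<Rightarrow> complex" where
  "upper_incomplete_Gamma s x =
     integral {x..} (\<lambda>t. of_real t powr (s - 1) * of_real (exp (- t)))"

end

theory Submission
  imports Defs
begin

text \<open>
  The coefficients of the \<open>U\<close>-series are the Beta weights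
  $w_n(a,d) = \Gamma(d)\,(a)_n / \Gamma(a+d+n)$ with $d = \alpha + 2 - b$. Since
  $w_n(a,d) - w_{n+1}(a,d) = w_n(a,d+1)$ and
  $L_n^{(\alpha)} = L_n^{(\alpha+1)} - L_{n-1}^{(\alpha+1)}$, summation by parts replaces
  $\alpha$ by $\alpha + 1$ without changing the sum; the boundary term vanishes because
  $L_n^{(\alpha)}(x) = O(n^{\Re\alpha/2 + 1/4})$, which is exactly what the hypothesis on
  $\alpha - 2b$ provides. So $\Re\alpha$ may be taken as large as desired, and all series
  converge absolutely.

  For $a = 1$ the weights are the moments of $(1-t)^{d-1}$ on $[0,1]$, and integrating the
  generating function of the Laguerre polynomials gives $x^{-s} e^x \Gamma(s,x)$ with
  $s = b - 1$. For $\Re a > 1$, Gauss's theorem expands $w_n(a,d)$ in the weights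
  $w_n(1,d+k)$; inserting $\Gamma(s,x) = \Gamma(s) - x^s M(s;s+1;-x)/s$ and using Gauss's
  theorem and Kummer's transformation gives the connection formula for \<open>U\<close>. The recursion
  $U(a-1;b;z) = z\,U(a;b+1;z) - (b-a)\,U(a;b;z)$, which both sides satisfy, yields the
  remaining \<open>a\<close>, starting from $a = 0$ in the polynomial case; integer \<open>b\<close> follow by continuity in \<open>b\<close>.
  The series for \<open>M\<close> is a double series whose inner sums are evaluated by Gauss's theorem.
\<close>

subsection \<open>Laguerre polynomials\<close>

text \<open>The obstacle is convergence. For z off the nonnegative reals, L_n(z) grows like exp(c
  sqrt n), which no power weight can beat; hence z > 0, or a nonpositive integer a, which makes the
  U-series finite. For z > 0 a power bound is needed at every complex order. An energy estimate
  gives it on one strip of orders of width 1, and a relation between the orders \<alpha>, \<alpha> +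
  1, \<alpha> + 2 carries it to all others. The hypotheses are read off the boundary term
  L_n^(\<alpha>+1) w_n(a, d) of the summation by parts: it is O(n^(Re \<alpha> / 2 + 3/4 - Re d)),
  and with d = \<alpha> + 2 - b the exponent is negative iff Re (\<alpha> - 2 b) > -5/2. For a = 1,
  b = s + 1 this reads Re (s - \<alpha> / 2) < 1/4. The expansion in the weights of a = 1 has
  absolutely summable coefficients when Re a > 1. Lowering a by a recursion avoids analytic
  continuation in a, but the recursion moves b by 1, so the statement that is carried along must
  cover a whole half-plane of b.\<close>

lemma laguerre_0 [simp]: "laguerre 0 \<alpha> z = 1"
  by (simp add: laguerre_def)

text \<open>Pascal's rule in each coefficient. The summand j = n + 1 is split off, since it has no
  counterpart in \<open>laguerre n\<close>.\<close>

lemma laguerre_Suc_order: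
  "laguerre (Suc n) (\<alpha> + 1) z = laguerre n (\<alpha> + 1) z + laguerre (Suc n) \<alpha> z"
proof -
  have pascal: "(of_nat (Suc n) + (\<alpha> + 1)) gchoose (Suc n - j) =
      ((of_nat n + (\<alpha> + 1)) gchoose (n - j)) + ((of_nat (Suc n) + \<alpha>) gchoose (Suc n - j))"
    if "j \<le> n" for j
    using gbinomial_Suc_Suc[of "of_nat n + (\<alpha> + 1)" "n - j"] that
    by (simp add: Suc_diff_le add_ac)
  have "laguerre (Suc n) (\<alpha> + 1) z =
      (\<Sum>j\<le>n. (-1)^j * (((of_nat n + (\<alpha> + 1)) gchoose (n - j))
          + ((of_nat (Suc n) + \<alpha>) gchoose (Suc n - j))) * z ^ j / fact j)
      + (-1)^Suc n * z ^ Suc n / fact (Suc n)"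
    unfolding laguerre_def by (simp add: pascal del: of_nat_Suc fact_Suc power_Suc)
  then show ?thesis
    unfolding laguerre_def
    by (simp add: sum.distrib algebra_simps add_divide_distrib del: of_nat_Suc fact_Suc power_Suc)
qed

text \<open>Comparison of coefficients by the absorption identity. This recurrence drives the energy
  estimate, the generating function and the recursion in a.\<close>

lemma laguerre_Suc_mult:
  "of_nat (Suc n) * laguerre (Suc n) \<alpha> z =
     (of_nat (Suc n) + \<alpha>) * laguerre n \<alpha> z - z * laguerre n (\<alpha> + 1) z"
proof -
  define g where "g j = (-1)^j * (((of_nat n + (\<alpha> + 1)) gchoose (n - j))) * z ^ Suc j / fact j" for j
  \<comment> \<open>Multiplication by z shifts the coefficients by one place, so the coefficient at
    j = 0 is 0.\<close>
  define h where "h j = (if j = 0 then 0 else g (j - 1))" for j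
  have "(\<Sum>j\<le>Suc n. h j) = (\<Sum>j\<le>n. g j)"
    by (subst sum.atMost_Suc_shift) (simp add: h_def)
  then have zL: "z * laguerre n (\<alpha> + 1) z = (\<Sum>j\<le>Suc n. h j)"
    by (simp add: laguerre_def sum_distrib_left g_def mult_ac)
  \<comment> \<open>At j = Suc n the truncated difference n - j would give a binomial coefficient 1
    instead of 0, hence the case distinction.\<close>
  define c where "c j = (if j \<le> n then (of_nat (Suc n) + \<alpha>) * ((of_nat n + \<alpha>) gchoose (n - j)) else 0)" for j
  have "(of_nat (Suc n) + \<alpha>) * laguerre n \<alpha> z = (\<Sum>j\<le>n. (-1)^j * c j * z^j / fact j)"
    by (simp add: laguerre_def sum_distrib_left c_def mult_ac)
  then have nL: "(of_nat (Suc n) + \<alpha>) * laguerre n \<alpha> z = (\<Sum>j\<le>Suc n. (-1)^j * c j * z^j / fact j)"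
    by (simp add: c_def)
  have "(-1)^j * c j * z^j / fact j - h j =
      of_nat (Suc n) * ((-1)^j * ((of_nat (Suc n) + \<alpha>) gchoose (Suc n - j)) * z^j / fact j)"
    if j: "j \<le> Suc n" for j
  proof -
    let ?G = "(of_nat (Suc n) + \<alpha>) gchoose (Suc n - j)"
    have ab: "c j = of_nat (Suc n - j) * ?G"
    proof (cases "j \<le> n")
      case True
      then obtain k where k: "n = j + k"
        using le_iff_add by blast
      then have e: "Suc n - j = Suc k" "n - j = k" by simp_all
      have "of_nat (Suc n) + \<alpha> - 1 = of_nat n + \<alpha>" by simp
      then show ?thesis
        unfolding c_def e using gbinomial_absorption[of k "of_nat (Suc n) + \<alpha>"] True
        by (simp only: if_True)
    next
      case False
      with j have "j = Suc n" by simp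
      then show ?thesis by (simp add: c_def)
    qed
    have h: "- h j = (-1)^j * (of_nat j * ?G) * z^j / fact j"
    proof (cases j)
      case (Suc i)
      then have "h j = (-1)^i * ?G * z^Suc i / fact i"
        using j by (simp add: h_def g_def add_ac)
      also have "\<dots> = - ((-1)^j * (of_nat j * ?G) * z^j / fact j)"
        by (simp add: Suc divide_simps del: of_nat_Suc)
      finally show ?thesis by simp
    qed (simp add: h_def)
    have "(-1)^j * c j * z^j / fact j - h j = (-1)^j * ((of_nat (Suc n - j) + of_nat j) * ?G) * z^j / fact j"
    proof -
      have "(-1)^j * c j * z^j / fact j - h j = (-1)^j * c j * z^j / fact j + (- h j)"
        by simp
      also have "\<dots> = (-1)^j * ((of_nat (Suc n - j) + of_nat j) * ?G) * z^j / fact j"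
        unfolding h ab by (simp only: distrib_left distrib_right add_divide_distrib)
      finally show ?thesis .
    qed
    also have "of_nat (Suc n - j) + of_nat j = (of_nat (Suc n) :: complex)"
      using j by (simp add: of_nat_diff)
    finally show ?thesis by (simp add: mult_ac)
  qed
  then have "(\<Sum>j\<le>Suc n. (-1)^j * c j * z^j / fact j - h j) = of_nat (Suc n) * laguerre (Suc n) \<alpha> z"
    unfolding laguerre_def sum_distrib_left by (intro sum.cong) auto
  then show ?thesis
    by (simp only: zL nL sum_subtractf)
qed

text \<open>Links three consecutive orders with a single factor n + 1. Read in either direction, it
  transports growth bounds from one order to another.\<close>

lemma laguerre_Suc_order2:
  "of_nat (Suc n) * laguerre (Suc n) \<alpha> z =
     (\<alpha> + 1) * laguerre n (\<alpha> + 1) z - z * laguerre n (\<alpha> + 2) z"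
proof -
  have "\<alpha> + 1 + 1 = \<alpha> + 2" by simp
  then have "of_nat (Suc n) * laguerre (Suc n) (\<alpha> + 1) z =
      (of_nat (Suc n) + (\<alpha> + 1)) * laguerre n (\<alpha> + 1) z - z * laguerre n (\<alpha> + 2) z"
    using laguerre_Suc_mult[of n "\<alpha> + 1" z] by (simp only:)
  then show ?thesis
    unfolding laguerre_Suc_order[of n \<alpha> z] by (simp add: algebra_simps del: of_nat_Suc)
qed

subsection \<open>Ratios of Pochhammer symbols and Gauss's summation theorem\<close>

text \<open>For r < 0 the roles of u and v are exchanged, whence the two-sided comparison and the
  exponent \<bar>r\<bar>.\<close>

lemma powr_le_comparable:
  fixes u v c r :: real
  assumes "0 < u" "0 < v" "v \<le> c * u" "u \<le> c * v"
  shows "v powr r \<le> c powr \<bar>r\<bar> * u powr r"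
proof -
  have c: "c > 0"
    using assms by (metis order_less_le_trans zero_less_mult_pos2)
  show ?thesis
  proof (cases "r \<ge> 0")
    case True
    then have "v powr r \<le> (c * u) powr r"
      using assms by (intro powr_mono2) auto
    then show ?thesis
      using True by (simp add: powr_mult)
  next
    case False
    have "(c * v) powr r \<le> u powr r"
      using assms False by (intro powr_mono2') auto
    then have "c powr (- r) * (c powr r * v powr r) \<le> c powr (- r) * u powr r"
      unfolding powr_mult by (intro mult_left_mono) auto
    then show ?thesis
      using False c by (simp add: mult.assoc[symmetric] powr_add[symmetric])
  qed
qed

text \<open>Gauss's product for Gamma yields bounds at index Suc n in terms of n. The base n + 1 is
  used from here on, since \<open>0 powr r\<close> is 0 and would be a false bound at n = 0.\<close>

lemma powr_bound_shift:
  fixes f :: "nat \<Rightarrow> 'a :: real_normed_vector"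
  assumes "\<And>n. n > 0 \<Longrightarrow> norm (f (Suc n)) \<le> K * real n powr r"
  obtains L where "L > 0" "\<And>n. norm (f n) \<le> L * (real n + 1) powr r"
proof -
  have "norm (f 2) \<le> K"
    using assms[of 1] by (simp add: numeral_2_eq_2)
  then have K: "K \<ge> 0"
    using norm_ge_zero order_trans by blast
  \<comment> \<open>The 3 comes from n + 2 \<le> 3 n for n \<ge> 1.\<close>
  define J where "J = 3 powr \<bar>r\<bar>"
  have J: "real n powr r \<le> J * (real n + 2) powr r" if n: "n > 0" for n
    unfolding J_def using n by (intro powr_le_comparable) auto
  define L where "L = K * J + norm (f 0) + norm (f 1) * 2 powr (- r) + 1"
  have J0: "J > 0" by (simp add: J_def)
  have "norm (f n) \<le> L * (real n + 1) powr r" for n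
  proof -
    consider "n = 0" | "n = 1" | m where "n = Suc m" "m > 0"
      by (cases n) auto
    then show ?thesis
    proof cases
      case 1
      then show ?thesis using K J0 by (simp add: L_def)
    next
      case 2
      have "norm (f 1) = norm (f 1) * 2 powr (- r) * 2 powr r"
        by (simp only: mult.assoc powr_add[symmetric]) simp
      also have "\<dots> \<le> L * 2 powr r"
        using K J0 by (intro mult_right_mono) (auto simp: L_def)
      finally show ?thesis using 2 by simp
    next
      case 3
      have "norm (f (Suc m)) \<le> K * real m powr r"
        using assms 3 by simp
      also have "\<dots> \<le> K * (J * (real m + 2) powr r)"
        using K J[of m] 3 by (intro mult_left_mono) auto
      also have "\<dots> \<le> L * (real m + 2) powr r"
        unfolding mult.assoc[symmetric] L_def by (intro mult_right_mono) auto
      finally show ?thesis using 3 by (simp add: add_ac)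
    qed
  qed
  moreover have "L > 0"
    unfolding L_def using K J0 by (intro add_nonneg_pos add_nonneg_nonneg mult_nonneg_nonneg) auto
  ultimately show ?thesis
    using that by blast
qed

lemma powr_bound_shift':
  fixes f :: "nat \<Rightarrow> 'a :: real_normed_vector"
  assumes "\<And>n. norm (f (Suc n)) \<le> K * (real n + 1) powr r"
  obtains L where "L > 0" "\<And>n. norm (f n) \<le> L * (real n + 1) powr r"
proof (rule powr_bound_shift)
  show "norm (f (Suc n)) \<le> (K * 2 powr \<bar>r\<bar>) * real n powr r" if n: "n > 0" for n
  proof -
    have "norm (f 1) \<le> K"
      using assms[of 0] by simp
    then have "K \<ge> 0"
      using norm_ge_zero order_trans by blast
    moreover have "(real n + 1) powr r \<le> 2 powr \<bar>r\<bar> * real n powr r"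
      using n by (intro powr_le_comparable) auto
    ultimately have "K * (real n + 1) powr r \<le> K * (2 powr \<bar>r\<bar> * real n powr r)"
      by (intro mult_left_mono)
    then show ?thesis
      using assms[of n] by (simp add: mult.assoc)
  qed
qed (use that in blast)

lemma rGamma_series_mult_Gamma_series:
  fixes a c :: complex
  shows "rGamma_series a n * Gamma_series c n =
    pochhammer a (Suc n) / pochhammer c (Suc n) * exp ((c - a) * of_real (ln (of_nat n)))"
  by (simp add: rGamma_series_def Gamma_series_def exp_diff left_diff_distrib
      del: pochhammer_Suc)

text \<open>Up to n powr (c - a), the quotient is the product of Gauss's sequences for 1 / Gamma(a)
  and Gamma(c); it converges and is therefore bounded. At a pole, where \<open>Gamma c\<close> is 0,
  the quotients are eventually 0 too, so the bound covers every pair a, c.\<close>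

lemma pochhammer_ratio_bound:
  fixes a c :: complex
  obtains K where "K > 0"
    "\<And>n. norm (pochhammer a n / pochhammer c n) \<le> K * (real n + 1) powr Re (a - c)"
proof -
  have "(\<lambda>n. rGamma_series a n * Gamma_series c n) \<longlonglongrightarrow> rGamma a * Gamma c"
    by (intro tendsto_intros)
  then have "Bseq (\<lambda>n. rGamma_series a n * Gamma_series c n)"
    by (intro convergent_imp_Bseq) (auto simp: convergent_def)
  then obtain K where K: "norm (rGamma_series a n * Gamma_series c n) \<le> K" for n
    by (auto simp: Bseq_def)
  have bd: "norm (pochhammer a (Suc n) / pochhammer c (Suc n)) \<le> K * real n powr Re (a - c)"
    if "n > 0" for n
  proof -
    have "norm (exp ((c - a) * of_real (ln (real n)))) = real n powr - Re (a - c)"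
      using that by (simp add: powr_def)
    then have "norm (pochhammer a (Suc n) / pochhammer c (Suc n)) * real n powr - Re (a - c) \<le> K"
      using K[of n] unfolding rGamma_series_mult_Gamma_series norm_mult by simp
    then have "norm (pochhammer a (Suc n) / pochhammer c (Suc n)) * real n powr - Re (a - c) * real n powr Re (a - c)
       \<le> K * real n powr Re (a - c)"
      by (intro mult_right_mono) auto
    then show ?thesis
      using that by (simp only: mult.assoc powr_add[symmetric]) simp
  qed
  show ?thesis
    using powr_bound_shift[OF bd] that by blast
qed

lemma summable_powr_minus:
  assumes "r < - 1"
  shows "summable (\<lambda>n. (real n + 1) powr r)"
proof -
  have "summable (\<lambda>n. real (n + 1) powr r)"
    using assms by (subst summable_iff_shift) (simp add: summable_real_powr_iff)
  then show ?thesis by (simp add: add_ac)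
qed

lemma powr_minus_tendsto_0:
  assumes "r < 0"
  shows "(\<lambda>n. (real n + 1) powr r) \<longlonglongrightarrow> 0"
  using tendsto_neg_powr[OF assms filterlim_tendsto_add_at_top[OF tendsto_const filterlim_real_sequentially, of 1]]
  by (simp add: add.commute)

text \<open>The terms of the hypergeometric series F(A, B; C; 1).\<close>

definition gauss_term :: "complex \<Rightarrow> complex \<Rightarrow> complex \<Rightarrow> nat \<Rightarrow> complex" where
  "gauss_term A B C k = pochhammer A k * pochhammer B k / (pochhammer C k * fact k)"

lemma gauss_term_bound:
  obtains K where "K > 0"
    "\<And>n. norm (gauss_term A B C n) \<le> K * (real n + 1) powr (Re (A + B - C) - 1)"
proof -
  obtain K where K: "K > 0" "\<And>n. norm (pochhammer A n / pochhammer C n) \<le> K * (real n + 1) powr Re (A - C)"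
    using pochhammer_ratio_bound by blast
  obtain L where L: "L > 0" "\<And>n. norm (pochhammer B n / pochhammer 1 n) \<le> L * (real n + 1) powr Re (B - 1)"
    using pochhammer_ratio_bound by blast
  have "norm (gauss_term A B C n) \<le> (K * L) * (real n + 1) powr (Re (A + B - C) - 1)" for n
  proof -
    have "norm (gauss_term A B C n) = norm (pochhammer A n / pochhammer C n) * norm (pochhammer B n / pochhammer 1 n)"
      by (simp add: gauss_term_def norm_mult norm_divide pochhammer_fact)
    also have "\<dots> \<le> (K * (real n + 1) powr Re (A - C)) * (L * (real n + 1) powr Re (B - 1))"
      using K L by (intro mult_mono) auto
    also have "\<dots> = (K * L) * (real n + 1) powr (Re (A - C) + Re (B - 1))"
      by (simp add: powr_add)
    finally show ?thesis by (simp add: algebra_simps)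
  qed
  then show ?thesis using that[of "K * L"] K(1) L(1) by simp
qed

lemma summable_norm_gauss_term:
  assumes "Re (C - A - B) > 0"
  shows "summable (\<lambda>n. norm (gauss_term A B C n))"
proof -
  obtain K where K: "\<And>n. norm (gauss_term A B C n) \<le> K * (real n + 1) powr (Re (A + B - C) - 1)"
    using gauss_term_bound by blast
  show ?thesis
    by (rule summable_comparison_test'[where g = "\<lambda>n. K * (real n + 1) powr (Re (A + B - C) - 1)"])
       (use K assms in \<open>auto intro!: summable_mult summable_powr_minus\<close>)
qed

lemmas summable_gauss_term = summable_norm_cancel[OF summable_norm_gauss_term]

text \<open>A telescoping certificate: the combination on the left is a difference in k, so
  summation over k relates the sums for C and C + 1.\<close>

lemma gauss_term_contiguous:
  assumes C: "C \<notin> \<int>\<^sub>\<le>\<^sub>0"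
  shows "C * (C - A - B) * gauss_term A B C k - (C - A) * (C - B) * gauss_term A B (C + 1) k =
    C * (of_nat k * gauss_term A B C k - of_nat (Suc k) * gauss_term A B C (Suc k))"
proof -
  have nz: "C + of_nat k \<noteq> 0" for k
    using C by (metis add_eq_0_iff2 minus_of_nat_in_nonpos_Ints neg_equal_iff_equal minus_minus add.inverse_inverse)
  have pz: "pochhammer C k \<noteq> 0"
    using C by (auto simp: pochhammer_eq_0_iff)
  have Cn: "C \<noteq> 0" using nz[of 0] by simp
  have P: "pochhammer (C + 1) k = (C + of_nat k) / C * pochhammer C k"
    using pochhammer_rec[of C k] Cn by (simp add: pochhammer_Suc field_simps)
  define u where "u = gauss_term A B C k"
  have 1: "gauss_term A B (C + 1) k = u * C / (C + of_nat k)"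
    using Cn nz[of k] pz by (simp add: u_def gauss_term_def P field_simps)
  have 2: "of_nat (Suc k) * gauss_term A B C (Suc k) = u * (A + of_nat k) * (B + of_nat k) / (C + of_nat k)"
    using nz[of k] pz by (simp add: u_def gauss_term_def pochhammer_Suc divide_simps del: of_nat_Suc)
  show ?thesis
    unfolding 1 2 u_def[symmetric] using nz[of k] by (simp add: divide_simps) (simp add: algebra_simps power2_eq_square)
qed

lemma gauss_sum_contiguous:
  assumes C: "C \<notin> \<int>\<^sub>\<le>\<^sub>0" and re: "Re (C - A - B) > 0"
  shows "C * (C - A - B) * (\<Sum>k. gauss_term A B C k) =
    (C - A) * (C - B) * (\<Sum>k. gauss_term A B (C + 1) k)"
proof -
  let ?g = "\<lambda>k. of_nat k * gauss_term A B C k"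
  obtain K where K: "\<And>n. norm (gauss_term A B C n) \<le> K * (real n + 1) powr (Re (A + B - C) - 1)"
    using gauss_term_bound by blast
  \<comment> \<open>The boundary term is O(k^Re (A + B - C)) and vanishes under the condition for
    convergence.\<close>
  have "?g \<longlonglongrightarrow> 0"
  proof (rule Lim_null_comparison[OF always_eventually[OF allI]])
    fix n
    have "norm (?g n) = real n * norm (gauss_term A B C n)"
      by (simp add: norm_mult)
    also have "\<dots> \<le> (real n + 1) * (K * (real n + 1) powr (Re (A + B - C) - 1))"
      using K by (intro mult_mono) auto
    also have "\<dots> = K * (real n + 1) powr Re (A + B - C)"
      by (simp add: powr_diff)
    finally show "norm (?g n) \<le> K * (real n + 1) powr Re (A + B - C)" .
  next
    show "(\<lambda>n. K * (real n + 1) powr Re (A + B - C)) \<longlonglongrightarrow> 0"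
      using re by (intro tendsto_mult_right_zero powr_minus_tendsto_0) simp
  qed
  then have "(\<lambda>k. ?g (Suc k) - ?g k) sums (0 - ?g 0)"
    by (rule telescope_sums)
  from sums_mult[OF this, of "- C"]
  have "(\<lambda>k. C * (?g k - ?g (Suc k))) sums 0"
    by (simp add: algebra_simps)
  moreover have "(\<lambda>k. C * (C - A - B) * gauss_term A B C k - (C - A) * (C - B) * gauss_term A B (C + 1) k) sums
      (C * (C - A - B) * (\<Sum>k. gauss_term A B C k) - (C - A) * (C - B) * (\<Sum>k. gauss_term A B (C + 1) k))"
    using re by (intro sums_diff sums_mult summable_sums summable_gauss_term) auto
  ultimately show ?thesis
    unfolding gauss_term_contiguous[OF C] using sums_unique2 by fastforce
qed

lemma plus_nat_notin_nonpos_Ints: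
  fixes C :: "'a :: ring_char_0"
  assumes "C \<notin> \<int>\<^sub>\<le>\<^sub>0"
  shows "C + of_nat n \<notin> \<int>\<^sub>\<le>\<^sub>0"
  using assms nonpos_Ints_diff_Nats[of "C + of_nat n" "of_nat n"] by auto

text \<open>The way to Gauss's theorem: as m grows, the sum on the right tends to 1 and the
  Pochhammer quotient to a quotient of Gamma values.\<close>

lemma gauss_sum_shift:
  assumes C: "C \<notin> \<int>\<^sub>\<le>\<^sub>0" and re: "Re (C - A - B) > 0"
  shows "(\<Sum>k. gauss_term A B C k) =
    pochhammer (C - A) m * pochhammer (C - B) m / (pochhammer C m * pochhammer (C - A - B) m)
      * (\<Sum>k. gauss_term A B (C + of_nat m) k)"
proof (induction m)
  case (Suc m)
  have "Re (C + of_nat m - A - B) > 0"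
    using re by simp
  moreover from this have "C + of_nat m - A - B \<noteq> 0"
    by (auto simp del: minus_complex.simps plus_complex.simps)
  moreover have "C + of_nat m \<notin> \<int>\<^sub>\<le>\<^sub>0"
    using plus_nat_notin_nonpos_Ints[OF C] .
  moreover from this have "C + of_nat m \<noteq> 0"
    by auto
  ultimately have "(\<Sum>k. gauss_term A B (C + of_nat m) k) =
      (C + of_nat m - A) * (C + of_nat m - B) / ((C + of_nat m) * (C + of_nat m - A - B)) *
      (\<Sum>k. gauss_term A B (C + of_nat m + 1) k)"
    using gauss_sum_contiguous[of "C + of_nat m" A B] by (simp add: divide_simps) (simp add: mult_ac)
  moreover have "C + of_nat (Suc m) = C + of_nat m + 1"
    by simp
  ultimately show ?case
    by (simp only: Suc.IH pochhammer_Suc diff_add_eq times_divide_times_eq mult.assoc[symmetric])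
       (simp add: mult_ac)
qed simp

lemma norm_pochhammer_le: "norm (pochhammer a n) \<le> pochhammer (norm a) n" for a :: complex
proof (induction n)
  case (Suc n)
  have "norm (a + of_nat n) \<le> norm a + real n"
    using norm_triangle_ineq[of a "of_nat n"] by simp
  moreover have "0 \<le> pochhammer (norm a) n"
    using Suc norm_ge_zero order_trans by blast
  ultimately show ?case
    using Suc by (auto simp: pochhammer_Suc norm_mult intro!: mult_mono)
qed simp

lemma pochhammer_norm_nonneg: "0 \<le> pochhammer (norm a) n" for a :: complex
  using norm_pochhammer_le norm_ge_zero order_trans by blast

lemma pochhammer_le_norm:
  fixes c :: complex
  assumes "0 \<le> r" "r \<le> Re c"
  shows "pochhammer r n \<le> norm (pochhammer c n)"
proof (induction n)
  case (Suc n)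
  have "r + real n \<le> norm (c + of_nat n)"
    using complex_Re_le_cmod[of "c + of_nat n"] assms by simp
  with Suc assms show ?case
    by (auto simp: pochhammer_Suc norm_mult intro!: mult_mono)
qed simp

text \<open>Every term with k > 0 tends to 0 as the lower parameter moves to infinity; Tannery's
  theorem allows the termwise limit.\<close>

lemma gauss_sum_tendsto:
  "(\<lambda>m. \<Sum>k. gauss_term A B (C + of_nat m) k) \<longlonglongrightarrow> 1"
proof -
  \<comment> \<open>The majorant is itself a Gauss series, with parameters |A|, |B| and R; it
    converges because R - |A| - |B| = 1.\<close>
  define R where "R = norm A + norm B + 1"
  define M where "M k = norm (gauss_term (of_real (norm A)) (of_real (norm B)) (of_real R) k)" for k
  define b where "b k = (if k = 0 then 1 else 0 :: complex)" for k :: nat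
  have R: "R > 0" by (simp add: R_def add_nonneg_pos)
  have lim: "(\<lambda>m. gauss_term A B (C + of_nat m) k) \<longlonglongrightarrow> b k" for k
  proof (cases k)
    case (Suc j)
    have at: "filterlim (\<lambda>m. C + of_nat m + of_nat i) at_infinity sequentially" for i
      using tendsto_add_filterlim_at_infinity[OF tendsto_const[of "C + of_nat i"] tendsto_of_nat]
      by (simp add: add_ac)
    have "(\<lambda>m. inverse (C + of_nat m + of_nat i)) \<longlonglongrightarrow> 0" for i
      by (rule filterlim_compose[OF tendsto_inverse_0 at])
    then have "(\<lambda>m. \<Prod>i<k. inverse (C + of_nat m + of_nat i)) \<longlonglongrightarrow> (\<Prod>i<k. 0)"
      by (intro tendsto_prod)
    then have "(\<lambda>m. pochhammer A k * pochhammer B k / fact k * (\<Prod>i<k. inverse (C + of_nat m + of_nat i))) \<longlonglongrightarrow> 0"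
      using Suc by (intro tendsto_mult_right_zero) (simp add: zero_power)
    then show ?thesis
      using Suc by (simp add: b_def gauss_term_def pochhammer_prod prod_inversef[symmetric] o_def
          divide_inverse atLeast0LessThan mult_ac del: prod.lessThan_Suc)
  qed (simp add: gauss_term_def b_def)
  have bound: "norm (gauss_term A B (C + of_nat m) k) \<le> M k" if "real m \<ge> R - Re C" for m k
  proof -
    have pos: "pochhammer R k > 0"
      using R by (rule pochhammer_pos)
    have "norm (gauss_term A B (C + of_nat m) k) =
      norm (pochhammer A k) * norm (pochhammer B k) / (norm (pochhammer (C + of_nat m) k) * fact k)"
      by (simp add: gauss_term_def norm_mult norm_divide)
    also have "\<dots> \<le> pochhammer (norm A) k * pochhammer (norm B) k / (pochhammer R k * fact k)"
      using pos R that
      by (intro frac_le mult_mono mult_right_mono norm_pochhammer_le pochhammer_le_norm mult_pos_pos)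
         (auto intro!: pochhammer_norm_nonneg mult_nonneg_nonneg)
    also have "\<dots> = M k"
      using R by (simp add: M_def gauss_term_def pochhammer_of_real norm_mult norm_divide
          abs_of_nonneg pochhammer_norm_nonneg pochhammer_nonneg)
    finally show ?thesis .
  qed
  have "eventually (\<lambda>m. real m \<ge> R - Re C) sequentially"
    using filterlim_real_sequentially by (simp add: filterlim_at_top)
  then have ev: "eventually (\<lambda>(k, m). norm (gauss_term A B (C + of_nat m) k) \<le> M k) (at_top \<times>\<^sub>F sequentially)"
    unfolding eventually_prod_filter
    by (intro exI[of _ "\<lambda>_. True"] exI[of _ "\<lambda>m. real m \<ge> R - Re C"]) (use bound in auto)
  have "summable M"
    unfolding M_def by (rule summable_norm_gauss_term) (simp add: R_def)
  from tannerys_theorem[OF lim ev this]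
  have "(\<lambda>m. \<Sum>k. gauss_term A B (C + of_nat m) k) \<longlonglongrightarrow> (\<Sum>k. b k)"
    by simp
  moreover have "(\<Sum>k. b k) = (\<Sum>k\<in>{0}. b k)"
    by (rule suminf_finite) (auto simp: b_def)
  moreover have "(\<Sum>k\<in>{0}. b k) = 1"
    by (simp add: b_def)
  ultimately show ?thesis by simp
qed

text \<open>The sum is 0 when C - A or C - B is a pole of Gamma; \<open>rGamma\<close> expresses
  this without a case distinction.\<close>

theorem gauss_sum:
  assumes C: "C \<notin> \<int>\<^sub>\<le>\<^sub>0" and re: "Re (C - A - B) > 0"
  shows "gauss_term A B C sums
    (Gamma C * Gamma (C - A - B) * rGamma (C - A) * rGamma (C - B))"
proof -
  have "(\<lambda>n. (rGamma_series (C - A) n * Gamma_series C n) * (rGamma_series (C - B) n * Gamma_series (C - A - B) n))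
     \<longlonglongrightarrow> (rGamma (C - A) * Gamma C) * (rGamma (C - B) * Gamma (C - A - B))"
    by (intro tendsto_intros)
  also have "(\<lambda>n. (rGamma_series (C - A) n * Gamma_series C n) * (rGamma_series (C - B) n * Gamma_series (C - A - B) n)) =
     (\<lambda>n. pochhammer (C - A) (Suc n) * pochhammer (C - B) (Suc n) / (pochhammer C (Suc n) * pochhammer (C - A - B) (Suc n)))"
  proof
    fix n
    \<comment> \<open>The first pair of Gamma sequences contributes n powr A, the second n powr
      (-A).\<close>
    have "exp ((C - (C - A)) * of_real (ln (of_nat n))) * exp ((C - A - B - (C - B)) * complex_of_real (ln (of_nat n))) = 1"
      unfolding exp_add[symmetric] by (simp add: algebra_simps)
    then show "(rGamma_series (C - A) n * Gamma_series C n) * (rGamma_series (C - B) n * Gamma_series (C - A - B) n) =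
     pochhammer (C - A) (Suc n) * pochhammer (C - B) (Suc n) / (pochhammer C (Suc n) * pochhammer (C - A - B) (Suc n))"
      unfolding rGamma_series_mult_Gamma_series by (simp add: field_simps del: pochhammer_Suc) 
  qed
  finally have "(\<lambda>n. pochhammer (C - A) (Suc n) * pochhammer (C - B) (Suc n) / (pochhammer C (Suc n) * pochhammer (C - A - B) (Suc n))
      * (\<Sum>k. gauss_term A B (C + of_nat (Suc n)) k)) \<longlonglongrightarrow>
      (rGamma (C - A) * Gamma C) * (rGamma (C - B) * Gamma (C - A - B)) * 1"
    by (intro tendsto_mult LIMSEQ_Suc[OF gauss_sum_tendsto])
  then have "(\<lambda>n::nat. \<Sum>k. gauss_term A B C k) \<longlonglongrightarrow>
      (rGamma (C - A) * Gamma C) * (rGamma (C - B) * Gamma (C - A - B)) * 1"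
    unfolding gauss_sum_shift[OF C re, symmetric] .
  then have "(\<Sum>k. gauss_term A B C k) = Gamma C * Gamma (C - A - B) * rGamma (C - A) * rGamma (C - B)"
    by (simp add: LIMSEQ_const_iff mult_ac)
  then show ?thesis
    using summable_sums[OF summable_gauss_term[OF re]] by simp
qed

subsection \<open>Growth of the Laguerre polynomials\<close>

text \<open>Discrete Gronwall inequality: a product of factors 1 + k i is at most the exponential of
  the sum of the k i.\<close>

lemma bounded_of_growth_summable:
  fixes E k :: "nat \<Rightarrow> real"
  assumes step: "\<And>n. n \<ge> N \<Longrightarrow> E (Suc n) \<le> (1 + k n) * E n"
    and nonneg: "\<And>n. n \<ge> N \<Longrightarrow> E n \<ge> 0" "\<And>n. k n \<ge> 0" and "summable k"
  obtains C where "\<And>n. n \<ge> N \<Longrightarrow> E n \<le> C"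
proof -
  have "E n \<le> exp (\<Sum>i<n. k i) * E N" if "n \<ge> N" for n
    using that
  proof (induction n rule: dec_induct)
    case base
    have "1 * E N \<le> exp (\<Sum>i<N. k i) * E N"
      using nonneg by (intro mult_right_mono) (auto intro: sum_nonneg)
    then show ?case by simp
  next
    case (step n)
    have "E (Suc n) \<le> (1 + k n) * E n"
      using assms(1) step.hyps by simp
    also have "\<dots> \<le> exp (k n) * (exp (\<Sum>i<n. k i) * E N)"
      using step nonneg exp_ge_add_one_self[of "k n"] by (intro mult_mono) auto
    finally show ?case by (simp add: exp_add mult_ac)
  qed
  moreover have "exp (\<Sum>i<n. k i) * E N \<le> exp (suminf k) * E N" for n
    using nonneg \<open>summable k\<close> by (intro mult_right_mono) (auto intro!: sum_le_suminf)
  ultimately show ?thesis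
    using that[of "exp (suminf k) * E N"] order_trans by blast
qed

text \<open>
  A discrete energy: when $\Re a \le -1/2$, its increments relative to its size are
  $O(n^{-3/2})$, hence summable, so it stays bounded.
\<close>

definition laguerre_energy :: "complex \<Rightarrow> real \<Rightarrow> nat \<Rightarrow> real" where
  "laguerre_energy a x n =
     real n * (norm (laguerre n a x))\<^sup>2 + x * (norm (laguerre n (a + 1) x))\<^sup>2
     - x * Re (cnj (laguerre n (a + 1) x) * laguerre n a x)"

text \<open>Here p and q stand for L_m at the orders a and a + 1, and p' for L_(m+1) at order a. The
  cross term of the energy is chosen so that, by the recurrence, q drops out of the increment. Since
  p' is close to p, the increment is about (1 + 2 Re a) |p|^2, which explains the condition Re a
  \<le> -1/2.\<close>

lemma energy_increment_identity:
  fixes p q p' a :: complex and m x :: real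
  assumes "(m + 1) * p' = (m + 1 + a) * p - x * q"
  shows "((m + 1) * (norm p')\<^sup>2 + x * (norm (q + p'))\<^sup>2 - x * Re (cnj (q + p') * p'))
     - (m * (norm p)\<^sup>2 + x * (norm q)\<^sup>2 - x * Re (cnj q * p))
     = (norm p)\<^sup>2 + Re (cnj (a * p) * (p + p'))"
proof -
  obtain p1 p2 q1 q2 a1 a2 r1 r2 where
    e: "p = Complex p1 p2" "q = Complex q1 q2" "a = Complex a1 a2" "p' = Complex r1 r2"
    by (metis complex.exhaust)
  have 1: "x * q1 = (m + 1 + a1) * p1 - a2 * p2 - (m + 1) * r1"
    and 2: "x * q2 = (m + 1 + a1) * p2 + a2 * p1 - (m + 1) * r2"
    using assms by (auto simp: e complex_eq_iff algebra_simps)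
  have "((m + 1) * (norm p')\<^sup>2 + x * (norm (q + p'))\<^sup>2 - x * Re (cnj (q + p') * p'))
     - (m * (norm p)\<^sup>2 + x * (norm q)\<^sup>2 - x * Re (cnj q * p))
     = (m + 1) * (r1\<^sup>2 + r2\<^sup>2) - m * (p1\<^sup>2 + p2\<^sup>2) + (x * q1) * (p1 + r1) + (x * q2) * (p2 + r2)"
    unfolding e cmod_power2 by (simp add: power2_eq_square algebra_simps)
  also have "\<dots> = (norm p)\<^sup>2 + Re (cnj (a * p) * (p + p'))"
    unfolding 1 2 unfolding e cmod_power2 by (simp add: power2_eq_square algebra_simps)
  finally show ?thesis .
qed

lemma laguerre_energy_increment:
  "laguerre_energy a x (Suc n) - laguerre_energy a x n =
     (norm (laguerre n a x))\<^sup>2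
       + Re (cnj (a * laguerre n a x) * (laguerre n a x + laguerre (Suc n) a x))"
proof -
  have "of_real (real n + 1) * laguerre (Suc n) a x =
      (of_real (real n + 1) + a) * laguerre n a x - of_real x * laguerre n (a + 1) x"
    using laguerre_Suc_mult[of n a "of_real x"] by (simp add: add_ac)
  from energy_increment_identity[of "real n", OF this]
  show ?thesis
    unfolding laguerre_energy_def laguerre_Suc_order[of n a "of_real x"] by (simp add: add_ac)
qed

text \<open>For n \<ge> x the inequality between the arithmetic and geometric means absorbs the
  cross term in half of the two squares.\<close>

lemma laguerre_energy_ge:
  assumes "x > 0" "real n \<ge> x"
  shows "laguerre_energy a x n \<ge>
    real n / 2 * (norm (laguerre n a x))\<^sup>2 + x / 2 * (norm (laguerre n (a + 1) x))\<^sup>2"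
proof -
  define p q where "p = laguerre n a x" and "q = laguerre n (a + 1) x"
  have "Re (cnj q * p) \<le> norm (cnj q * p)"
    by (rule complex_Re_le_cmod)
  also have "\<dots> = norm q * norm p"
    by (simp add: norm_mult)
  also have "\<dots> \<le> ((norm p)\<^sup>2 + (norm q)\<^sup>2) / 2"
    using sum_squares_bound[of "norm p" "norm q"] by (simp add: mult_ac)
  finally have "x * Re (cnj q * p) \<le> x * (((norm p)\<^sup>2 + (norm q)\<^sup>2) / 2)"
    using assms by (intro mult_left_mono) auto
  moreover have "x * (norm p)\<^sup>2 \<le> real n * (norm p)\<^sup>2"
    using assms by (intro mult_right_mono) auto
  ultimately show ?thesis
    unfolding laguerre_energy_def p_def[symmetric] q_def[symmetric]
    by (simp add: field_simps)
qed

lemma laguerre_energy_growth: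
  assumes x: "x > 0" and n: "real n \<ge> x" and a: "Re a \<le> - 1 / 2"
  shows "laguerre_energy a x (Suc n) \<le>
    (1 + (2 * (norm a)\<^sup>2 + 2 * norm a * sqrt x) * real n powr (- 3 / 2)) * laguerre_energy a x n"
proof -
  define p q p' E where "p = laguerre n a x" and "q = laguerre n (a + 1) x"
    and "p' = laguerre (Suc n) a x" and "E = laguerre_energy a x n"
  have n0: "real n > 0" using x n by simp
  have E: "real n / 2 * (norm p)\<^sup>2 + x / 2 * (norm q)\<^sup>2 \<le> E"
    using laguerre_energy_ge[OF x n, of a] by (simp add: p_def q_def E_def)
  have p2: "(norm p)\<^sup>2 \<le> 2 * E / real n"
  proof -
    have "real n / 2 * (norm p)\<^sup>2 \<le> E"
      using E x by (smt (verit) divide_nonneg_nonneg mult_nonneg_nonneg zero_le_power2)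
    then show ?thesis using n0 by (simp add: field_simps)
  qed
  have E0: "E \<ge> 0"
    using E x n0 by (smt (verit) divide_nonneg_nonneg mult_nonneg_nonneg zero_le_power2)
  have pq: "sqrt (real n) * sqrt x * (norm p * norm q) \<le> E"
  proof -
    have "sqrt (real n) * sqrt x * (norm p * norm q) \<le> ((sqrt (real n) * norm p)\<^sup>2 + (sqrt x * norm q)\<^sup>2) / 2"
      using sum_squares_bound[of "sqrt (real n) * norm p" "sqrt x * norm q"] by (simp add: mult_ac)
    also have "\<dots> = real n / 2 * (norm p)\<^sup>2 + x / 2 * (norm q)\<^sup>2"
      using n0 x by (simp add: power_mult_distrib field_simps)
    finally show ?thesis using E by simp
  qed
  have rec: "p' = p + (a * p - x * q) / (real n + 1)"
  proof -
    have "(real n + 1) * p' = (real n + 1 + a) * p - x * q"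
      using laguerre_Suc_mult[of n a "of_real x"] by (simp add: p_def q_def p'_def add_ac)
    moreover have "complex_of_real (real n + 1) \<noteq> 0"
      using n0 by (simp only: of_real_eq_0_iff)
    ultimately show ?thesis
      by (simp add: field_simps)
  qed
  have "laguerre_energy a x (Suc n) - E = (norm p)\<^sup>2 + Re (cnj (a * p) * (p + p'))"
    unfolding E_def p_def p'_def by (rule laguerre_energy_increment)
  also have "\<dots> = (norm p)\<^sup>2 * (1 + 2 * Re a) + Re (cnj (a * p) * (a * p - x * q)) / (real n + 1)"
  proof -
    have "p + p' = 2 * p + (a * p - x * q) / complex_of_real (real n + 1)"
      by (simp add: rec)
    then have "Re (cnj (a * p) * (p + p')) =
        Re (cnj (a * p) * (2 * p)) + Re (cnj (a * p) * (a * p - x * q) / complex_of_real (real n + 1))"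
      by (simp only: distrib_left plus_complex.simps times_divide_eq_right)
    also have "Re (cnj (a * p) * (2 * p)) = 2 * Re a * (norm p)\<^sup>2"
      unfolding cmod_power2 by (simp add: power2_eq_square algebra_simps)
    finally show ?thesis
      by (simp only: Re_divide_of_real) (simp add: algebra_simps)
  qed
  \<comment> \<open>The first summand is dropped by the sign of 1 + 2 Re a. The energy bounds |p|^2
    by 2 E / n and |p| |q| by E / sqrt (n x), so the remainder will be O(n powr (-3/2)) times
    E.\<close>
  also have "\<dots> \<le> 0 + ((norm a)\<^sup>2 * (norm p)\<^sup>2 + norm a * x * (norm p * norm q)) / (real n + 1)"
  proof (intro add_mono divide_right_mono)
    show "(norm p)\<^sup>2 * (1 + 2 * Re a) \<le> 0"
      using a by (intro mult_nonneg_nonpos) auto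
    have "Re (cnj (a * p) * (a * p - x * q)) \<le> norm (cnj (a * p) * (a * p - x * q))"
      by (rule complex_Re_le_cmod)
    also have "\<dots> \<le> (norm a * norm p) * (norm a * norm p + x * norm q)"
      unfolding norm_mult complex_mod_cnj
      using norm_triangle_ineq4[of "a * p" "x * q"] x
      by (intro mult_left_mono) (auto simp: norm_mult)
    finally show "Re (cnj (a * p) * (a * p - x * q)) \<le> (norm a)\<^sup>2 * (norm p)\<^sup>2 + norm a * x * (norm p * norm q)"
      by (simp add: power2_eq_square algebra_simps)
  qed auto
  also have "\<dots> \<le> 0 + ((norm a)\<^sup>2 * (2 * E / real n) + norm a * x * (E / (sqrt (real n) * sqrt x))) / real n"
    using x n0 p2 pq E0
    by (intro add_mono frac_le mult_left_mono add_nonneg_nonneg) (auto simp: field_simps)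
  also have "\<dots> \<le> ((2 * (norm a)\<^sup>2 + 2 * norm a * sqrt x) * real n powr (- 3 / 2)) * E"
  proof -
    have n1: "real n \<ge> 1" using n0 by simp
    have e: "real n powr (- 3 / 2) = 1 / (sqrt (real n) * real n)"
    proof -
      have "real n powr (3 / 2) = real n powr (1 / 2 + 1)" by simp
      also have "\<dots> = sqrt (real n) * real n"
        using n0 by (simp only: powr_add powr_half_sqrt) simp
      finally show ?thesis
        by (simp add: powr_minus_divide)
    qed
    have sq: "sqrt (real n) \<le> real n"
      by (rule real_le_lsqrt) (use n1 in \<open>auto simp: self_le_power\<close>)
    have "(norm a)\<^sup>2 * (2 * E / real n) \<le> (norm a)\<^sup>2 * (2 * E / sqrt (real n))"
      using n1 E0 sq by (intro mult_left_mono divide_left_mono) auto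
    moreover have "norm a * x * (E / (sqrt (real n) * sqrt x)) \<le> 2 * norm a * sqrt x * (E / sqrt (real n))"
    proof -
      have "norm a * x * (E / (sqrt (real n) * sqrt x)) = norm a * (x / sqrt x) * (E / sqrt (real n))"
        by simp
      also have "x / sqrt x = sqrt x"
        using x by (simp add: real_div_sqrt)
      also have "norm a * sqrt x * (E / sqrt (real n)) \<le> 2 * (norm a * sqrt x * (E / sqrt (real n)))"
      proof -
        have "0 \<le> norm a * sqrt x * (E / sqrt (real n))"
          using x E0 by simp
        moreover have "t \<le> 2 * t" if "0 \<le> t" for t :: real
          using that by simp
        ultimately show ?thesis by blast
      qed
      finally show ?thesis by simp
    qed
    ultimately have "((norm a)\<^sup>2 * (2 * E / real n) + norm a * x * (E / (sqrt (real n) * sqrt x))) / real n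
       \<le> ((norm a)\<^sup>2 * (2 * E / sqrt (real n)) + 2 * norm a * sqrt x * (E / sqrt (real n))) / real n"
      using n0 by (intro divide_right_mono add_mono) auto
    also have "\<dots> = ((2 * (norm a)\<^sup>2 + 2 * norm a * sqrt x) * real n powr (- 3 / 2)) * E"
      unfolding e using n0 by (simp add: field_simps)
    finally show ?thesis by simp
  qed
  finally show ?thesis
    by (simp add: E_def algebra_simps)
qed


text \<open>A bounded energy means that L_n is O(n^(-1/2)) at order a and O(1) at order a + 1. The
  claimed exponents are at least -1/2 and 0 exactly for Re a \<ge> -3/2, while the energy argument
  wants Re a \<le> -1/2; this is the strip.\<close>

lemma laguerre_bound_strip:
  assumes x: "x > 0" and a: "- 3 / 2 \<le> Re a" "Re a \<le> - 1 / 2"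
  shows "\<exists>K. \<forall>n. norm (laguerre n a (of_real x)) \<le> K * (real n + 1) powr (Re a / 2 + 1 / 4)"
    and "\<exists>K. \<forall>n. norm (laguerre n (a + 1) (of_real x)) \<le> K * (real n + 1) powr (Re (a + 1) / 2 + 1 / 4)"
proof -
  define N where "N = nat \<lceil>x\<rceil> + 1"
  have N: "real n \<ge> x" "real n \<ge> 1" if "n \<ge> N" for n
    using that by (auto simp: N_def) linarith+
  let ?E = "laguerre_energy a x"
  define k where "k n = (2 * (norm a)\<^sup>2 + 2 * norm a * sqrt x) * real n powr (- 3 / 2)" for n
  have "summable (\<lambda>n. real n powr (- 3 / 2))"
    by (simp add: summable_real_powr_iff)
  then have "summable k"
    unfolding k_def by (intro summable_mult)
  moreover have "?E (Suc n) \<le> (1 + k n) * ?E n" if "n \<ge> N" for n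
    unfolding k_def using x a N(1)[OF that] by (intro laguerre_energy_growth) auto
  moreover have E0: "?E n \<ge> real n / 2 * (norm (laguerre n a x))\<^sup>2 + x / 2 * (norm (laguerre n (a + 1) x))\<^sup>2"
      if "n \<ge> N" for n
    using x N(1)[OF that] by (rule laguerre_energy_ge)
  moreover have "?E n \<ge> 0" if "n \<ge> N" for n
  proof (rule order_trans[OF _ E0[OF that]])
    show "0 \<le> real n / 2 * (norm (laguerre n a x))\<^sup>2 + x / 2 * (norm (laguerre n (a + 1) x))\<^sup>2"
      using x by simp
  qed
  moreover have "k n \<ge> 0" for n
    using x by (simp add: k_def)
  ultimately obtain C where C: "\<And>n. n \<ge> N \<Longrightarrow> ?E n \<le> C"
    using bounded_of_growth_summable[of N ?E k] by metis
  have p: "norm (laguerre n a x) \<le> sqrt (4 * C) * (real n + 1) powr (Re a / 2 + 1 / 4)" if n: "n \<ge> N" for n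
  proof -
    have "real n / 2 * (norm (laguerre n a x))\<^sup>2 \<le> C"
      using C[OF n] E0[OF n] x by (smt (verit) divide_nonneg_nonneg mult_nonneg_nonneg zero_le_power2)
    then have "(norm (laguerre n a x))\<^sup>2 \<le> 2 * C / real n"
      using N(2)[OF n] by (simp add: field_simps)
    also have "\<dots> \<le> 4 * C / (real n + 1)"
    proof -
      have "C \<ge> 0"
        using \<open>real n / 2 * (norm (laguerre n a x))\<^sup>2 \<le> C\<close> by (smt (verit) divide_nonneg_nonneg mult_nonneg_nonneg zero_le_power2 of_nat_0_le_iff)
      then show ?thesis
        using N(2)[OF n] by (simp add: divide_simps) (simp add: algebra_simps mult_le_cancel_left1)
    qed
    also have "\<dots> = 4 * C * (real n + 1) powr (- 1)"
      by (simp add: powr_minus_divide)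
    also have "\<dots> = 4 * C * ((real n + 1) powr (- 1 / 2))\<^sup>2"
      by (simp add: power2_eq_square flip: powr_add)
    finally have "sqrt ((norm (laguerre n a x))\<^sup>2) \<le> sqrt (4 * C * ((real n + 1) powr (- 1 / 2))\<^sup>2)"
      by (rule real_sqrt_le_mono)
    then have "norm (laguerre n a x) \<le> sqrt (4 * C) * (real n + 1) powr (- 1 / 2)"
      by (simp add: real_sqrt_mult)
    also have "\<dots> \<le> sqrt (4 * C) * (real n + 1) powr (Re a / 2 + 1 / 4)"
    proof (intro mult_left_mono powr_mono)
      show "0 \<le> sqrt (4 * C)"
        using \<open>(norm (laguerre n a x))\<^sup>2 \<le> 2 * C / real n\<close>
        by (metis C E0 N(2) \<open>\<And>n. N \<le> n \<Longrightarrow> 0 \<le> laguerre_energy a x n\<close> mult_nonneg_nonneg n order_trans real_sqrt_ge_zero zero_le_numeral)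
    qed (use a in auto)
    finally show ?thesis .
  qed
  have q: "norm (laguerre n (a + 1) x) \<le> sqrt (2 * C / x) * (real n + 1) powr (Re (a + 1) / 2 + 1 / 4)" if n: "n \<ge> N" for n
  proof -
    have C0: "C \<ge> 0"
      using C n \<open>\<And>n. N \<le> n \<Longrightarrow> 0 \<le> laguerre_energy a x n\<close> order_trans by blast
    have r0: "0 \<le> Re (a + 1) / 2 + 1 / 4"
      using a by (simp add: field_simps)
    have "0 \<le> real n / 2 * (norm (laguerre n a x))\<^sup>2"
      by simp
    then have "x / 2 * (norm (laguerre n (a + 1) x))\<^sup>2 \<le> C"
      using C[OF n] E0[OF n] by linarith
    then have "(norm (laguerre n (a + 1) x))\<^sup>2 \<le> 2 * C / x"
      using x by (simp add: field_simps)
    then have "norm (laguerre n (a + 1) x) \<le> sqrt (2 * C / x) * 1"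
      using real_le_rsqrt by simp
    also have "\<dots> \<le> sqrt (2 * C / x) * (real n + 1) powr (Re (a + 1) / 2 + 1 / 4)"
      using x C0 by (intro mult_left_mono ge_one_powr_ge_zero r0) auto
    finally show ?thesis .
  qed
  \<comment> \<open>The finitely many indices below N are absorbed in the constant.\<close>
  have "\<exists>K. \<forall>n. norm (f n) \<le> K * (real n + 1) powr r"
    if "\<And>n. n \<ge> N \<Longrightarrow> norm (f n) \<le> K * (real n + 1) powr r" for f :: "nat \<Rightarrow> complex" and K r
  proof -
    define g where "g n = norm (f n) / (real n + 1) powr r" for n
    define K' where "K' = \<bar>K\<bar> + (\<Sum>i<N. g i)"
    have g0: "g n \<ge> 0" for n by (simp add: g_def)
    have "g n \<le> K'" for n
    proof (cases "n < N")
      case True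
      then have "g n \<le> (\<Sum>i<N. g i)"
        using g0 by (intro member_le_sum) auto
      then show ?thesis by (simp add: K'_def)
    next
      case False
      then have "g n \<le> K"
        using that[of n] by (simp add: g_def divide_simps)
      moreover have "(\<Sum>i<N. g i) \<ge> 0" using g0 by (simp add: sum_nonneg)
      ultimately show ?thesis by (simp add: K'_def)
    qed
    then show ?thesis
      by (intro exI[of _ K']) (simp add: g_def divide_simps)
  qed
  from this[OF p] this[OF q]
  show "\<exists>K. \<forall>n. norm (laguerre n a (of_real x)) \<le> K * (real n + 1) powr (Re a / 2 + 1 / 4)"
    and "\<exists>K. \<forall>n. norm (laguerre n (a + 1) (of_real x)) \<le> K * (real n + 1) powr (Re (a + 1) / 2 + 1 / 4)"
    by blast+
qed

section \<open>Extension of the growth bound to all orders\<close>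

definition laguerre_bounded :: "complex \<Rightarrow> complex \<Rightarrow> bool" where
  "laguerre_bounded z a \<longleftrightarrow>
     (\<exists>K. \<forall>n. norm (laguerre n a z) \<le> K * (real n + 1) powr (Re a / 2 + 1 / 4))"

lemma laguerre_boundedE:
  assumes "laguerre_bounded z a"
  obtains K where "K > 0" "\<And>n. norm (laguerre n a z) \<le> K * (real n + 1) powr (Re a / 2 + 1 / 4)"
proof -
  obtain K where K: "\<And>n. norm (laguerre n a z) \<le> K * (real n + 1) powr (Re a / 2 + 1 / 4)"
    using assms by (auto simp: laguerre_bounded_def)
  have "norm (laguerre n a z) \<le> (\<bar>K\<bar> + 1) * (real n + 1) powr (Re a / 2 + 1 / 4)" for n
    by (rule order_trans[OF K mult_right_mono]) auto
  then show ?thesis using that[of "\<bar>K\<bar> + 1"] by simp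
qed

text \<open>Division of \<open>laguerre_Suc_order2\<close> by n + 1 lowers exponents by 1, which is
  exactly the gap between the exponents for a + 2 and a; the term of order a + 1 has 1/2 to
  spare.\<close>

lemma laguerre_bounded_down:
  assumes "laguerre_bounded z (a + 1)" "laguerre_bounded z (a + 2)"
  shows "laguerre_bounded z a"
proof -
  let ?r = "Re a / 2 + 1 / 4"
  obtain K where K: "K > 0" "\<And>n. norm (laguerre n (a + 1) z) \<le> K * (real n + 1) powr (Re (a + 1) / 2 + 1 / 4)"
    using assms laguerre_boundedE by blast
  obtain L where L: "L > 0" "\<And>n. norm (laguerre n (a + 2) z) \<le> L * (real n + 1) powr (Re (a + 2) / 2 + 1 / 4)"
    using assms laguerre_boundedE by blast
  have "norm (laguerre (Suc n) a z) \<le> (norm (a + 1) * K + norm z * L) * (real n + 1) powr ?r" for n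
  proof -
    have "(real n + 1) * norm (laguerre (Suc n) a z) = norm (of_nat (Suc n) * laguerre (Suc n) a z)"
      unfolding norm_mult norm_of_nat by simp
    also have "\<dots> \<le> norm (a + 1) * norm (laguerre n (a + 1) z) + norm z * norm (laguerre n (a + 2) z)"
      unfolding laguerre_Suc_order2 norm_mult[symmetric] by (rule norm_triangle_ineq4)
    also have "\<dots> \<le> norm (a + 1) * (K * (real n + 1) powr (?r + 1)) + norm z * (L * (real n + 1) powr (?r + 1))"
    proof (intro add_mono mult_left_mono)
      have "(real n + 1) powr (Re (a + 1) / 2 + 1 / 4) \<le> (real n + 1) powr (?r + 1)"
        by (rule powr_mono) (auto simp: field_simps)
      then show "norm (laguerre n (a + 1) z) \<le> K * (real n + 1) powr (?r + 1)"
        using K(1) by (intro order_trans[OF K(2)] mult_left_mono) auto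
      show "norm (laguerre n (a + 2) z) \<le> L * (real n + 1) powr (?r + 1)"
        using L(2)[of n] by (simp add: field_simps)
    qed auto
    also have "\<dots> = (real n + 1) * ((norm (a + 1) * K + norm z * L) * (real n + 1) powr ?r)"
      unfolding powr_add by (simp add: algebra_simps)
    finally show ?thesis
      by (rule mult_left_le_imp_le) simp
  qed
  from powr_bound_shift'[of "\<lambda>n. laguerre n a z", OF this] show ?thesis
    unfolding laguerre_bounded_def by metis
qed

text \<open>The same relation, solved for order a + 2; this divides by z.\<close>

lemma laguerre_bounded_up:
  assumes "laguerre_bounded z a" "laguerre_bounded z (a + 1)" "z \<noteq> 0"
  shows "laguerre_bounded z (a + 2)"
proof -
  let ?r = "Re (a + 2) / 2 + 1 / 4"
  obtain K where K: "K > 0" "\<And>n. norm (laguerre n a z) \<le> K * (real n + 1) powr (Re a / 2 + 1 / 4)"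
    using assms laguerre_boundedE by blast
  obtain L where L: "L > 0" "\<And>n. norm (laguerre n (a + 1) z) \<le> L * (real n + 1) powr (Re (a + 1) / 2 + 1 / 4)"
    using assms laguerre_boundedE by blast
  define J where "J = 2 powr \<bar>Re a / 2 + 1 / 4\<bar>"
  have "norm (laguerre n (a + 2) z) \<le> (norm (a + 1) * L + K * J) / norm z * (real n + 1) powr ?r" for n
  proof -
    have J: "(real n + 2) powr (Re a / 2 + 1 / 4) \<le> J * (real n + 1) powr (Re a / 2 + 1 / 4)"
      unfolding J_def by (intro powr_le_comparable) auto
    have "z * laguerre n (a + 2) z = (a + 1) * laguerre n (a + 1) z - of_nat (Suc n) * laguerre (Suc n) a z"
      unfolding laguerre_Suc_order2 by simp
    then have "norm z * norm (laguerre n (a + 2) z) =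
        norm ((a + 1) * laguerre n (a + 1) z - of_nat (Suc n) * laguerre (Suc n) a z)"
      by (simp only: norm_mult[symmetric])
    also have "\<dots> \<le> norm ((a + 1) * laguerre n (a + 1) z) + norm (of_nat (Suc n) * laguerre (Suc n) a z)"
      by (rule norm_triangle_ineq4)
    also have "\<dots> = norm (a + 1) * norm (laguerre n (a + 1) z) + (real n + 1) * norm (laguerre (Suc n) a z)"
      unfolding norm_mult norm_of_nat by simp
    also have "\<dots> \<le> norm (a + 1) * (L * (real n + 1) powr ?r) + (real n + 1) * (K * (J * (real n + 1) powr (Re a / 2 + 1 / 4)))"
    proof (intro add_mono mult_left_mono)
      have "(real n + 1) powr (Re (a + 1) / 2 + 1 / 4) \<le> (real n + 1) powr ?r"
        by (rule powr_mono) (auto simp: field_simps)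
      then show "norm (laguerre n (a + 1) z) \<le> L * (real n + 1) powr ?r"
        using L(1) by (intro order_trans[OF L(2)] mult_left_mono) auto
      have "norm (laguerre (Suc n) a z) \<le> K * (real n + 2) powr (Re a / 2 + 1 / 4)"
        using K(2)[of "Suc n"] by (simp add: add_ac)
      also have "\<dots> \<le> K * (J * (real n + 1) powr (Re a / 2 + 1 / 4))"
        using K(1) J by (intro mult_left_mono) auto
      finally show "norm (laguerre (Suc n) a z) \<le> K * (J * (real n + 1) powr (Re a / 2 + 1 / 4))" .
    qed auto
    also have "\<dots> = (norm (a + 1) * L + K * J) * (real n + 1) powr ?r"
    proof -
      have "?r = (Re a / 2 + 1 / 4) + 1" by (simp add: field_simps)
      then have "(real n + 1) powr ?r = (real n + 1) powr (Re a / 2 + 1 / 4) * (real n + 1)"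
        by (simp only: powr_add) simp
      then show ?thesis by (simp add: algebra_simps)
    qed
    finally show ?thesis
      using \<open>z \<noteq> 0\<close> by (simp add: field_simps)
  qed
  then show ?thesis
    unfolding laguerre_bounded_def by blast
qed

theorem laguerre_bound:
  assumes "x > 0"
  shows "laguerre_bounded (of_real x) a"
proof -
  \<comment> \<open>Chosen so that c = a - m falls into the strip of
    \<open>laguerre_bound_strip\<close>.\<close>
  define m where "m = \<lfloor>Re a + 3 / 2\<rfloor>"
  define c where "c = a - of_int m"
  have c: "- 3 / 2 \<le> Re c" "Re c \<le> - 1 / 2"
    unfolding c_def m_def minus_complex.simps complex_Re_of_int by linarith+
  \<comment> \<open>A step up or down uses two consecutive orders, so the induction carries a
    pair.\<close>
  have "laguerre_bounded (of_real x) (c + of_int k) \<and> laguerre_bounded (of_real x) (c + of_int k + 1)" for k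
  proof (induction k rule: int_induct[where k = 0])
    case base
    then show ?case
      using laguerre_bound_strip[OF assms c] by (simp add: laguerre_bounded_def)
  next
    case (step1 i)
    then show ?case
      using laguerre_bounded_up[of "of_real x" "c + of_int i"] assms by (simp add: add_ac)
  next
    case (step2 i)
    then show ?case
      using laguerre_bounded_down[of "of_real x" "c + of_int (i - 1)"] by (simp add: algebra_simps)
  qed
  from this[of m] show ?thesis by (simp add: c_def)
qed

subsection \<open>The series for the Kummer function of the first kind\<close>

text \<open>The product majorant gives absolute summability over all pairs, and then Fubini applies
  to each way of slicing them. The diagonal sums serve the M-series, rows and columns the
  U-series.\<close>

lemma double_series:
  fixes f :: "nat \<Rightarrow> nat \<Rightarrow> complex" and u v :: "nat \<Rightarrow> real"
  assumes bound: "\<And>j k. norm (f j k) \<le> u j * v k"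
    and "summable u" "summable v" and nonneg: "\<And>j. u j \<ge> 0" "\<And>k. v k \<ge> 0"
  obtains S where "(\<lambda>j. \<Sum>k. f j k) sums S" "(\<lambda>k. \<Sum>j. f j k) sums S"
    "(\<lambda>n. \<Sum>j\<le>n. f j (n - j)) sums S"
proof -
  have su: "u summable_on UNIV" and sv: "v summable_on UNIV"
    using assms by (auto simp: summable_on_UNIV_nonneg_real_iff)
  have "(\<lambda>p. u (fst p) * v (snd p)) summable_on (UNIV \<times> UNIV)"
  proof (rule summable_on_SigmaI)
    show "((\<lambda>k. u (fst (j, k)) * v (snd (j, k))) has_sum u j * infsum v UNIV) UNIV" for j
      using has_sum_cmult_right[OF has_sum_infsum[OF sv], of "u j"] by simp
    show "(\<lambda>j. u j * infsum v UNIV) summable_on UNIV"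
      using summable_on_cmult_left[OF su] .
  qed (use nonneg in auto)
  then have "(\<lambda>p. norm (f (fst p) (snd p))) summable_on (UNIV \<times> UNIV)"
    by (rule Infinite_Sum.abs_summable_on_comparison_test'[where g = "\<lambda>p. u (fst p) * v (snd p)"]) (use bound in auto)
  then have "(\<lambda>p. f (fst p) (snd p)) summable_on (UNIV \<times> UNIV)"
    by (rule abs_summable_summable)
  then obtain S where S: "((\<lambda>p. f (fst p) (snd p)) has_sum S) (UNIV \<times> UNIV)"
    by (auto simp: summable_on_def)
  have row: "(f j has_sum (\<Sum>k. f j k)) UNIV" for j
  proof (rule norm_summable_imp_has_sum)
    show *: "summable (\<lambda>k. norm (f j k))"
      by (rule summable_comparison_test'[OF summable_mult[OF \<open>summable v\<close>, of "u j"]]) (use bound in auto)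
    show "f j sums (\<Sum>k. f j k)"
      using summable_norm_cancel[OF *] by (rule summable_sums)
  qed
  have col: "((\<lambda>j. f j k) has_sum (\<Sum>j. f j k)) UNIV" for k
  proof (rule norm_summable_imp_has_sum)
    show *: "summable (\<lambda>j. norm (f j k))"
      by (rule summable_comparison_test'[OF summable_mult2[OF \<open>summable u\<close>, of "v k"]]) (use bound in auto)
    show "(\<lambda>j. f j k) sums (\<Sum>j. f j k)"
      using summable_norm_cancel[OF *] by (rule summable_sums)
  qed
  have "((\<lambda>j. \<Sum>k. f j k) has_sum S) UNIV"
    by (rule has_sum_SigmaD[OF S]) (use row in auto)
  moreover have "((\<lambda>p. f (snd p) (fst p)) has_sum S) (UNIV \<times> UNIV)"
    using S by (subst has_sum_reindex_bij_witness[where j = prod.swap and i = prod.swap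
          and T = "UNIV \<times> UNIV" and h = "\<lambda>p. f (fst p) (snd p)"]) auto
  then have "((\<lambda>k. \<Sum>j. f j k) has_sum S) UNIV"
    by (rule has_sum_SigmaD) (use col in auto)
  moreover have "((\<lambda>p. f (snd p) (fst p - snd p)) has_sum S) (SIGMA n:UNIV. {..n})"
    using S by (subst has_sum_reindex_bij_witness[where j = "\<lambda>p. (snd p, fst p - snd p)"
          and i = "\<lambda>p. (fst p + snd p, fst p)"
          and T = "UNIV \<times> UNIV" and h = "\<lambda>p. f (fst p) (snd p)"]) auto
  then have "((\<lambda>n. \<Sum>j\<le>n. f j (n - j)) has_sum S) UNIV"
    by (rule has_sum_SigmaD) auto
  ultimately show ?thesis
    using that has_sum_imp_sums by blast
qed

definition kummer_term :: "complex \<Rightarrow> complex \<Rightarrow> complex \<Rightarrow> nat \<Rightarrow> complex" where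
  "kummer_term a b z i = pochhammer a i / pochhammer b i * z ^ i / fact i"

lemma kummer_M_eq: "kummer_M a b z = (\<Sum>i. kummer_term a b z i)"
proof -
  have "((a + of_nat i - 1) gchoose i) / ((b + of_nat i - 1) gchoose i) * z ^ i / fact i = kummer_term a b z i" for i
    by (simp add: kummer_term_def gbinomial_pochhammer')
  then show ?thesis
    by (simp add: kummer_M_def)
qed

lemma powr_le_power: "(real n + 1) powr r \<le> exp \<bar>r\<bar> ^ n"
proof -
  have "(real n + 1) powr r \<le> (real n + 1) powr \<bar>r\<bar>"
    by (rule powr_mono) auto
  also have "\<dots> = exp (\<bar>r\<bar> * ln (1 + real n))"
    by (simp add: powr_def add.commute)
  also have "\<dots> \<le> exp (\<bar>r\<bar> * real n)"
    using ln_add_one_self_le_self[of "real n"] by (simp add: mult_left_mono)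
  also have "\<dots> = exp \<bar>r\<bar> ^ n"
    by (simp add: exp_of_nat_mult[symmetric] mult.commute)
  finally show ?thesis .
qed

lemma summable_powr_exp:
  assumes "c \<ge> 0"
  shows "summable (\<lambda>n. (real n + 1) powr r * c ^ n / fact n)"
proof (rule summable_comparison_test'[where g = "\<lambda>n. (exp \<bar>r\<bar> * c) ^ n / fact n"])
  show "summable (\<lambda>n. (exp \<bar>r\<bar> * c) ^ n / fact n)"
    using summable_exp[of "exp \<bar>r\<bar> * c"] by (simp add: divide_inverse mult.commute)
  show "norm ((real n + 1) powr r * c ^ n / fact n) \<le> (exp \<bar>r\<bar> * c) ^ n / fact n" for n
    using assms powr_le_power[of n r]
    by (simp add: power_mult_distrib divide_right_mono mult_right_mono)
qed

lemma summable_norm_kummer_term: "summable (\<lambda>i. norm (kummer_term a b z i))"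
proof -
  obtain K where K: "\<And>n. norm (pochhammer a n / pochhammer b n) \<le> K * (real n + 1) powr Re (a - b)"
    using pochhammer_ratio_bound by blast
  show ?thesis
  proof (rule summable_comparison_test'[OF summable_mult[OF summable_powr_exp[OF norm_ge_zero[of z], of "Re (a - b)"], of K]])
    fix n
    have "norm (kummer_term a b z n) = norm (pochhammer a n / pochhammer b n) * (norm z ^ n / fact n)"
      by (simp add: kummer_term_def norm_mult norm_divide norm_power)
    also have "\<dots> \<le> K * (real n + 1) powr Re (a - b) * (norm z ^ n / fact n)"
      using K by (intro mult_right_mono) auto
    finally show "norm (norm (kummer_term a b z n)) \<le> K * ((real n + 1) powr Re (a - b) * norm z ^ n / fact n)"
      by (simp add: mult_ac)
  qed
qed

lemmas summable_kummer_term = summable_norm_cancel[OF summable_norm_kummer_term]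

lemma kummer_sums: "kummer_term a b z sums kummer_M a b z"
  unfolding kummer_M_eq using summable_kummer_term by (rule summable_sums)

lemma chu_vandermonde:
  fixes b p :: complex
  assumes "b \<notin> \<int>\<^sub>\<le>\<^sub>0"
  shows "(\<Sum>j\<le>n. of_nat (n choose j) * (-1) ^ j * pochhammer p j / pochhammer b j) =
    pochhammer (b - p) n / pochhammer b n"
  using assms
proof (induction n arbitrary: p b)
  case (Suc n)
  let ?t = "\<lambda>n p b j. of_nat (n choose j) * (-1) ^ j * pochhammer p j / pochhammer b j :: complex"
  have b0: "b \<noteq> 0" and bn: "b + of_nat n \<noteq> 0" and pn: "pochhammer b n \<noteq> 0" and b1: "b + 1 \<notin> \<int>\<^sub>\<le>\<^sub>0"
    using Suc.prems plus_nat_notin_nonpos_Ints[OF Suc.prems, of n] plus_nat_notin_nonpos_Ints[OF Suc.prems, of 1]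
    by (auto simp: pochhammer_eq_0_iff)
  have "(\<Sum>j\<le>Suc n. ?t (Suc n) p b j) = 1 + (\<Sum>j\<le>n. ?t (Suc n) p b (Suc j))"
    by (subst sum.atMost_Suc_shift) simp
  \<comment> \<open>Pascal's rule. The second part is a sum of the same kind with p + 1 and b + 1,
    which is why the induction leaves p and b arbitrary.\<close>
  also have "(\<Sum>j\<le>n. ?t (Suc n) p b (Suc j)) =
      (\<Sum>j\<le>n. ?t n p b (Suc j)) + (\<Sum>j\<le>n. - (p / b) * ?t n (p + 1) (b + 1) j)"
    unfolding sum.distrib[symmetric]
    by (intro sum.cong) (auto simp: pochhammer_rec divide_inverse algebra_simps)
  also have "1 + ((\<Sum>j\<le>n. ?t n p b (Suc j)) + (\<Sum>j\<le>n. - (p / b) * ?t n (p + 1) (b + 1) j)) =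
      (\<Sum>j\<le>Suc n. ?t n p b j) - p / b * (\<Sum>j\<le>n. ?t n (p + 1) (b + 1) j)"
    by (subst sum.atMost_Suc_shift) (simp add: sum_distrib_left sum_negf)
  also have "(\<Sum>j\<le>Suc n. ?t n p b j) = (\<Sum>j\<le>n. ?t n p b j)"
    by simp
  also have "(\<Sum>j\<le>n. ?t n p b j) = pochhammer (b - p) n / pochhammer b n"
    by (rule Suc.IH[OF Suc.prems])
  also have "(\<Sum>j\<le>n. ?t n (p + 1) (b + 1) j) = pochhammer (b - p) n / pochhammer (b + 1) n"
    using Suc.IH[OF b1, of "p + 1"] by simp
  also have "pochhammer (b + 1) n = (b + of_nat n) / b * pochhammer b n"
    using pochhammer_rec[of b n] b0 by (simp add: pochhammer_Suc field_simps)
  also have "pochhammer (b - p) n / pochhammer b n - p / b * (pochhammer (b - p) n / ((b + of_nat n) / b * pochhammer b n)) =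
      pochhammer (b - p) n * (b - p + of_nat n) / (pochhammer b n * (b + of_nat n))"
    using b0 bn pn by (simp add: divide_simps) (simp add: algebra_simps)
  finally show ?case
    by (simp add: pochhammer_Suc)
qed simp

text \<open>The right-hand side is a Cauchy product whose coefficients are Chu-Vandermonde sums with
  p = b - a.\<close>

lemma kummer_transformation:
  assumes "b \<notin> \<int>\<^sub>\<le>\<^sub>0"
  shows "kummer_M a b z = exp z * kummer_M (b - a) b (- z)"
proof -
  have "(\<Sum>j\<le>n. kummer_term (b - a) b (- z) j * (z ^ (n - j) /\<^sub>R fact (n - j))) = kummer_term a b z n" for n
  proof -
    have "(\<Sum>j\<le>n. kummer_term (b - a) b (- z) j * (z ^ (n - j) /\<^sub>R fact (n - j))) =
        (\<Sum>j\<le>n. (of_nat (n choose j) * (-1) ^ j * pochhammer (b - a) j / pochhammer b j) * (z ^ n / fact n))"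
    proof (rule sum.cong)
      fix j assume "j \<in> {..n}"
      then have e: "z ^ n = z ^ j * z ^ (n - j)" "of_nat (n choose j) = fact n / (fact j * fact (n - j) :: complex)"
        by (auto simp: power_add[symmetric] binomial_fact)
      then show "kummer_term (b - a) b (- z) j * (z ^ (n - j) /\<^sub>R fact (n - j)) =
          of_nat (n choose j) * (-1) ^ j * pochhammer (b - a) j / pochhammer b j * (z ^ n / fact n)"
        unfolding kummer_term_def e power_minus[of z j] by (simp add: scaleR_conv_of_real divide_inverse)
    qed auto
    also have "\<dots> = kummer_term a b z n"
      unfolding sum_distrib_right[symmetric] chu_vandermonde[OF assms] by (simp add: kummer_term_def)
    finally show ?thesis .
  qed
  then have "kummer_M a b z = (\<Sum>n. \<Sum>j\<le>n. kummer_term (b - a) b (- z) j * (z ^ (n - j) /\<^sub>R fact (n - j)))"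
    by (simp add: kummer_M_eq)
  also have "\<dots> = kummer_M (b - a) b (- z) * exp z"
    unfolding kummer_M_eq exp_def
    by (intro Cauchy_product[symmetric] summable_norm_kummer_term summable_norm_exp)
  finally show ?thesis by (simp add: mult.commute)
qed


lemma Re_pos_notin_nonpos_Ints: "Re z > 0 \<Longrightarrow> z \<notin> \<int>\<^sub>\<le>\<^sub>0"
  by (auto elim!: nonpos_Ints_cases)

text \<open>At order \<beta> - i the binomial coefficients in L_i have upper argument \<beta>, free
  of i. With k = i - j the series therefore becomes a double series in j and k whose diagonal sums
  are the given terms.\<close>

lemma kummer_M_part:
  assumes re: "Re (b - a) > 0" and b: "b \<notin> \<int>\<^sub>\<le>\<^sub>0" and c: "b - \<beta> \<notin> \<int>\<^sub>\<le>\<^sub>0"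
  shows "(\<lambda>i. (- 1) ^ i * laguerre i (\<beta> - of_nat i) z * (((- a) gchoose i) / ((\<beta> - b) gchoose i)))
    sums (kummer_M a b z * (Gamma (b - \<beta>) * Gamma (b - a) * rGamma b * rGamma (b - \<beta> - a)))"
proof -
  define c where "c = b - \<beta>"
  define f where "f j k = z ^ j / fact j * (pochhammer (- \<beta>) k / fact k) * (pochhammer a (j + k) / pochhammer c (j + k))" for j k
  obtain K where K: "K > 0" "\<And>n. norm (pochhammer a n / pochhammer c n) \<le> K * (real n + 1) powr Re (a - c)"
    using pochhammer_ratio_bound by blast
  obtain L where L: "L > 0" "\<And>n. norm (pochhammer (- \<beta>) n / pochhammer 1 n) \<le> L * (real n + 1) powr Re (- \<beta> - 1)"
    using pochhammer_ratio_bound by blast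
  define r where "r = Re (a - c)"
  define u where "u j = K * L * ((real j + 1) powr \<bar>r\<bar> * norm z ^ j / fact j)" for j
  define v where "v k = (real k + 1) powr (Re (a - b) - 1)" for k
  have bound: "norm (f j k) \<le> u j * v k" for j k
  proof -
    \<comment> \<open>Separates the variables: j + k + 1 \<le> (j + 1) (k + 1) for r \<ge> 0,
      monotonicity for r < 0. The power of j + 1 is harmless next to 1 / j!.\<close>
    have "(real (j + k) + 1) powr r \<le> (real j + 1) powr \<bar>r\<bar> * (real k + 1) powr r"
    proof (cases "r \<ge> 0")
      case True
      have "real (j + k) + 1 \<le> (real j + 1) * (real k + 1)"
        by (simp add: algebra_simps)
      then have "(real (j + k) + 1) powr r \<le> ((real j + 1) * (real k + 1)) powr r"
        using True by (intro powr_mono2) auto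
      then show ?thesis using True by (simp add: powr_mult)
    next
      case False
      then have "(real (j + k) + 1) powr r \<le> 1 * (real k + 1) powr r"
        using powr_mono2'[of r "real k + 1" "real (j + k) + 1"] by simp
      also have "\<dots> \<le> (real j + 1) powr \<bar>r\<bar> * (real k + 1) powr r"
        by (intro mult_right_mono ge_one_powr_ge_zero) auto
      finally show ?thesis .
    qed
    then have "K * (real (j + k) + 1) powr r \<le> K * ((real j + 1) powr \<bar>r\<bar> * (real k + 1) powr r)"
      using K(1) by (intro mult_left_mono) auto
    then have P: "norm (pochhammer a (j + k) / pochhammer c (j + k)) \<le> K * ((real j + 1) powr \<bar>r\<bar> * (real k + 1) powr r)"
      using K(2)[of "j + k"] unfolding r_def by linarith
    have "norm (f j k) = norm z ^ j / fact j * norm (pochhammer (- \<beta>) k / pochhammer 1 k)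
        * norm (pochhammer a (j + k) / pochhammer c (j + k))"
      by (simp add: f_def norm_mult norm_divide norm_power flip: pochhammer_fact)
    also have "\<dots> \<le> norm z ^ j / fact j * (L * (real k + 1) powr Re (- \<beta> - 1))
        * (K * ((real j + 1) powr \<bar>r\<bar> * (real k + 1) powr r))"
      using L P by (intro mult_mono) auto
    also have "\<dots> = u j * ((real k + 1) powr Re (- \<beta> - 1) * (real k + 1) powr r)"
      by (simp add: u_def)
    also have "(real k + 1) powr Re (- \<beta> - 1) * (real k + 1) powr r = v k"
      unfolding powr_add[symmetric] v_def r_def c_def by (simp add: algebra_simps)
    finally show ?thesis .
  qed
  have su: "summable u"
    unfolding u_def by (intro summable_mult summable_powr_exp) auto
  have sv: "summable v"
    unfolding v_def using re by (intro summable_powr_minus) simp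
  have nonneg: "u j \<ge> 0" "v k \<ge> 0" for j k
    using K(1) L(1) by (auto simp: u_def v_def)
  define G where "G = Gamma c * Gamma (b - a) * rGamma b * rGamma (c - a)"
  \<comment> \<open>Gauss's theorem with A = -\<beta>, B = a + j, C = c + j. Here C - A - B = b - a
    for every j, so the hypothesis on b - a is the convergence condition; the values at C and C - A
    = b + j turn (a)_j / (c)_j into (a)_j / (b)_j.\<close>
  have row: "(\<Sum>k. f j k) = kummer_term a b z j * G" for j
  proof -
    have cj: "c + of_nat j \<notin> \<int>\<^sub>\<le>\<^sub>0"
      unfolding c_def using plus_nat_notin_nonpos_Ints[OF c] .
    have f: "f j k = z ^ j / fact j * (pochhammer a j / pochhammer c j) * gauss_term (- \<beta>) (a + of_nat j) (c + of_nat j) k" for k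
      by (simp add: f_def gauss_term_def pochhammer_product' mult_ac)
    have pc: "pochhammer c j \<noteq> 0"
      using c by (auto simp: c_def[symmetric] pochhammer_eq_0_iff)
    have e: "c + of_nat j - (- \<beta>) - (a + of_nat j) = b - a" "c + of_nat j - (- \<beta>) = b + of_nat j"
        "c + of_nat j - (a + of_nat j) = c - a"
      by (simp_all add: c_def)
    have "gauss_term (- \<beta>) (a + of_nat j) (c + of_nat j) sums
        (Gamma (c + of_nat j) * Gamma (b - a) * rGamma (b + of_nat j) * rGamma (c - a))"
      using gauss_sum[OF cj, of "- \<beta>" "a + of_nat j"] re unfolding e by simp
    from sums_mult[OF this, of "z ^ j / fact j * (pochhammer a j / pochhammer c j)"]
    have "(\<Sum>k. f j k) = z ^ j / fact j * (pochhammer a j / pochhammer c j) *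
        (Gamma (c + of_nat j) * Gamma (b - a) * rGamma (b + of_nat j) * rGamma (c - a))"
      unfolding f by (simp add: sums_iff)
    also have "Gamma (c + of_nat j) = pochhammer c j * Gamma c"
      using pochhammer_Gamma[of c j] c by (simp add: c_def Gamma_eq_zero_iff)
    also have "rGamma (b + of_nat j) = rGamma b / pochhammer b j"
      using pochhammer_rGamma[of b j] b plus_nat_notin_nonpos_Ints[OF b, of j]
      by (auto simp: rGamma_eq_zero_iff pochhammer_eq_0_iff)
    finally show ?thesis
      using pc by (simp add: G_def kummer_term_def mult_ac)
  qed
  obtain S where S: "(\<lambda>j. \<Sum>k. f j k) sums S" "(\<lambda>k. \<Sum>j. f j k) sums S"
      "(\<lambda>n. \<Sum>j\<le>n. f j (n - j)) sums S"
    by (rule double_series[OF bound su sv nonneg])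
  have "S = kummer_M a b z * G"
    using S(1) sums_mult2[OF kummer_sums[of a b z], of G] unfolding row by (rule sums_unique2)
  moreover have "(\<Sum>j\<le>i. f j (i - j)) =
      (- 1) ^ i * laguerre i (\<beta> - of_nat i) z * (((- a) gchoose i) / ((\<beta> - b) gchoose i))" for i
  proof -
    have 1: "((- a) gchoose i) / ((\<beta> - b) gchoose i) = pochhammer a i / pochhammer c i"
      by (simp add: c_def gbinomial_pochhammer)
    have 2: "(- 1) ^ i * laguerre i (\<beta> - of_nat i) z = (\<Sum>j\<le>i. z ^ j / fact j * (pochhammer (- \<beta>) (i - j) / fact (i - j)))"
      unfolding laguerre_def sum_distrib_left
    proof (rule sum.cong)
      fix j assume "j \<in> {..i}"
      then have "(- 1 :: complex) ^ i = (-1) ^ j * (-1) ^ (i - j)"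
        by (simp add: power_add[symmetric])
      moreover have "\<beta> gchoose (i - j) = (-1) ^ (i - j) * pochhammer (- \<beta>) (i - j) / fact (i - j)"
        by (simp add: gbinomial_pochhammer)
      ultimately show "(- 1) ^ i * ((- 1) ^ j * (of_nat i + (\<beta> - of_nat i) gchoose (i - j)) * z ^ j / fact j) =
          z ^ j / fact j * (pochhammer (- \<beta>) (i - j) / fact (i - j))"
        by (simp add: mult_ac)
    qed auto
    show ?thesis
      unfolding 1 2 sum_distrib_right by (intro sum.cong) (auto simp: f_def)
  qed
  ultimately show ?thesis
    using S(3) by (simp add: G_def c_def)
qed

section \<open>Removable singularities and the final form of the M-series\<close>

lemma eventually_notin_Ints: "eventually (\<lambda>w. w \<notin> \<int>) (at (b :: complex))"
proof -
  have ev: "eventually (\<lambda>w. w \<notin> \<int>) (at b)" if b: "b \<in> \<int>"  for b :: complex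
    unfolding eventually_at
  proof (intro exI[of _ 1] conjI ballI impI)
    fix w assume w: "w \<noteq> b \<and> dist w b < 1"
    show "w \<notin> \<int>"
    proof
      assume "w \<in> \<int>"
      then obtain m where m: "w = of_int m"
        by (rule Ints_cases)
      obtain n where n: "b = of_int n"
        using b by (rule Ints_cases)
      have "norm (of_int (m - n) :: complex) < 1"
        using w by (simp add: m n dist_norm)
      then have "\<bar>real_of_int (m - n)\<bar> < 1"
        by (simp only: norm_of_int)
      moreover have "m \<noteq> n"
        using w m n by blast
      ultimately show False
        by linarith
    qed
  qed simp
  have "closed (\<int> :: complex set)"
    by (rule closed_Ints)
  then have "open (- \<int> :: complex set)"
    by (simp add: open_closed)
  then have "eventually (\<lambda>w. w \<in> - \<int>) (at b)" if "b \<notin> \<int>"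
    using that by (intro eventually_at_in_open') auto
  then show ?thesis
    using ev by (cases "b \<in> \<int>") auto
qed

text \<open>The factor 1 / Gamma(w + 1) cancels away from its zeros, and what remains is continuous
  at y; so the limit and the plain quotient have the same value.\<close>

lemma binomial_quotient_eq:
  assumes "Re (x - y) > - 1" and "x' - y + 1 \<notin> \<int>\<^sub>\<le>\<^sub>0"
  shows "binomial_quotient x x' y =
    Gamma (x + 1) * Gamma (x' - y + 1) / (Gamma (x - y + 1) * Gamma (x' + 1))"
proof -
  let ?g = "\<lambda>w. Gamma (x + 1) * Gamma (x' - w + 1) / (Gamma (x - w + 1) * Gamma (x' + 1))"
  have g: "gen_binomial x w / gen_binomial x' w = ?g w" if "w + 1 \<notin> \<int>\<^sub>\<le>\<^sub>0" for w
    using that by (simp add: gen_binomial_def Gamma_eq_zero_iff)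
  have nz: "x - y + 1 \<notin> \<int>\<^sub>\<le>\<^sub>0"
    using assms(1) by (intro Re_pos_notin_nonpos_Ints) simp
  have "isCont ?g y" if "Gamma (x' + 1) \<noteq> 0"
    using assms(2) nz that
    by (intro continuous_intros) (auto simp: Gamma_eq_zero_iff)
  \<comment> \<open>If \<open>Gamma (x' + 1)\<close> is 0, division by zero makes \<open>?g\<close>
    constantly 0.\<close>
  then have "(?g \<longlongrightarrow> ?g y) (at y)"
    by (cases "Gamma (x' + 1) = 0") (auto simp: isCont_def)
  moreover have "eventually (\<lambda>w. ?g w = gen_binomial x w / gen_binomial x' w) (at y)"
  proof -
    have "eventually (\<lambda>w. w \<notin> \<int>) (at y)"
      by (rule eventually_notin_Ints)
    then show ?thesis
    proof eventually_elim
      case (elim w)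
      have "w + 1 \<notin> \<int>\<^sub>\<le>\<^sub>0"
        using elim Ints_diff[of "w + 1" 1] nonpos_Ints_subset_Ints by auto
      from g[OF this] show ?case by simp
    qed
  qed
  ultimately have "((\<lambda>w. gen_binomial x w / gen_binomial x' w) \<longlongrightarrow> ?g y) (at y)"
    by (rule Lim_transform_eventually)
  then have "Lim (at y) (\<lambda>w. gen_binomial x w / gen_binomial x' w) = ?g y"
    by (intro tendsto_Lim) auto
  then show ?thesis
    using g[of y] by (auto simp: binomial_quotient_def)
qed

text \<open>The binomial prefactor is the reciprocal of the Gamma factor that Gauss's theorem leaves
  in \<open>kummer_M_part\<close>.\<close>

theorem kummer_M_laguerre_series:
  fixes a b \<beta> z :: complex
  assumes re: "Re (b - a) > 0" and b: "b \<notin> \<int>\<^sub>\<le>\<^sub>0" and c: "b - \<beta> \<notin> \<int>\<^sub>\<le>\<^sub>0" "b - \<beta> - a \<notin> \<int>\<^sub>\<le>\<^sub>0"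
  defines "t \<equiv> (\<lambda>i. (- 1) ^ i * laguerre i (\<beta> - of_nat i) z * (((- a) gchoose i) / ((\<beta> - b) gchoose i)))"
  shows "summable t" "kummer_M a b z = binomial_quotient (b - 1) (b - \<beta> - 1) a * (\<Sum>i. t i)"
proof -
  let ?G = "Gamma (b - \<beta>) * Gamma (b - a) * rGamma b * rGamma (b - \<beta> - a)"
  have sums: "t sums (kummer_M a b z * ?G)"
    unfolding t_def using re b c(1) by (rule kummer_M_part)
  then show "summable t"
    by (rule sums_summable)
  have ba: "b - a \<notin> \<int>\<^sub>\<le>\<^sub>0"
    using re by (rule Re_pos_notin_nonpos_Ints)
  have "binomial_quotient (b - 1) (b - \<beta> - 1) a =
      Gamma b * Gamma (b - \<beta> - a) / (Gamma (b - a) * Gamma (b - \<beta>))"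
    using binomial_quotient_eq[of "b - 1" a "b - \<beta> - 1"] re c(2) by (simp add: algebra_simps)
  then have "binomial_quotient (b - 1) (b - \<beta> - 1) a * ?G = 1"
    using ba b c by (simp add: rGamma_inverse_Gamma Gamma_eq_zero_iff divide_simps) (simp add: mult.commute)
  then show "kummer_M a b z = binomial_quotient (b - 1) (b - \<beta> - 1) a * (\<Sum>i. t i)"
    unfolding sums_unique[OF sums, symmetric] by (simp only: mult.left_commute mult_1_right)
qed

subsection \<open>Series of Laguerre polynomials with Beta weights\<close>

text \<open>This is B(a + n, d) / Gamma(a). Written with a Pochhammer symbol and
  \<open>rGamma\<close>, it stays meaningful for nonpositive integers a, where it vanishes for large
  n.\<close>

definition weight :: "complex \<Rightarrow> complex \<Rightarrow> nat \<Rightarrow> complex" where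
  "weight a d n = Gamma d * pochhammer a n * rGamma (a + d + of_nat n)"

text \<open>Algebraically (a + d + n) - (a + n) = d; for Beta integrals it is t^n - t^(n+1) = t^n (1
  - t).\<close>

lemma weight_diff:
  assumes "d \<notin> \<int>\<^sub>\<le>\<^sub>0"
  shows "weight a d n - weight a d (Suc n) = weight a (d + 1) n"
proof -
  have "rGamma (a + d + of_nat n) = (a + d + of_nat n) * rGamma (a + d + of_nat n + 1)"
    by (rule rGamma_plus1[symmetric])
  moreover have "Gamma (d + 1) = d * Gamma d"
    using assms by (rule Gamma_plus1)
  ultimately show ?thesis
    by (simp add: weight_def pochhammer_Suc algebra_simps)
qed

lemma weight_eq_0:
  assumes "a \<in> \<int>\<^sub>\<le>\<^sub>0"
  shows "eventually (\<lambda>n. weight a d n = 0) sequentially"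
proof -
  obtain k where k: "a = - of_nat k"
    using assms by (elim nonpos_Ints_cases')
  show ?thesis
    using eventually_gt_at_top[of k]
    by eventually_elim (auto simp: weight_def k pochhammer_of_nat_eq_0_iff)
qed

lemma weight_bound:
  assumes "a + d \<notin> \<int>\<^sub>\<le>\<^sub>0"
  obtains K where "K > 0" "\<And>n. norm (weight a d n) \<le> K * (real n + 1) powr (- Re d)"
proof -
  obtain K where K: "K > 0"
      "\<And>n. norm (pochhammer a n / pochhammer (a + d) n) \<le> K * (real n + 1) powr Re (a - (a + d))"
    using pochhammer_ratio_bound by blast
  let ?C = "norm (Gamma d * rGamma (a + d))"
  have "norm (weight a d n) \<le> (?C * K + 1) * (real n + 1) powr (- Re d)" for n
  proof -
    have "pochhammer (a + d) n \<noteq> 0"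
      using assms by (auto simp: pochhammer_eq_0_iff)
    then have "rGamma (a + d + of_nat n) = rGamma (a + d) / pochhammer (a + d) n"
      using pochhammer_rGamma[of "a + d" n] by (simp add: field_simps)
    then have "norm (weight a d n) = ?C * norm (pochhammer a n / pochhammer (a + d) n)"
      by (simp add: weight_def norm_mult norm_divide)
    also have "\<dots> \<le> ?C * (K * (real n + 1) powr Re (a - (a + d)))"
      using K by (intro mult_left_mono) auto
    also have "\<dots> \<le> (?C * K + 1) * (real n + 1) powr (- Re d)"
      by (simp add: algebra_simps)
    finally show ?thesis .
  qed
  moreover have "?C * K + 1 > 0"
    using K(1) by (intro add_nonneg_pos) auto
  ultimately show ?thesis
    using that by blast
qed

text \<open>Either the growth bound for Laguerre polynomials is available, or only finitely many
  weights are nonzero and growth does not matter.\<close>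

definition weight_admissible :: "complex \<Rightarrow> complex \<Rightarrow> bool" where
  "weight_admissible z a \<longleftrightarrow> (\<exists>x>0. z = complex_of_real x) \<or> a \<in> \<int>\<^sub>\<le>\<^sub>0"

text \<open>The additional power r is 0 for the boundary term of the summation by parts; the
  recursion in a requires r = 1 as well.\<close>

lemma laguerre_weight_tendsto_0:
  assumes adm: "weight_admissible z a"
    and re: "Re (\<alpha> - 2 * d) < - 2 * r - 1 / 2" and ad: "a + d \<notin> \<int>\<^sub>\<le>\<^sub>0"
  shows "(\<lambda>n. of_real ((real n + 1) powr r) * laguerre n \<alpha> z * weight a d n) \<longlonglongrightarrow> 0"
  using adm unfolding weight_admissible_def
proof
  assume "a \<in> \<int>\<^sub>\<le>\<^sub>0"
  from weight_eq_0[OF this, of d] show ?thesis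
    by (intro tendsto_eventually) (auto elim!: eventually_mono)
next
  assume "\<exists>x>0. z = complex_of_real x"
  then have "laguerre_bounded z \<alpha>"
    using laguerre_bound by blast
  then obtain K where K: "K > 0" "\<And>n. norm (laguerre n \<alpha> z) \<le> K * (real n + 1) powr (Re \<alpha> / 2 + 1 / 4)"
    using laguerre_boundedE by blast
  obtain L where L: "L > 0" "\<And>n. norm (weight a d n) \<le> L * (real n + 1) powr (- Re d)"
    using weight_bound[OF ad] by blast
  let ?e = "Re \<alpha> / 2 + 1 / 4 + r - Re d"
  show ?thesis
  proof (rule Lim_null_comparison[OF always_eventually[OF allI]])
    fix n
    have "norm (of_real ((real n + 1) powr r) * laguerre n \<alpha> z * weight a d n) =
        (real n + 1) powr r * norm (laguerre n \<alpha> z) * norm (weight a d n)"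
      by (simp add: norm_mult)
    also have "\<dots> \<le> (real n + 1) powr r * (K * (real n + 1) powr (Re \<alpha> / 2 + 1 / 4)) * (L * (real n + 1) powr (- Re d))"
      using K L by (intro mult_mono) auto
    also have "\<dots> = K * L * (real n + 1) powr (r + (Re \<alpha> / 2 + 1 / 4) + (- Re d))"
      unfolding powr_add by simp
    also have "r + (Re \<alpha> / 2 + 1 / 4) + (- Re d) = ?e"
      by simp
    finally show "norm (of_real ((real n + 1) powr r) * laguerre n \<alpha> z * weight a d n) \<le> K * L * (real n + 1) powr ?e" .
  next
    have "?e < 0"
      using re by (simp add: field_simps)
    then show "(\<lambda>n. K * L * (real n + 1) powr ?e) \<longlonglongrightarrow> 0"
      by (intro tendsto_mult_right_zero powr_minus_tendsto_0)
  qed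
qed

lemma laguerre_weight_sums_shift:
  assumes adm: "weight_admissible z a"
    and re: "Re (\<alpha> - 2 * d) < - 3 / 2" and ad: "a + d \<notin> \<int>\<^sub>\<le>\<^sub>0" and d: "d \<notin> \<int>\<^sub>\<le>\<^sub>0"
    and S: "(\<lambda>n. laguerre n (\<alpha> + 1) z * weight a (d + 1) n) sums S"
  shows "(\<lambda>n. laguerre n \<alpha> z * weight a d n) sums S"
proof -
  have part: "(\<Sum>i<Suc N. laguerre i \<alpha> z * weight a d i) =
      (\<Sum>i<Suc N. laguerre i (\<alpha> + 1) z * weight a (d + 1) i) + laguerre N (\<alpha> + 1) z * weight a d (Suc N)" for N
  proof (induction N)
    case 0
    then show ?case
      by (simp add: weight_diff[OF d, of a 0, symmetric])
  next
    case (Suc N)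
    have L: "laguerre (Suc N) \<alpha> z = laguerre (Suc N) (\<alpha> + 1) z - laguerre N (\<alpha> + 1) z"
      using laguerre_Suc_order[of N \<alpha> z] by simp
    then show ?case
      unfolding sum.lessThan_Suc[of _ "Suc N"] Suc.IH L weight_diff[OF d, symmetric]
      by (simp add: algebra_simps)
  qed
  have re': "Re (\<alpha> + 1 - 2 * (d + 1)) < - 2 * 0 - 1 / 2"
    using re by simp
  have ad': "a + (d + 1) \<notin> \<int>\<^sub>\<le>\<^sub>0"
    using plus_nat_notin_nonpos_Ints[OF ad, of 1] by (simp add: add_ac)
  have bd: "(\<lambda>N. laguerre N (\<alpha> + 1) z * weight a d (Suc N)) \<longlonglongrightarrow> 0"
  proof -
    have 1: "(\<lambda>N. of_real ((real N + 1) powr 0) * laguerre N (\<alpha> + 1) z * weight a d N) \<longlonglongrightarrow> 0"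
      using re by (intro laguerre_weight_tendsto_0[OF adm _ ad]) simp
    have 2: "(\<lambda>N. of_real ((real N + 1) powr 0) * laguerre N (\<alpha> + 1) z * weight a (d + 1) N) \<longlonglongrightarrow> 0"
      by (rule laguerre_weight_tendsto_0[OF adm re' ad'])
    \<comment> \<open>The weight at Suc N is a difference of two weights at N, so polynomials and
      weights are estimated at the same index.\<close>
    have "(\<lambda>N. laguerre N (\<alpha> + 1) z * (weight a d N - weight a (d + 1) N)) \<longlonglongrightarrow> 0"
      using tendsto_diff[OF 1 2] by (simp add: algebra_simps)
    then show ?thesis
      by (simp add: weight_diff[OF d, symmetric])
  qed
  have "(\<lambda>N. \<Sum>i<Suc N. laguerre i (\<alpha> + 1) z * weight a (d + 1) i) \<longlonglongrightarrow> S"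
    using S unfolding sums_def by (rule LIMSEQ_Suc)
  from tendsto_add[OF this bd] have "(\<lambda>N. \<Sum>i<Suc N. laguerre i \<alpha> z * weight a d i) \<longlonglongrightarrow> S"
    unfolding part by simp
  then show ?thesis
    unfolding sums_def by (rule LIMSEQ_imp_Suc)
qed

text \<open>Raising \<alpha> and d together by 1 lowers Re (\<alpha> - 2 d) by 1, so the hypothesis
  persists along the iteration.\<close>

lemma laguerre_weight_sums_shift_nat:
  assumes adm: "weight_admissible z a"
    and re: "Re (\<alpha> - 2 * d) < - 3 / 2" and ad: "a + d \<notin> \<int>\<^sub>\<le>\<^sub>0" and d: "d \<notin> \<int>\<^sub>\<le>\<^sub>0"
    and S: "(\<lambda>n. laguerre n (\<alpha> + of_nat m) z * weight a (d + of_nat m) n) sums S"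
  shows "(\<lambda>n. laguerre n \<alpha> z * weight a d n) sums S"
  using S
proof (induction m)
  case (Suc m)
  have "(\<lambda>n. laguerre n (\<alpha> + of_nat m) z * weight a (d + of_nat m) n) sums S"
  proof (rule laguerre_weight_sums_shift[OF adm])
    show "Re (\<alpha> + of_nat m - 2 * (d + of_nat m)) < - 3 / 2"
      using re by simp
    show "a + (d + of_nat m) \<notin> \<int>\<^sub>\<le>\<^sub>0" "d + of_nat m \<notin> \<int>\<^sub>\<le>\<^sub>0"
      using plus_nat_notin_nonpos_Ints[OF ad, of m] plus_nat_notin_nonpos_Ints[OF d, of m]
      by (simp_all add: add_ac)
    show "(\<lambda>n. laguerre n (\<alpha> + of_nat m + 1) z * weight a (d + of_nat m + 1) n) sums S"
      using Suc.prems by (simp add: add_ac)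
  qed
  then show ?case by (rule Suc.IH)
qed simp

text \<open>The series side of the recursion for U with b = \<alpha> + 2 - d: raising \<alpha> at
  fixed d raises b. The weight for a - 1 combines w_n and w_(n-1) with coefficients linear in n, and
  the factor n + 1 in \<open>laguerre_Suc_mult\<close> makes the excess telescope.\<close>

lemma laguerre_weight_sums_pred:
  assumes S1: "(\<lambda>n. laguerre n (\<alpha> + 1) z * weight a d n) sums S1"
    and S2: "(\<lambda>n. laguerre n \<alpha> z * weight a d n) sums S2"
    and bd: "(\<lambda>n. of_nat (Suc n) * laguerre (Suc n) \<alpha> z * weight a d n) \<longlonglongrightarrow> 0"
  shows "(\<lambda>n. laguerre n \<alpha> z * weight (a - 1) d n) sums (z * S1 - (\<alpha> + 2 - d - a) * S2)"
proof -
  \<comment> \<open>The factor n makes the truncated index n - 1 harmless at n = 0.\<close>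
  define g where "g n = of_nat n * laguerre n \<alpha> z * weight a d (n - 1)" for n
  have w: "(of_nat n + a + d - 1) * weight a d n - of_nat n * weight a d (n - 1) = weight (a - 1) d n" for n
  proof (cases n)
    case 0
    have R: "rGamma (a + d - 1) = (a + d - 1) * rGamma (a + d)"
      using rGamma_plus1[of "a + d - 1"] by simp
    have W: "weight (a - 1) d 0 = Gamma d * rGamma (a + d - 1)"
      by (simp add: weight_def algebra_simps)
    show ?thesis
      unfolding 0 W R by (simp add: weight_def)
  next
    case (Suc m)
    define R where "R = rGamma (a + d + of_nat (Suc m))"
    have R: "rGamma (a + d + of_nat m) = (a + d + of_nat m) * R"
      using rGamma_plus1[of "a + d + of_nat m"] by (simp add: R_def add_ac)
    have P: "pochhammer (a - 1) (Suc m) = (a - 1) * pochhammer a m"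
      using pochhammer_rec[of "a - 1" m] by simp
    have "a - 1 + d + of_nat (Suc m) = a + d + of_nat m"
      by simp
    then have W: "weight (a - 1) d (Suc m) = Gamma d * ((a - 1) * pochhammer a m) * ((a + d + of_nat m) * R)"
      unfolding weight_def P by (simp only: R)
    have W1: "weight a d (Suc m) = Gamma d * ((a + of_nat m) * pochhammer a m) * R"
      unfolding weight_def R_def by (simp add: pochhammer_Suc mult.commute)
    have W2: "weight a d m = Gamma d * pochhammer a m * ((a + d + of_nat m) * R)"
      unfolding weight_def R ..
    show ?thesis
      unfolding Suc diff_Suc_1 W W1 W2 by (simp add: algebra_simps)
  qed
  have "z * (laguerre n (\<alpha> + 1) z * weight a d n) - (\<alpha> + 2 - d - a) * (laguerre n \<alpha> z * weight a d n)
      + (g (Suc n) - g n) = laguerre n \<alpha> z * weight (a - 1) d n" for n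
  proof -
    have zL: "z * laguerre n (\<alpha> + 1) z = (of_nat (Suc n) + \<alpha>) * laguerre n \<alpha> z - of_nat (Suc n) * laguerre (Suc n) \<alpha> z"
      using laguerre_Suc_mult[of n \<alpha> z] by simp
    have "z * (laguerre n (\<alpha> + 1) z * weight a d n) =
        (of_nat (Suc n) + \<alpha>) * laguerre n \<alpha> z * weight a d n - g (Suc n)"
      unfolding mult.assoc[symmetric] zL by (simp add: g_def left_diff_distrib del: of_nat_Suc)
    then show ?thesis
      unfolding w[symmetric] by (simp add: g_def algebra_simps)
  qed
  moreover have "(\<lambda>n. g (Suc n) - g n) sums (0 - g 0)"
    by (rule telescope_sums) (rule LIMSEQ_imp_Suc, use bd in \<open>simp add: g_def\<close>)
  then have "(\<lambda>n. z * (laguerre n (\<alpha> + 1) z * weight a d n) - (\<alpha> + 2 - d - a) * (laguerre n \<alpha> z * weight a d n)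
      + (g (Suc n) - g n)) sums (z * S1 - (\<alpha> + 2 - d - a) * S2 + (0 - g 0))"
    by (rule sums_add[OF sums_diff[OF sums_mult[OF S1] sums_mult[OF S2]]])
  ultimately show ?thesis
    by (simp add: g_def)
qed

section \<open>Contiguous relations for the Kummer functions\<close>

lemma pochhammer_notin_nonpos_Ints: "b \<notin> \<int>\<^sub>\<le>\<^sub>0 \<Longrightarrow> pochhammer b n \<noteq> 0"
  for b :: complex
  by (auto simp: pochhammer_eq_0_iff)

lemma pochhammer_plus_one:
  fixes b :: complex
  assumes "b \<noteq> 0"
  shows "pochhammer (b + 1) n = (b + of_nat n) / b * pochhammer b n"
  using pochhammer_rec[of b n] assms by (simp add: pochhammer_Suc field_simps)

text \<open>Rests on (a - 1)_(n+1) = (a)_(n+1) - (n + 1) (a)_n.\<close>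

lemma kummer_M_pred:
  assumes b: "b \<notin> \<int>\<^sub>\<le>\<^sub>0"
  shows "kummer_M (a - 1) b z = kummer_M a b z - z / b * kummer_M a (b + 1) z"
proof -
  have b0: "b \<noteq> 0" using b by auto
  have "kummer_term (a - 1) b z (Suc n) = kummer_term a b z (Suc n) - z / b * kummer_term a (b + 1) z n" for n
  proof -
    have bn: "b + of_nat n \<noteq> 0"
      using plus_nat_notin_nonpos_Ints[OF b, of n] by auto
    have "pochhammer (a - 1) (Suc n) = (a - 1) * pochhammer a n"
      using pochhammer_rec[of "a - 1" n] by simp
    also have "\<dots> = pochhammer a (Suc n) - of_nat (Suc n) * pochhammer a n"
      by (simp add: pochhammer_Suc algebra_simps)
    finally have e: "pochhammer (a - 1) (Suc n) = pochhammer a (Suc n) - of_nat (Suc n) * pochhammer a n" .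
    have e2: "b * pochhammer (b + 1) n = pochhammer b (Suc n)"
      by (simp add: pochhammer_rec)
    have "z / b * kummer_term a (b + 1) z n = of_nat (Suc n) * pochhammer a n / pochhammer b (Suc n) * z ^ Suc n / fact (Suc n)"
      unfolding e2[symmetric] kummer_term_def fact_Suc by (simp add: field_simps del: of_nat_Suc)
    then show ?thesis
      unfolding kummer_term_def[of "a - 1"] e
      by (simp add: kummer_term_def left_diff_distrib diff_divide_distrib del: of_nat_Suc pochhammer_Suc fact_Suc power_Suc)
  qed
  then have "(\<lambda>n. kummer_term a b z (Suc n) - z / b * kummer_term a (b + 1) z n) =
      (\<lambda>n. kummer_term (a - 1) b z (Suc n))"
    by simp
  moreover have "(\<lambda>n. kummer_term a b z (Suc n) - z / b * kummer_term a (b + 1) z n) sums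
      ((kummer_M a b z - kummer_term a b z 0) - z / b * kummer_M a (b + 1) z)"
    by (intro sums_diff sums_mult kummer_sums) (simp add: sums_Suc_iff kummer_sums)
  ultimately have "(\<lambda>n. kummer_term (a - 1) b z (Suc n)) sums
      ((kummer_M a b z - kummer_term a b z 0) - z / b * kummer_M a (b + 1) z)"
    by simp
  then have "kummer_term (a - 1) b z sums
      ((kummer_M a b z - kummer_term a b z 0) - z / b * kummer_M a (b + 1) z + kummer_term (a - 1) b z 0)"
    by (subst (asm) sums_Suc_iff)
  then have "kummer_term (a - 1) b z sums (kummer_M a b z - z / b * kummer_M a (b + 1) z)"
    by (simp add: kummer_term_def)
  then show ?thesis
    using kummer_sums sums_unique2 by blast
qed

text \<open>Termwise p (p + 1)_n = (p + n) (p)_n, and the total (p + n) + (q - p) = q + n is what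
  turns (q + 1)_n into (q)_n.\<close>

lemma kummer_M_contiguous:
  assumes q: "q \<notin> \<int>\<^sub>\<le>\<^sub>0"
  shows "q * kummer_M p q z = p * kummer_M (p + 1) (q + 1) z + (q - p) * kummer_M p (q + 1) z"
proof -
  have q0: "q \<noteq> 0" using q by auto
  have "q * kummer_term p q z n = p * kummer_term (p + 1) (q + 1) z n + (q - p) * kummer_term p (q + 1) z n" for n
  proof -
    have qn: "q + of_nat n \<noteq> 0"
      using plus_nat_notin_nonpos_Ints[OF q, of n] by auto
    have e: "p * pochhammer (p + 1) n = (p + of_nat n) * pochhammer p n"
      using pochhammer_rec[of p n] by (simp add: pochhammer_Suc mult.commute)
    have Q: "pochhammer q n = q / (q + of_nat n) * pochhammer (q + 1) n"
      unfolding pochhammer_plus_one[OF q0] using q0 qn by simp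
    have "p * kummer_term (p + 1) (q + 1) z n + (q - p) * kummer_term p (q + 1) z n =
        (p * pochhammer (p + 1) n + (q - p) * pochhammer p n) / pochhammer (q + 1) n * z ^ n / fact n"
      by (simp add: kummer_term_def add_divide_distrib distrib_right mult.assoc)
    also have "\<dots> = (q + of_nat n) * pochhammer p n / pochhammer (q + 1) n * z ^ n / fact n"
      unfolding e by (simp add: algebra_simps)
    also have "\<dots> = q * kummer_term p q z n"
      unfolding kummer_term_def Q using q0 qn by simp
    finally show ?thesis ..
  qed
  moreover have "(\<lambda>n. q * kummer_term p q z n) sums (q * kummer_M p q z)"
    by (intro sums_mult kummer_sums)
  moreover have "(\<lambda>n. p * kummer_term (p + 1) (q + 1) z n + (q - p) * kummer_term p (q + 1) z n) sums
      (p * kummer_M (p + 1) (q + 1) z + (q - p) * kummer_M p (q + 1) z)"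
    by (intro sums_add sums_mult kummer_sums)
  ultimately show ?thesis
    using sums_unique2 by fastforce
qed

text \<open>The two summands of the connection formula satisfy the recursion separately: the first
  by \<open>kummer_M_pred\<close>, the second by \<open>kummer_M_contiguous\<close> with p = a - b
  and q = 1 - b.\<close>

lemma kummer_U_generic_pred:
  assumes b: "b \<notin> \<int>" and z: "z \<noteq> 0 \<or> a \<in> \<int>\<^sub>\<le>\<^sub>0"
  shows "kummer_U_generic (a - 1) b z = z * kummer_U_generic a (b + 1) z - (b - a) * kummer_U_generic a b z"
proof -
  have nb: "b \<notin> \<int>\<^sub>\<le>\<^sub>0" "1 - b \<notin> \<int>\<^sub>\<le>\<^sub>0" "- b \<notin> \<int>\<^sub>\<le>\<^sub>0" "b - 1 \<notin> \<int>\<^sub>\<le>\<^sub>0"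
    using b Ints_diff[of 1 "1 - b"] Ints_add[of "b - 1" 1] minus_in_Ints_iff[of b]
    by (auto dest: nonpos_Ints_Int)
  have b0: "b \<noteq> 0" "b \<noteq> 1" using b by auto
  define A where "A = Gamma (1 - b) * rGamma (1 - b + a)"
  define B where "B = Gamma (b - 1) * rGamma a * z powr (1 - b)"
  have U: "kummer_U_generic a b z = A * kummer_M a b z + B * kummer_M (a - b + 1) (2 - b) z"
    by (simp add: kummer_U_generic_def A_def B_def rGamma_inverse_Gamma divide_inverse)
  have G1: "Gamma (1 - b) = - b * Gamma (- b)"
    using Gamma_plus1[of "- b"] nb by (simp add: add.commute)
  have G2: "Gamma b = (b - 1) * Gamma (b - 1)"
    using Gamma_plus1[of "b - 1"] nb by simp
  have R1: "rGamma (a - b) = (a - b) * rGamma (1 - b + a)"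
    using rGamma_plus1[of "a - b"] by (simp add: algebra_simps)
  have R2: "rGamma (a - 1) = (a - 1) * rGamma a"
    using rGamma_plus1[of "a - 1"] by simp
  have U1: "kummer_U_generic (a - 1) b z =
      (a - b) * A * kummer_M (a - 1) b z + (a - 1) * B * kummer_M (a - b) (2 - b) z"
  proof -
    have e: "1 - b + (a - 1) = a - b" "a - 1 - b + 1 = a - b"
      by simp_all
    have "kummer_U_generic (a - 1) b z = Gamma (1 - b) * rGamma (a - b) * kummer_M (a - 1) b z
        + Gamma (b - 1) * rGamma (a - 1) * z powr (1 - b) * kummer_M (a - b) (2 - b) z"
      unfolding kummer_U_generic_def e by (simp add: rGamma_inverse_Gamma divide_inverse)
    then show ?thesis
      unfolding R1 R2 by (simp add: A_def B_def)
  qed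
  have "z * kummer_U_generic a (b + 1) z =
      z * (Gamma (- b) * rGamma (a - b)) * kummer_M a (b + 1) z
      + Gamma b * rGamma a * (z * z powr (- b)) * kummer_M (a - b) (1 - b) z"
    by (simp add: kummer_U_generic_def rGamma_inverse_Gamma divide_inverse algebra_simps)
  \<comment> \<open>At z = 0 the parameter a is a nonpositive integer, and 1 / Gamma(a) = 0 removes
    the summand.\<close>
  also have "Gamma b * rGamma a * (z * z powr (- b)) = (b - 1) * B"
  proof (cases "z = 0")
    case True
    then have "rGamma a = 0" using z by (simp add: rGamma_eq_zero_iff)
    then show ?thesis by (simp add: B_def)
  next
    case False
    then have "z powr (1 - b) = z * z powr (- b)"
      by (simp add: powr_diff powr_minus divide_inverse)
    then show ?thesis by (simp add: B_def G2)
  qed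
  also have "Gamma (- b) * rGamma (a - b) = (b - a) / b * A"
    unfolding R1 A_def G1 using b0 by (simp add: field_simps)
  finally have U2: "z * kummer_U_generic a (b + 1) z =
      z * ((b - a) / b * A) * kummer_M a (b + 1) z + (b - 1) * B * kummer_M (a - b) (1 - b) z" .
  have C: "(b - 1) * kummer_M (a - b) (1 - b) z - (b - a) * kummer_M (a - b + 1) (2 - b) z = (a - 1) * kummer_M (a - b) (2 - b) z"
    using kummer_M_contiguous[OF nb(2), of "a - b" z] by (simp add: algebra_simps)
  have "z * kummer_U_generic a (b + 1) z - (b - a) * kummer_U_generic a b z =
      (a - b) * A * (kummer_M a b z - z / b * kummer_M a (b + 1) z) +
      B * ((b - 1) * kummer_M (a - b) (1 - b) z - (b - a) * kummer_M (a - b + 1) (2 - b) z)"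
    unfolding U U2 using b0 by (simp add: field_simps)
  also have "\<dots> = kummer_U_generic (a - 1) b z"
    unfolding C kummer_M_pred[OF nb(1), symmetric] U1 by simp
  finally show ?thesis ..
qed

subsection \<open>The generating function\<close>

lemma powr_le_exp:
  fixes p y0 \<delta> :: real
  assumes "y0 > 0" "\<delta> > 0"
  obtains C where "C > 0" "\<And>y. y \<ge> y0 \<Longrightarrow> y powr p \<le> C * exp (\<delta> * y)"
proof (cases "p \<le> 0")
  case True
  have "y powr p \<le> y0 powr p * exp (\<delta> * y)" if "y \<ge> y0" for y
  proof -
    have "y powr p \<le> y0 powr p"
      using True that assms by (intro powr_mono2') auto
    also have "\<dots> \<le> y0 powr p * exp (\<delta> * y)"
      using that assms by (simp add: mult_le_cancel_left1)
    finally show ?thesis .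
  qed
  then show ?thesis
    using that[of "y0 powr p"] assms by simp
next
  case False
  \<comment> \<open>The tangent to ln at c bounds p ln y by p y / c + p ln c; this c gives it the
    slope \<delta>.\<close>
  define c where "c = p / \<delta>"
  have c: "c > 0" using False assms by (simp add: c_def)
  have "y powr p \<le> exp (p * ln c) * exp (\<delta> * y)" if "y \<ge> y0" for y
  proof -
    have y: "y > 0" using that assms by simp
    have "ln (y / c) \<le> y / c - 1"
      using y c by (intro ln_le_minus_one) auto
    then have "ln y \<le> y / c + ln c"
      using y c by (simp add: ln_div)
    then have "p * ln y \<le> p * (y / c + ln c)"
      using False by (intro mult_left_mono) auto
    also have "\<dots> = p * ln c + \<delta> * y"
      using False assms by (simp add: c_def field_simps)
    finally have "exp (p * ln y) \<le> exp (p * ln c + \<delta> * y)"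
      by simp
    then show ?thesis
      using y by (simp add: powr_def exp_add)
  qed
  then show ?thesis
    using that[of "exp (p * ln c)"] by simp
qed

lemma summable_laguerre_power:
  assumes x: "x > 0" and t: "norm t < 1"
  shows "summable (\<lambda>n. laguerre n \<alpha> (of_real x) * t ^ n)"
proof -
  obtain K where K: "K > 0" "\<And>n. norm (laguerre n \<alpha> (of_real x)) \<le> K * (real n + 1) powr (Re \<alpha> / 2 + 1 / 4)"
    using laguerre_boundedE[OF laguerre_bound[OF x]] by blast
  define r where "r = (1 + norm t) / 2"
  have r: "norm t < r" "r < 1" "r > 0"
    using t by (auto simp: r_def add_pos_nonneg)
  \<comment> \<open>r lies strictly between |t| and 1 and is positive even for t = 0. One half of
    its exponential decay pays for the power of n, the other half leaves a geometric series.\<close>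
  define \<delta> where "\<delta> = - ln r / 2"
  have \<delta>: "\<delta> > 0" using r by (simp add: \<delta>_def)
  obtain C where C: "C > 0" "\<And>y. y \<ge> 1 \<Longrightarrow> y powr (Re \<alpha> / 2 + 1 / 4) \<le> C * exp (\<delta> * y)"
    using powr_le_exp[of 1 \<delta> "Re \<alpha> / 2 + 1 / 4"] \<delta> by auto
  show ?thesis
  proof (rule summable_comparison_test'[where g = "\<lambda>n. K * C * exp \<delta> * exp (- \<delta>) ^ n"])
    show "summable (\<lambda>n. K * C * exp \<delta> * exp (- \<delta>) ^ n)"
      using \<delta> by (intro summable_mult summable_geometric) simp
    fix n
    have "norm t ^ n \<le> r ^ n"
      using r by (intro power_mono) auto
    also have "r ^ n = exp (- (2 * \<delta>)) ^ n"
      using r by (simp add: \<delta>_def)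
    also have "\<dots> = exp (- \<delta>) ^ n * exp (- \<delta> * n)"
      by (simp add: exp_of_nat_mult[symmetric] exp_add[symmetric] algebra_simps)
    finally have tn: "norm t ^ n \<le> exp (- \<delta>) ^ n * exp (- \<delta> * n)" .
    have "norm (laguerre n \<alpha> (of_real x) * t ^ n) = norm (laguerre n \<alpha> (of_real x)) * norm t ^ n"
      by (simp add: norm_mult norm_power)
    also have "\<dots> \<le> (K * (C * exp (\<delta> * (real n + 1)))) * (exp (- \<delta>) ^ n * exp (- \<delta> * n))"
    proof (intro mult_mono tn)
      have "K * (real n + 1) powr (Re \<alpha> / 2 + 1 / 4) \<le> K * (C * exp (\<delta> * (real n + 1)))"
        using K(1) C(2) by (intro mult_left_mono) auto
      with K(2)[of n] show "norm (laguerre n \<alpha> (of_real x)) \<le> K * (C * exp (\<delta> * (real n + 1)))"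
        by linarith
      show "0 \<le> K * (C * exp (\<delta> * (real n + 1)))"
        using K(1) C(1) by simp
    qed auto
    also have "\<dots> = K * C * (exp (\<delta> * (real n + 1)) * exp (- \<delta> * n)) * exp (- \<delta>) ^ n"
      by (simp only: mult_ac)
    also have "exp (\<delta> * (real n + 1)) * exp (- \<delta> * n) = exp \<delta>"
      unfolding exp_add[symmetric] by (simp add: algebra_simps)
    finally show "norm (laguerre n \<alpha> (of_real x) * t ^ n) \<le> K * C * exp \<delta> * exp (- \<delta>) ^ n" .
  qed
qed

text \<open>The recurrence in the order says that passing to \<alpha> + 1 divides the series f by 1
  - t. With this, \<open>laguerre_Suc_mult\<close> becomes a linear differential equation of first
  order for f. The reciprocal E of the claimed value solves the adjoint equation, so f E is constant
  on the disc and equals its value 1 at t = 0.\<close>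

theorem laguerre_generating_function:
  assumes x: "x > 0" and t: "norm t < 1"
  shows "(\<lambda>n. laguerre n \<alpha> (of_real x) * t ^ n) sums
    exp (- (\<alpha> + 1) * Ln (1 - t) - of_real x * t / (1 - t))"
proof -
  define f where "f t = (\<Sum>n. laguerre n \<alpha> (of_real x) * t ^ n)" for t
  define E where "E t = exp ((\<alpha> + 1) * Ln (1 - t) + of_real x * t / (1 - t))" for t
  have sm: "summable (\<lambda>n. laguerre n \<beta> (of_real x) * t ^ n)" if "norm t < 1" for t \<beta>
    using summable_laguerre_power[OF x that] .
  have re: "Re (1 - t) > 0" if "norm t < 1" for t
    using complex_Re_le_cmod[of t] that by simp
  have f1: "(\<Sum>n. laguerre n (\<alpha> + 1) (of_real x) * t ^ n) = f t / (1 - t)" if t: "norm t < 1" for t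
  proof -
    let ?g = "\<lambda>n. laguerre n (\<alpha> + 1) (of_real x) * t ^ n"
    have g: "?g sums (\<Sum>n. ?g n)"
      by (intro summable_sums sm t)
    then have "(\<lambda>n. ?g (Suc n)) sums ((\<Sum>n. ?g n) - ?g 0)"
      by (subst sums_Suc_iff) (simp only: diff_add_cancel)
    from sums_diff[OF this sums_mult[OF g]]
    have "(\<lambda>n. ?g (Suc n) - t * ?g n) sums ((\<Sum>n. ?g n) - ?g 0 - t * (\<Sum>n. ?g n))" .
    moreover have "?g (Suc n) - t * ?g n = laguerre (Suc n) \<alpha> (of_real x) * t ^ Suc n" for n
      unfolding laguerre_Suc_order by (simp add: algebra_simps)
    ultimately have "(\<lambda>n. laguerre (Suc n) \<alpha> (of_real x) * t ^ Suc n) sums ((\<Sum>n. ?g n) - ?g 0 - t * (\<Sum>n. ?g n))"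
      by simp
    then have "(\<lambda>n. laguerre n \<alpha> (of_real x) * t ^ n) sums ((\<Sum>n. ?g n) - t * (\<Sum>n. ?g n))"
      by (subst (asm) sums_Suc_iff) simp
    then have "f t = (\<Sum>n. ?g n) - t * (\<Sum>n. ?g n)"
      unfolding f_def by (simp add: sums_iff)
    also have "\<dots> = (\<Sum>n. ?g n) * (1 - t)"
      by (simp add: algebra_simps)
    finally have "f t = (\<Sum>n. ?g n) * (1 - t)" .
    moreover have "1 - t \<noteq> 0"
      using re[OF t] by auto
    ultimately show ?thesis
      by (metis nonzero_mult_div_cancel_right)
  qed
  have f': "(f has_field_derivative ((\<alpha> + 1) / (1 - t) - of_real x / (1 - t)\<^sup>2) * f t) (at t)" if t: "norm t < 1" for t
  proof -
    let ?c = "\<lambda>n. laguerre n \<alpha> (of_real x)"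
    have d: "(f has_field_derivative (\<Sum>n. diffs ?c n * t ^ n)) (at t)"
      unfolding f_def by (rule termdiffs_strong'[OF sm t])
    have sd: "summable (\<lambda>n. diffs ?c n * t ^ n)"
      by (rule termdiff_converges[of _ 1]) (use t sm in auto)
    have 1: "(\<lambda>n. t * (of_nat n * ?c n * t ^ (n - Suc 0))) sums (t * (\<Sum>n. diffs ?c n * t ^ n))"
      by (intro sums_mult diffs_equiv sd)
    have "(\<lambda>n. t * (of_nat n * ?c n * t ^ (n - Suc 0)) + (\<alpha> + 1) * (?c n * t ^ n) - of_real x * (laguerre n (\<alpha> + 1) (of_real x) * t ^ n)) sums
      (t * (\<Sum>n. diffs ?c n * t ^ n) + (\<alpha> + 1) * f t - of_real x * (f t / (1 - t)))"
      unfolding f1[OF t, symmetric] unfolding f_def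
      by (rule sums_diff[OF sums_add[OF 1 sums_mult[OF summable_sums[OF sm[OF t]]]] sums_mult[OF summable_sums[OF sm[OF t]]]])
    moreover have "t * (of_nat n * ?c n * t ^ (n - Suc 0)) + (\<alpha> + 1) * (?c n * t ^ n) - of_real x * (laguerre n (\<alpha> + 1) (of_real x) * t ^ n)
      = diffs ?c n * t ^ n" for n
    proof -
      have "t * (of_nat n * ?c n * t ^ (n - Suc 0)) = of_nat n * ?c n * t ^ n"
        by (cases n) auto
      then show ?thesis
        unfolding diffs_def laguerre_Suc_mult by (simp add: algebra_simps)
    qed
    ultimately have "(\<lambda>n. diffs ?c n * t ^ n) sums
      (t * (\<Sum>n. diffs ?c n * t ^ n) + (\<alpha> + 1) * f t - of_real x * (f t / (1 - t)))"
      by simp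
    then have "(\<Sum>n. diffs ?c n * t ^ n) = t * (\<Sum>n. diffs ?c n * t ^ n) + (\<alpha> + 1) * f t - of_real x * (f t / (1 - t))"
      by (simp add: sums_iff)
    then have "(1 - t) * (\<Sum>n. diffs ?c n * t ^ n) = (\<alpha> + 1) * f t - of_real x * (f t / (1 - t))"
      by (simp add: algebra_simps)
    moreover have "1 - t \<noteq> 0"
      using re[OF t] by auto
    ultimately have "(\<Sum>n. diffs ?c n * t ^ n) = ((\<alpha> + 1) * f t - of_real x * (f t / (1 - t))) / (1 - t)"
      by (metis nonzero_mult_div_cancel_left)
    also have "\<dots> = ((\<alpha> + 1) / (1 - t) - of_real x / (1 - t)\<^sup>2) * f t"
      by (simp add: power2_eq_square diff_divide_distrib left_diff_distrib)
    finally show ?thesis using d by simp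
  qed
  have E': "(E has_field_derivative E t * (- (\<alpha> + 1) / (1 - t) + of_real x / (1 - t)\<^sup>2)) (at t)" if t: "norm t < 1" for t
  proof -
    have nz: "1 - t \<noteq> 0" "1 - t \<notin> \<real>\<^sub>\<le>\<^sub>0"
      using re[OF t] by (auto simp: complex_nonpos_Reals_iff)
    have 1: "((\<lambda>t. 1 - t) has_field_derivative - 1) (at t)"
      by (auto intro!: derivative_eq_intros)
    have 2: "((\<lambda>t. (\<alpha> + 1) * Ln (1 - t)) has_field_derivative (\<alpha> + 1) * (inverse (1 - t) * - 1)) (at t)"
      by (rule DERIV_cmult[OF DERIV_chain2[OF has_field_derivative_Ln[OF nz(2)] 1]])
    have 3: "((\<lambda>t. of_real x * t) has_field_derivative of_real x) (at t)"
      by (auto intro!: derivative_eq_intros)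
    have "(E has_field_derivative E t * ((\<alpha> + 1) * (inverse (1 - t) * - 1)
        + (of_real x * (1 - t) - of_real x * t * - 1) / ((1 - t) * (1 - t)))) (at t)"
      unfolding E_def by (rule DERIV_chain2[OF DERIV_exp DERIV_add[OF 2 DERIV_divide[OF 3 1 nz(1)]]])
    moreover have "(\<alpha> + 1) * (inverse (1 - t) * - 1) + (of_real x * (1 - t) - of_real x * t * - 1) / ((1 - t) * (1 - t))
        = - (\<alpha> + 1) / (1 - t) + of_real x / (1 - t)\<^sup>2"
      by (simp add: divide_inverse power2_eq_square algebra_simps)
    ultimately show ?thesis
      by simp
  qed
  have "((\<lambda>t. f t * E t) has_field_derivative 0) (at t within ball 0 1)" if "t \<in> ball 0 1" for t
  proof -
    have t: "norm t < 1" using that by simp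
    have z: "(P - R) * f t * E t + E t * (- P + R) * f t = 0" for P R
      by (simp add: algebra_simps)
    have "((\<lambda>t. f t * E t) has_field_derivative 0) (at t)"
      by (rule DERIV_cong[OF DERIV_mult[OF f'[OF t] E'[OF t]]]) (simp only: minus_divide_left[symmetric] z)
    then show ?thesis by (rule has_field_derivative_at_within)
  qed
  from has_field_derivative_zero_constant[OF convex_ball this]
  obtain c where c: "\<And>t. norm t < 1 \<Longrightarrow> f t * E t = c"
    by (auto simp: dist_norm)
  have "f 0 = 1"
    unfolding f_def by (subst powser_zero) simp
  then have "f t * E t = 1"
    using c[of 0] c[OF t] by (simp add: E_def)
  then have "f t = inverse (E t)"
    by (simp add: E_def inverse_eq_divide eq_divide_eq)
  then have "f t = exp (- (\<alpha> + 1) * Ln (1 - t) - of_real x * t / (1 - t))"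
    by (simp add: E_def exp_minus[symmetric] algebra_simps)
  then show ?thesis
    using summable_sums[OF sm[OF t, of \<alpha>]] unfolding f_def by (simp only:)
qed

subsection \<open>The incomplete Gamma function\<close>

lemma incomplete_Gamma_integrand_bound:
  assumes "x0 > 0"
  obtains C where "C > 0"
    "\<And>t. t \<ge> x0 \<Longrightarrow> norm (complex_of_real t powr (s - 1) * of_real (exp (- t))) \<le> C * exp (- (1 / 2) * t)"
proof -
  obtain C where C: "C > 0" "\<And>y. y \<ge> x0 \<Longrightarrow> y powr (Re s - 1) \<le> C * exp (1 / 2 * y)"
    using powr_le_exp[of x0 "1 / 2" "Re s - 1"] assms by auto
  have "norm (complex_of_real t powr (s - 1) * of_real (exp (- t))) \<le> C * exp (- (1 / 2) * t)" if t: "t \<ge> x0" for t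
  proof -
    have "norm (complex_of_real t powr (s - 1) * of_real (exp (- t))) = t powr (Re s - 1) * exp (- t)"
      using t assms by (simp add: norm_mult norm_powr_real_powr)
    also have "\<dots> \<le> C * exp (1 / 2 * t) * exp (- t)"
      using C(2)[OF t] by (intro mult_right_mono) auto
    also have "\<dots> = C * exp (- (1 / 2) * t)"
      unfolding mult.assoc exp_add[symmetric] by simp
    finally show ?thesis .
  qed
  then show ?thesis using that[of C] C(1) by blast
qed

lemma continuous_on_incomplete_Gamma_integrand:
  assumes "\<And>t. t \<in> S \<Longrightarrow> t > 0"
  shows "continuous_on S (\<lambda>t. complex_of_real t powr (s - 1) * of_real (exp (- t)))"
  using assms by (intro continuous_intros) (auto intro: less_imp_le)

lemma incomplete_Gamma_integrable:
  assumes "x0 > 0"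
  shows "(\<lambda>t. complex_of_real t powr (s - 1) * of_real (exp (- t))) integrable_on {x0..}"
proof -
  obtain C where C: "C > 0"
    "\<And>t. t \<ge> x0 \<Longrightarrow> norm (complex_of_real t powr (s - 1) * of_real (exp (- t))) \<le> C * exp (- (1 / 2) * t)"
    using incomplete_Gamma_integrand_bound[OF assms] by blast
  have "(\<lambda>t. C * exp (- (1 / 2) * t)) integrable_on {x0..}"
    using has_integral_mult_right[OF has_integral_exp_minus_to_infinity[of "1 / 2" x0], of C]
    unfolding integrable_on_def by auto
  then show ?thesis
  proof (rule measurable_bounded_by_integrable_imp_integrable[rotated])
    show "(\<lambda>t. complex_of_real t powr (s - 1) * of_real (exp (- t))) \<in> borel_measurable (lebesgue_on {x0..})"
      using assms by (intro continuous_imp_measurable_on_sets_lebesgue continuous_on_incomplete_Gamma_integrand) auto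
  qed (use C(2) in \<open>simp_all only: atLeast_iff, simp_all\<close>)
qed

lemma upper_incomplete_Gamma_split:
  assumes "0 < u" "u \<le> v"
  shows "upper_incomplete_Gamma s u =
    integral {u..v} (\<lambda>t. complex_of_real t powr (s - 1) * of_real (exp (- t))) + upper_incomplete_Gamma s v"
proof -
  let ?h = "\<lambda>t. complex_of_real t powr (s - 1) * of_real (exp (- t))"
  have 1: "(?h has_integral integral {u..v} ?h) {u..v}"
    using assms by (intro integrable_integral integrable_continuous_real continuous_on_incomplete_Gamma_integrand) auto
  have 2: "(?h has_integral upper_incomplete_Gamma s v) {v..}"
    unfolding upper_incomplete_Gamma_def using assms
    by (intro integrable_integral incomplete_Gamma_integrable) auto
  have "{u..v} \<inter> {v..} \<subseteq> {v}" by auto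
  then have "negligible ({u..v} \<inter> {v..})"
    by (rule negligible_subset[rotated]) simp
  from has_integral_Un[OF 1 2 this]
  have "(?h has_integral integral {u..v} ?h + upper_incomplete_Gamma s v) ({u..v} \<union> {v..})" .
  also have "{u..v} \<union> {v..} = {u..}"
    using assms by auto
  finally show ?thesis
    unfolding upper_incomplete_Gamma_def[of s u] by (rule integral_unique)
qed

lemma upper_incomplete_Gamma_has_vector_derivative:
  assumes "v > 0"
  shows "((\<lambda>v. upper_incomplete_Gamma s v) has_vector_derivative
    - (complex_of_real v powr (s - 1) * of_real (exp (- v)))) (at v)"
proof -
  let ?h = "\<lambda>t. complex_of_real t powr (s - 1) * of_real (exp (- t))"
  \<comment> \<open>Only an integral over a compact interval is differentiated; the tail from 2 v on
    is a constant.\<close>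
  have c: "continuous_on {v / 2..2 * v} ?h"
    using assms by (intro continuous_on_incomplete_Gamma_integrand) auto
  have "((\<lambda>u. integral {u..2 * v} ?h) has_vector_derivative - ?h v) (at v within {v / 2..2 * v})"
    using assms by (intro integral_has_vector_derivative'[OF c]) auto
  then have "((\<lambda>u. integral {u..2 * v} ?h) has_vector_derivative - ?h v) (at v)"
    using assms by (subst (asm) at_within_interior) auto
  then have "((\<lambda>u. integral {u..2 * v} ?h + upper_incomplete_Gamma s (2 * v)) has_vector_derivative - ?h v) (at v)"
    by (simp add: has_vector_derivative_add_const)
  then show ?thesis
  proof (rule has_vector_derivative_transform_within_open[where S = "{v / 2<..<2 * v}"])
    fix u assume "u \<in> {v / 2<..<2 * v}"
    then show "integral {u..2 * v} ?h + upper_incomplete_Gamma s (2 * v) = upper_incomplete_Gamma s u"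
      using assms by (subst upper_incomplete_Gamma_split[of u "2 * v"]) auto
  qed (use assms in auto)
qed

lemma upper_incomplete_Gamma_tendsto_0: "(upper_incomplete_Gamma s \<longlongrightarrow> 0) at_top"
proof -
  obtain C where C: "C > 0"
    "\<And>t. t \<ge> 1 \<Longrightarrow> norm (complex_of_real t powr (s - 1) * of_real (exp (- t))) \<le> C * exp (- (1 / 2) * t)"
    by (rule incomplete_Gamma_integrand_bound[OF zero_less_one, of s]) blast
  have bd: "norm (upper_incomplete_Gamma s v) \<le> C * (exp (- (1 / 2) * v) / (1 / 2))" if "v \<ge> 1" for v
  proof -
    have i: "((\<lambda>t. C * exp (- (1 / 2) * t)) has_integral C * (exp (- (1 / 2) * v) / (1 / 2))) {v..}"
      by (intro has_integral_mult_right has_integral_exp_minus_to_infinity) simp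
    have "norm (upper_incomplete_Gamma s v) \<le> integral {v..} (\<lambda>t. C * exp (- (1 / 2) * t))"
      unfolding upper_incomplete_Gamma_def
    proof (rule Henstock_Kurzweil_Integration.integral_norm_bound_integral)
      show "(\<lambda>t. complex_of_real t powr (s - 1) * of_real (exp (- t))) integrable_on {v..}"
        using that by (intro incomplete_Gamma_integrable) simp
      show "(\<lambda>t. C * exp (- (1 / 2) * t)) integrable_on {v..}"
        using i by (rule has_integral_integrable)
    qed (use that C(2) in auto)
    also have "\<dots> = C * (exp (- (1 / 2) * v) / (1 / 2))"
      using i by (rule integral_unique)
    finally show ?thesis .
  qed
  have "((\<lambda>v::real. C * (exp (- (1 / 2) * v) / (1 / 2))) \<longlongrightarrow> C * (0 / (1 / 2))) at_top"
  proof (intro tendsto_intros)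
    have "filterlim (\<lambda>v::real. - (1 / 2) * v) at_bot at_top"
      by (rule filterlim_tendsto_neg_mult_at_bot[OF tendsto_const _ filterlim_ident]) simp
    then show "((\<lambda>v::real. exp (- (1 / 2) * v)) \<longlongrightarrow> 0) at_top"
      by (rule filterlim_compose[OF exp_at_bot])
  qed auto
  then have "((\<lambda>v::real. C * (exp (- (1 / 2) * v) / (1 / 2))) \<longlongrightarrow> 0) at_top"
    by simp
  moreover have "eventually (\<lambda>v. norm (upper_incomplete_Gamma s v) \<le> C * (exp (- (1 / 2) * v) / (1 / 2))) at_top"
    using eventually_ge_at_top[of 1] by (rule eventually_mono) (rule bd)
  ultimately show ?thesis
    by (rule Lim_null_comparison[rotated])
qed

lemma has_vector_derivative_of_real_powr:
  assumes "v > 0"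
  shows "((\<lambda>v. complex_of_real v powr s) has_vector_derivative s * of_real v powr (s - 1)) (at v)"
proof -
  have "((\<lambda>w. w powr s) has_field_derivative s * of_real v powr (s - 1)) (at (complex_of_real v))"
    using assms by (intro has_field_derivative_powr) (auto simp: complex_nonpos_Reals_iff)
  from has_vector_derivative_real_field[OF this] show ?thesis .
qed

lemma zero_derivative_constant_pos:
  fixes f :: "real \<Rightarrow> complex"
  assumes "\<And>v. v > 0 \<Longrightarrow> (f has_vector_derivative 0) (at v)"
  obtains c where "\<And>v. v > 0 \<Longrightarrow> f v = c"
proof -
  have "\<exists>c. \<forall>v\<in>{0<..}. f v = c"
  proof (rule has_derivative_zero_constant)
    fix v :: real assume "v \<in> {0<..}"
    then have "(f has_vector_derivative 0) (at v within {0<..})"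
      by (intro has_vector_derivative_at_within[OF assms]) simp
    then show "(f has_derivative (\<lambda>h. 0)) (at v within {0<..})"
      by (simp add: has_vector_derivative_def)
  qed simp
  then obtain c where c: "\<forall>v\<in>{0<..}. f v = c" ..
  show ?thesis
    by (rule that[of c]) (use c in simp)
qed

text \<open>In place of an integration by parts over an unbounded interval: the difference D of the
  two sides has derivative 0 and tends to 0 at infinity.\<close>

lemma upper_incomplete_Gamma_plus1:
  assumes x: "x > 0"
  shows "upper_incomplete_Gamma (s + 1) x =
    s * upper_incomplete_Gamma s x + of_real x powr s * of_real (exp (- x))"
proof -
  define D where "D v = upper_incomplete_Gamma (s + 1) v - s * upper_incomplete_Gamma s v
      - of_real v powr s * of_real (exp (- v))" for v
  have e: "((\<lambda>v. complex_of_real (exp (- v))) has_vector_derivative - of_real (exp (- v))) (at v)" for v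
  proof -
    have "((\<lambda>w. exp (- w)) has_field_derivative - exp (- of_real v)) (at (of_real v :: complex))"
      by (auto intro!: derivative_eq_intros)
    from has_vector_derivative_real_field[OF this] show ?thesis
      by (simp flip: exp_of_real)
  qed
  have "(D has_vector_derivative 0) (at v)" if "v > 0" for v
  proof -
    have 1: "(upper_incomplete_Gamma (s + 1) has_vector_derivative
        - (of_real v powr s * of_real (exp (- v)))) (at v)"
      using upper_incomplete_Gamma_has_vector_derivative[OF that, of "s + 1"] by simp
    have 2: "((\<lambda>v. s * upper_incomplete_Gamma s v) has_vector_derivative
        s * - (of_real v powr (s - 1) * of_real (exp (- v)))) (at v)"
      using that by (intro has_vector_derivative_mult_right upper_incomplete_Gamma_has_vector_derivative)
    have 3: "((\<lambda>v. of_real v powr s * of_real (exp (- v))) has_vector_derivative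
        of_real v powr s * (- of_real (exp (- v))) + s * of_real v powr (s - 1) * of_real (exp (- v))) (at v)"
      by (rule has_vector_derivative_mult[OF has_vector_derivative_of_real_powr[OF that] e])
    from has_vector_derivative_diff[OF has_vector_derivative_diff[OF 1 2] 3]
    have "(D has_vector_derivative
        - (of_real v powr s * of_real (exp (- v))) - s * - (of_real v powr (s - 1) * of_real (exp (- v)))
        - (of_real v powr s * (- of_real (exp (- v))) + s * of_real v powr (s - 1) * of_real (exp (- v)))) (at v)"
      unfolding D_def .
    then show ?thesis by (simp add: algebra_simps)
  qed
  then obtain c where c: "\<And>v. v > 0 \<Longrightarrow> D v = c"
    using zero_derivative_constant_pos by blast
  obtain C where C: "C > 0"
    "\<And>t. t \<ge> 1 \<Longrightarrow> norm (complex_of_real t powr (s + 1 - 1) * of_real (exp (- t))) \<le> C * exp (- (1 / 2) * t)"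
    by (rule incomplete_Gamma_integrand_bound[OF zero_less_one, of "s + 1"]) blast
  have "((\<lambda>v. complex_of_real v powr s * of_real (exp (- v))) \<longlongrightarrow> 0) at_top"
  proof (rule Lim_null_comparison)
    show "\<forall>\<^sub>F v in at_top. norm (complex_of_real v powr s * of_real (exp (- v))) \<le> C * exp (- (1 / 2) * v)"
      using eventually_ge_at_top[of 1] by eventually_elim (use C(2) in auto)
    have "filterlim (\<lambda>v::real. - (1 / 2) * v) at_bot at_top"
      by (rule filterlim_tendsto_neg_mult_at_bot[OF tendsto_const _ filterlim_ident]) simp
    then have "((\<lambda>v::real. exp (- (1 / 2) * v)) \<longlongrightarrow> 0) at_top"
      by (rule filterlim_compose[OF exp_at_bot])
    then show "((\<lambda>v::real. C * exp (- (1 / 2) * v)) \<longlongrightarrow> 0) at_top"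
      by (rule tendsto_mult_right_zero)
  qed
  then have "(D \<longlongrightarrow> 0 - s * 0 - 0) at_top"
    unfolding D_def by (intro tendsto_intros upper_incomplete_Gamma_tendsto_0)
  moreover have "(D \<longlongrightarrow> c) at_top"
    by (rule tendsto_eventually, rule eventually_mono[OF eventually_gt_at_top[of 0]]) (use c in auto)
  ultimately have "c = 0"
    using tendsto_unique[of at_top D c 0] by simp
  then show ?thesis
    using c[OF x] by (simp add: D_def algebra_simps)
qed

lemma of_real_powr_eq_exp:
  "y > 0 \<Longrightarrow> complex_of_real y powr c = exp (c * of_real (ln y))"
  by (simp add: powr_def Ln_of_real)

section \<open>Moments of the Beta density and the case a = 1\<close>

lemma weight_1_0:
  assumes "d \<notin> \<int>\<^sub>\<le>\<^sub>0"
  shows "weight 1 d 0 = 1 / d"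
proof -
  have "d * weight 1 d 0 = Gamma d * rGamma d"
    using rGamma_plus1[of d] by (simp add: weight_def add.commute mult.left_commute)
  also have "\<dots> = 1"
    using assms by (simp add: rGamma_inverse_Gamma Gamma_eq_zero_iff)
  finally show ?thesis
    using assms by (auto simp: eq_divide_eq mult.commute)
qed

lemma continuous_on_one_minus_powr:
  assumes "Re d > 0"
  shows "continuous_on {0..1} (\<lambda>t. complex_of_real (1 - t) powr d)"
  using assms by (intro continuous_intros) auto

text \<open>Multiplying the integrand by t = 1 - (1 - t) matches \<open>weight_diff\<close>, so the
  step from n to n + 1 uses the moments for d and d + 1. For Re d < 1 the integrand is unbounded
  near 1; the antiderivative in the base case is still continuous there.\<close>

lemma has_integral_beta_nat:
  assumes "Re d > 0"
  shows "((\<lambda>t. of_real t ^ n * complex_of_real (1 - t) powr (d - 1)) has_integral weight 1 d n) {0..1}"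
  using assms
proof (induction n arbitrary: d)
  case 0
  have d: "d \<noteq> 0" "d \<notin> \<int>\<^sub>\<le>\<^sub>0" using 0 Re_pos_notin_nonpos_Ints by auto
  define f where "f t = - (complex_of_real (1 - t) powr d / d)" for t
  have "(f has_vector_derivative complex_of_real (1 - t) powr (d - 1)) (at t)" if t: "t \<in> {0<..<1}" for t
  proof -
    have 1: "((\<lambda>t. 1 - t) has_vector_derivative - 1) (at t)"
      by (auto intro!: derivative_eq_intros)
    have "((\<lambda>v. complex_of_real v powr d) has_vector_derivative d * of_real (1 - t) powr (d - 1)) (at (1 - t))"
      using t by (intro has_vector_derivative_of_real_powr) auto
    from vector_diff_chain_at[OF 1 this]
    have "((\<lambda>t. complex_of_real (1 - t) powr d) has_vector_derivative - (d * of_real (1 - t) powr (d - 1))) (at t)"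
      by (simp add: o_def)
    then have "((\<lambda>t. complex_of_real (1 - t) powr d * (- 1 / d)) has_vector_derivative - (d * of_real (1 - t) powr (d - 1)) * (- 1 / d)) (at t)"
      by (rule has_vector_derivative_mult_left)
    then show ?thesis
      using d by (simp add: f_def[abs_def])
  qed
  moreover have "continuous_on {0..1} f"
    unfolding f_def using 0 by (intro continuous_intros continuous_on_one_minus_powr) (use d in auto)
  ultimately have "((\<lambda>t. complex_of_real (1 - t) powr (d - 1)) has_integral (f 1 - f 0)) {0..1}"
    by (intro fundamental_theorem_of_calculus_interior) auto
  then show ?case
    using d by (simp add: f_def weight_1_0)
next
  case (Suc n)
  have d: "d \<notin> \<int>\<^sub>\<le>\<^sub>0" using Suc.prems Re_pos_notin_nonpos_Ints by auto
  have 1: "((\<lambda>t. of_real t ^ n * complex_of_real (1 - t) powr (d - 1)) has_integral weight 1 d n) {0..1}"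
    by (rule Suc.IH[OF Suc.prems])
  have 2: "((\<lambda>t. of_real t ^ n * complex_of_real (1 - t) powr (d + 1 - 1)) has_integral weight 1 (d + 1) n) {0..1}"
    using Suc.prems by (intro Suc.IH) auto
  \<comment> \<open>At t = 1 both sides are 0, since \<open>0 powr w\<close> is 0.\<close>
  have e: "complex_of_real (1 - t) powr (d + 1 - 1) = of_real (1 - t) * complex_of_real (1 - t) powr (d - 1)" for t
  proof (cases "t = 1")
    case False
    then show ?thesis
      using powr_add[of "complex_of_real (1 - t)" 1 "d - 1"] by simp
  qed simp
  have "weight 1 d n - weight 1 (d + 1) n = weight 1 d (Suc n)"
    using weight_diff[OF d, of 1 n] by (simp add: algebra_simps)
  with has_integral_diff[OF 1 2] show ?case
    unfolding e by (simp add: algebra_simps)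
qed

lemma power_over_fact_le_exp:
  assumes "(y::real) \<ge> 0"
  shows "y ^ k / fact k \<le> exp y"
proof -
  have "(\<Sum>n\<in>{k}. y ^ n /\<^sub>R fact n) \<le> (\<Sum>n. y ^ n /\<^sub>R fact n)"
    using assms by (intro sum_le_suminf summable_exp_generic) auto
  then show ?thesis
    by (simp add: exp_def divide_inverse mult.commute)
qed

text \<open>With u = 1 - t, t \<le> exp(-u) gives t^n \<le> e exp(-(n + 1) u), and y^k / k! \<le>
  exp y at y = (n + 1) u bounds what is left.\<close>

lemma beta_integrand_bound:
  assumes t: "0 \<le> t" "t \<le> (1::real)"
  shows "t ^ n * (1 - t) ^ k \<le> exp 1 * fact k * (real n + 1) powr (- real k)"
proof -
  define u where "u = 1 - t"
  have u: "0 \<le> u" "u \<le> 1" using t by (auto simp: u_def)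
  have "t \<le> exp (- u)"
    using exp_ge_add_one_self[of "- u"] by (simp add: u_def)
  then have "t ^ n \<le> exp (- u) ^ n"
    using t by (intro power_mono) auto
  also have "\<dots> = exp (- (real n * u))"
    by (simp add: exp_of_nat_mult[symmetric])
  also have "\<dots> \<le> exp (1 - (real n + 1) * u)"
    using u by (simp add: algebra_simps)
  also have "\<dots> = exp 1 / exp ((real n + 1) * u)"
    by (rule exp_diff)
  finally have "t ^ n * u ^ k \<le> exp 1 / exp ((real n + 1) * u) * u ^ k"
    using u by (intro mult_right_mono) auto
  also have "\<dots> \<le> exp 1 * fact k * (real n + 1) powr (- real k)"
  proof -
    have "((real n + 1) * u) ^ k / fact k \<le> exp ((real n + 1) * u)"
      using u by (intro power_over_fact_le_exp) auto
    then have "(real n + 1) ^ k * u ^ k \<le> fact k * exp ((real n + 1) * u)"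
      by (simp only: power_mult_distrib[symmetric] pos_divide_le_eq[OF fact_gt_zero] mult.commute)
    then have "u ^ k / exp ((real n + 1) * u) \<le> fact k / (real n + 1) ^ k"
      by (simp add: field_simps)
    then have "exp 1 * (u ^ k / exp ((real n + 1) * u)) \<le> exp 1 * (fact k / (real n + 1) ^ k)"
      by (intro mult_left_mono) auto
    then show ?thesis
      by (simp add: powr_minus_divide powr_realpow)
  qed
  finally show ?thesis by (simp add: u_def)
qed

text \<open>Termwise integration of the generating function against (1 - t)^(d-1); the partial sums
  are dominated by a constant, the sum of the uniform bounds M n.\<close>

lemma laguerre_weight_1_integral:
  assumes x: "x > 0" and d: "Re d \<ge> Re \<alpha> / 2 + 13 / 4" "Re d \<ge> 2"
  obtains S where "(\<lambda>n. laguerre n \<alpha> (of_real x) * weight 1 d n) sums S"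
    "((\<lambda>t. exp (- (\<alpha> + 1) * Ln (1 - of_real t) - of_real x * of_real t / (1 - of_real t))
        * complex_of_real (1 - t) powr (d - 1)) has_integral S) {0..1}"
proof -
  define p where "p = Re \<alpha> / 2 + 1 / 4"
  define L where "L n = laguerre n \<alpha> (of_real x)" for n
  obtain K where K: "K > 0" "\<And>n. norm (L n) \<le> K * (real n + 1) powr p"
    using laguerre_boundedE[OF laguerre_bound[OF x, of \<alpha>]] unfolding L_def p_def by blast
  \<comment> \<open>An integer power of 1 - t is wanted. As k > Re d - 2, the exponent p - k of M is
    below p - Re d + 2 \<le> -1; this is the origin of 13/4 = 1/4 + 3.\<close>
  define k where "k = nat \<lfloor>Re d - 1\<rfloor>"
  have k: "real k \<le> Re d - 1" "real k > Re d - 2"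
    using d(2) by (auto simp: k_def) linarith+
  define M where "M n = K * (exp 1 * fact k) * (real n + 1) powr (p - real k)" for n
  have M: "norm (L n * (of_real t ^ n * complex_of_real (1 - t) powr (d - 1))) \<le> M n" if t: "t \<in> {0..1}" for n t
  proof -
    have "norm (complex_of_real (1 - t) powr (d - 1)) \<le> (1 - t) ^ k"
    proof (cases "t = 1")
      case False
      with t have "norm (complex_of_real (1 - t) powr (d - 1)) = (1 - t) powr (Re d - 1)"
        by (subst norm_powr_real_powr) auto
      also have "\<dots> \<le> (1 - t) powr real k"
        using t k by (intro powr_mono') auto
      also have "\<dots> = (1 - t) ^ k"
        using t False by (simp add: powr_realpow)
      finally show ?thesis .
    qed simp
    then have "t ^ n * norm (complex_of_real (1 - t) powr (d - 1)) \<le> t ^ n * (1 - t) ^ k"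
      using t by (intro mult_left_mono) auto
    also have "\<dots> \<le> exp 1 * fact k * (real n + 1) powr (- real k)"
      using t by (intro beta_integrand_bound) auto
    finally have "norm (of_real t ^ n * complex_of_real (1 - t) powr (d - 1)) \<le> exp 1 * fact k * (real n + 1) powr (- real k)"
      using t by (simp add: norm_mult norm_power)
    then have "norm (L n * (of_real t ^ n * complex_of_real (1 - t) powr (d - 1))) \<le>
        (K * (real n + 1) powr p) * (exp 1 * fact k * (real n + 1) powr (- real k))"
      unfolding norm_mult[of "L n"] using K by (intro mult_mono) auto
    also have "\<dots> = M n"
      unfolding M_def powr_diff powr_minus_divide by simp
    finally show ?thesis .
  qed
  have sM: "summable M"
    unfolding M_def using d k by (intro summable_mult summable_powr_minus) (simp add: p_def)
  have M0: "M n \<ge> 0" for n using K(1) by (simp add: M_def)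
  have d1: "1 + d \<notin> \<int>\<^sub>\<le>\<^sub>0"
    using d(2) by (intro Re_pos_notin_nonpos_Ints) simp
  define f where "f N t = (\<Sum>n<N. L n * (of_real t ^ n * complex_of_real (1 - t) powr (d - 1)))" for N t
  define y where "y N = (\<Sum>n<N. L n * weight 1 d n)" for N
  have "summable (\<lambda>n. L n * weight 1 d n)"
  proof -
    obtain K' where K': "K' > 0" "\<And>n. norm (weight 1 d n) \<le> K' * (real n + 1) powr (- Re d)"
      using weight_bound[OF d1] by blast
    show ?thesis
    proof (rule summable_comparison_test'[where g = "\<lambda>n. K * K' * (real n + 1) powr (p - Re d)"])
      show "summable (\<lambda>n. K * K' * (real n + 1) powr (p - Re d))"
        using d by (intro summable_mult summable_powr_minus) (simp add: p_def)
      show "norm (L n * weight 1 d n) \<le> K * K' * (real n + 1) powr (p - Re d)" for n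
      proof -
        have "norm (L n * weight 1 d n) \<le> (K * (real n + 1) powr p) * (K' * (real n + 1) powr (- Re d))"
          unfolding norm_mult using K K' by (intro mult_mono) auto
        also have "\<dots> = K * K' * (real n + 1) powr (p - Re d)"
          unfolding powr_diff powr_minus_divide by simp
        finally show ?thesis .
      qed
    qed
  qed
  then have S: "(\<lambda>n. L n * weight 1 d n) sums (\<Sum>n. L n * weight 1 d n)"
    by (rule summable_sums)
  let ?g = "\<lambda>t. exp (- (\<alpha> + 1) * Ln (1 - of_real t) - of_real x * of_real t / (1 - of_real t))
        * complex_of_real (1 - t) powr (d - 1)"
  have "(?g has_integral (\<Sum>n. L n * weight 1 d n)) {0..1}"
  proof (rule has_integral_dominated_convergence[where f = f and y = y and h = "\<lambda>_. suminf M"])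
    show "(f N has_integral y N) {0..1}" for N
      unfolding f_def y_def using d(2)
      by (intro has_integral_sum has_integral_mult_right has_integral_beta_nat) auto
    show "\<forall>t\<in>{0..1}. norm (f N t) \<le> suminf M" for N
    proof
      fix t :: real assume t: "t \<in> {0..1}"
      have "norm (f N t) \<le> (\<Sum>n<N. M n)"
        unfolding f_def by (intro order_trans[OF norm_sum] sum_mono M t)
      also have "\<dots> \<le> suminf M"
        by (intro sum_le_suminf sM) (auto simp: M0)
      finally show "norm (f N t) \<le> suminf M" .
    qed
    show "\<forall>t\<in>{0..1}. (\<lambda>N. f N t) \<longlonglongrightarrow> ?g t"
    proof
      fix t :: real assume t: "t \<in> {0..1}"
      show "(\<lambda>N. f N t) \<longlonglongrightarrow> ?g t"
      proof (cases "t = 1")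
        case False
        with t have "norm (complex_of_real t) < 1" by simp
        from sums_mult2[OF laguerre_generating_function[OF x this, of \<alpha>], of "complex_of_real (1 - t) powr (d - 1)"]
        show ?thesis
          by (simp add: sums_def f_def L_def mult.assoc)
      qed (simp add: f_def)
    qed
    show "y \<longlonglongrightarrow> (\<Sum>n. L n * weight 1 d n)"
      using S by (simp add: sums_def y_def[abs_def])
  qed auto
  then show ?thesis
    using that S unfolding L_def by blast
qed

text \<open>The substitution v = x / (1 - t) carries [0, 1) to [x, \<infinity>) and the integrand to
  that of Gamma(s, x). It is carried out by checking that H is an antiderivative.\<close>

theorem incomplete_Gamma_laguerre_series_large:
  assumes x: "x > 0" and d: "Re d \<ge> Re \<alpha> / 2 + 13 / 4" "Re d \<ge> 2"
  defines "s \<equiv> \<alpha> + 1 - d"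
  shows "(\<lambda>n. laguerre n \<alpha> (of_real x) * weight 1 d n) sums
    (of_real x powr (- s) * exp (of_real x) * upper_incomplete_Gamma s x)"
proof -
  let ?g = "\<lambda>t. exp (- (\<alpha> + 1) * Ln (1 - of_real t) - of_real x * of_real t / (1 - of_real t))
        * complex_of_real (1 - t) powr (d - 1)"
  obtain S where S: "(\<lambda>n. laguerre n \<alpha> (of_real x) * weight 1 d n) sums S" "(?g has_integral S) {0..1}"
    using laguerre_weight_1_integral[OF x d] by blast
  define c where "c = - (of_real x powr (- s) * exp (complex_of_real x))"
  define H where "H t = c * upper_incomplete_Gamma s (x / (1 - t))" for t
  \<comment> \<open>The value 0 at t = 1 makes the antiderivative continuous on the closed interval,
    because Gamma(s, v) tends to 0 as v grows; at t = 1 itself the quotient x / (1 - t) would be a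
    division by zero.\<close>
  define G where "G t = (if t < 1 then H t else 0)" for t
  have H': "(H has_vector_derivative ?g t) (at t)" if t: "t < 1" for t
  proof -
    define u where "u = 1 - t"
    have u: "u > 0" using t by (simp add: u_def)
    have 1: "((\<lambda>t. x / (1 - t)) has_vector_derivative (x / u\<^sup>2)) (at t)"
      using t unfolding has_real_derivative_iff_has_vector_derivative[symmetric]
      by (auto intro!: derivative_eq_intros simp: u_def power2_eq_square)
    have "(upper_incomplete_Gamma s has_vector_derivative
        - (complex_of_real (x / (1 - t)) powr (s - 1) * of_real (exp (- (x / (1 - t)))))) (at (x / (1 - t)))"
      using t x by (intro upper_incomplete_Gamma_has_vector_derivative) auto
    from vector_diff_chain_at[OF 1 this]
    have "((\<lambda>t. upper_incomplete_Gamma s (x / (1 - t))) has_vector_derivative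
        (x / u\<^sup>2) *\<^sub>R - (complex_of_real (x / u) powr (s - 1) * of_real (exp (- (x / u))))) (at t)"
      by (simp add: o_def u_def)
    then have "(H has_vector_derivative
        c * ((x / u\<^sup>2) *\<^sub>R - (complex_of_real (x / u) powr (s - 1) * of_real (exp (- (x / u)))))) (at t)"
      unfolding H_def by (rule has_vector_derivative_mult_right)
    moreover have "c * ((x / u\<^sup>2) *\<^sub>R - (complex_of_real (x / u) powr (s - 1) * of_real (exp (- (x / u))))) = ?g t"
    proof -
      let ?lx = "complex_of_real (ln x)" and ?lu = "complex_of_real (ln u)"
      have xu: "complex_of_real (x / u\<^sup>2) = exp (?lx - 2 * ?lu)"
      proof -
        have "x / u\<^sup>2 = exp (ln x - 2 * ln u)"
          using x u by (simp add: exp_diff exp_double)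
        then have "complex_of_real (x / u\<^sup>2) = exp (of_real (ln x - 2 * ln u))"
          by (simp only: exp_of_real)
        then show ?thesis by simp
      qed
      have "complex_of_real (ln (x / u)) = ?lx - ?lu"
        using x u by (simp add: ln_div)
      then have e: "complex_of_real (x / u) powr (s - 1) = exp ((s - 1) * (?lx - ?lu))"
        using of_real_powr_eq_exp[of "x / u" "s - 1"] x u by (simp only: divide_pos_pos)
      have e3: "complex_of_real (exp (- (x / u))) = exp (- complex_of_real (x / u))"
        using exp_of_real[of "- (x / u)", where 'a = complex] by (simp only: of_real_minus)
      have "c * ((x / u\<^sup>2) *\<^sub>R - (complex_of_real (x / u) powr (s - 1) * of_real (exp (- (x / u))))) =
          exp (- s * ?lx) * exp (complex_of_real x) * exp (?lx - 2 * ?lu) * (exp ((s - 1) * (?lx - ?lu)) * exp (- complex_of_real (x / u)))"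
        unfolding c_def scaleR_conv_of_real xu e e3 of_real_powr_eq_exp[OF x] by simp
      also have "\<dots> = exp (- s * ?lx + of_real x + (?lx - 2 * ?lu) + ((s - 1) * (?lx - ?lu) - of_real (x / u)))"
        by (simp add: exp_add exp_diff exp_minus divide_inverse)
      also have "- s * ?lx + of_real x + (?lx - 2 * ?lu) + ((s - 1) * (?lx - ?lu) - of_real (x / u)) =
          (- (\<alpha> + 1) * ?lu - of_real x * of_real t / of_real u) + (d - 1) * ?lu"
      proof -
        have "complex_of_real x - of_real (x / u) = - (of_real x * of_real t / of_real u)"
          using u by (simp add: u_def field_simps)
        then show ?thesis
          by (simp add: s_def algebra_simps)
      qed
      also have "exp \<dots> = ?g t"
      proof -
        have "Ln (1 - complex_of_real t) = ?lu"
          using Ln_of_real[OF u] by (simp add: u_def)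
        then show ?thesis
          unfolding exp_add u_def[symmetric] of_real_powr_eq_exp[OF u] by (simp add: u_def)
      qed
      finally show ?thesis .
    qed
    ultimately show ?thesis by simp
  qed
  have G': "(G has_vector_derivative ?g t) (at t)" if t: "t < 1" for t
    by (rule has_vector_derivative_transform_within_open[OF H'[OF t], of "{..<1}"])
       (use t in \<open>auto simp: G_def\<close>)
  have "continuous_on {0..1} G"
    unfolding continuous_on_eq_continuous_within
  proof
    fix t :: real assume t: "t \<in> {0..1}"
    show "continuous (at t within {0..1}) G"
    proof (cases "t < 1")
      case True
      then show ?thesis
        using has_vector_derivative_continuous[OF G'] continuous_at_imp_continuous_at_within by blast
    next
      case False
      then have t1: "t = 1" using t by simp
      have "filterlim (\<lambda>t. 1 - t) (at_right 0) (at_left (1::real))"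
        unfolding filterlim_at by (auto intro!: tendsto_eq_intros simp: eventually_at_filter)
      then have "filterlim (\<lambda>t. inverse (1 - t)) at_top (at_left (1::real))"
        by (rule filterlim_compose[OF filterlim_inverse_at_top_right])
      then have "filterlim (\<lambda>t. x * inverse (1 - t)) at_top (at_left (1::real))"
        by (rule filterlim_tendsto_pos_mult_at_top[OF tendsto_const x])
      then have "filterlim (\<lambda>t. x / (1 - t)) at_top (at_left (1::real))"
        by (simp add: divide_inverse)
      then have "((\<lambda>t. upper_incomplete_Gamma s (x / (1 - t))) \<longlongrightarrow> 0) (at_left 1)"
        by (rule filterlim_compose[OF upper_incomplete_Gamma_tendsto_0])
      then have "(H \<longlongrightarrow> 0) (at_left 1)"
        unfolding H_def by (rule tendsto_mult_right_zero)
      then have "(G \<longlongrightarrow> 0) (at_left 1)"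
        by (rule Lim_transform_eventually) (auto simp: G_def eventually_at_filter)
      moreover have "at (1::real) within {0..1} = at_left 1"
        by (rule at_within_Icc_at_left) simp
      ultimately show ?thesis
        unfolding continuous_within t1 by (simp add: G_def)
    qed
  qed
  then have "(?g has_integral (G 1 - G 0)) {0..1}"
    by (intro fundamental_theorem_of_calculus_interior G') auto
  then have "S = G 1 - G 0"
    using S(2) has_integral_unique by blast
  then have "S = of_real x powr (- s) * exp (of_real x) * upper_incomplete_Gamma s x"
    by (simp add: G_def H_def c_def)
  then show ?thesis using S(1) by simp
qed

section \<open>The incomplete Gamma function in terms of M\<close>

lemma kummer_M_has_field_derivative:
  assumes b: "b \<notin> \<int>\<^sub>\<le>\<^sub>0"
  shows "(kummer_M a b has_field_derivative a / b * kummer_M (a + 1) (b + 1) z) (at z)"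
proof -
  define c where "c n = pochhammer a n / pochhammer b n / fact n" for n
  have t: "kummer_term a b z n = c n * z ^ n" for n z
    by (simp add: kummer_term_def c_def)
  have sm: "summable (\<lambda>n. c n * z ^ n)" for z
    using summable_kummer_term[of a b z] unfolding t .
  have "((\<lambda>z. \<Sum>n. c n * z ^ n) has_field_derivative (\<Sum>n. diffs c n * z ^ n)) (at z)"
    by (rule termdiffs_strong'[where K = "norm z + 1"]) (auto intro: sm)
  moreover have "kummer_M a b = (\<lambda>z. \<Sum>n. c n * z ^ n)"
    unfolding kummer_M_eq[abs_def] t ..
  moreover have "diffs c n * z ^ n = a / b * kummer_term (a + 1) (b + 1) z n" for n
    by (simp add: diffs_def c_def kummer_term_def pochhammer_rec del: of_nat_Suc)
  then have "(\<Sum>n. diffs c n * z ^ n) = a / b * kummer_M (a + 1) (b + 1) z"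
    unfolding kummer_M_eq by (simp only: suminf_mult[OF summable_kummer_term])
  ultimately show ?thesis by simp
qed

lemma kummer_M_0 [simp]: "kummer_M a b 0 = 1"
proof -
  have "kummer_M a b 0 = (\<Sum>n\<in>{0}. kummer_term a b 0 n)"
    unfolding kummer_M_eq by (rule suminf_finite) (auto simp: kummer_term_def)
  then show ?thesis by (simp add: kummer_term_def)
qed

lemma kummer_M_refl:
  assumes "b \<notin> \<int>\<^sub>\<le>\<^sub>0"
  shows "kummer_M b b z = exp z"
proof -
  have "kummer_term b b z n = z ^ n /\<^sub>R fact n" for n
    using pochhammer_notin_nonpos_Ints[OF assms, of n]
    by (simp add: kummer_term_def scaleR_conv_of_real divide_inverse)
  then show ?thesis
    by (simp add: kummer_M_eq exp_def)
qed

text \<open>The case a = b = s + 1 of \<open>kummer_M_pred\<close>.\<close>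

lemma kummer_M_incomplete_Gamma_rec:
  assumes "s \<notin> \<int>\<^sub>\<le>\<^sub>0"
  shows "kummer_M s (s + 1) z = exp z - z / (s + 1) * kummer_M (s + 1) (s + 2) z"
proof -
  have s1: "s + 1 \<notin> \<int>\<^sub>\<le>\<^sub>0"
    using plus_nat_notin_nonpos_Ints[OF assms, of 1] by simp
  have "s + 1 + 1 = s + 2" by simp
  with kummer_M_pred[OF s1, of "s + 1" z] show ?thesis
    by (simp only: kummer_M_refl[OF s1] add_diff_cancel_right')
qed

lemma upper_incomplete_Gamma_tendsto_Gamma:
  assumes "Re s > 0"
  shows "(upper_incomplete_Gamma s \<longlongrightarrow> Gamma s) (at_right 0)"
proof -
  let ?h = "\<lambda>t. complex_of_real t powr (s - 1) * of_real (exp (- t))"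
  have "?h = (\<lambda>t. of_real t powr (s - 1) / of_real (exp t))"
    by (simp add: exp_minus divide_inverse)
  then have h: "(?h has_integral Gamma s) {0..}"
    using Gamma_integral_complex[OF assms] by (simp only:)
  have int: "?h integrable_on {0..v}" for v
    by (rule integrable_on_subinterval[OF has_integral_integrable[OF h]]) auto
  have split: "upper_incomplete_Gamma s v = Gamma s - integral {0..v} ?h" if "v > 0" for v
  proof -
    have 2: "(?h has_integral upper_incomplete_Gamma s v) {v..}"
      unfolding upper_incomplete_Gamma_def using that
      by (intro integrable_integral incomplete_Gamma_integrable)
    have "{0..v} \<inter> {v..} \<subseteq> {v}" by auto
    then have "negligible ({0..v} \<inter> {v..})"
      by (rule negligible_subset[rotated]) simp
    from has_integral_Un[OF integrable_integral[OF int] 2 this]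
    have "(?h has_integral integral {0..v} ?h + upper_incomplete_Gamma s v) ({0..v} \<union> {v..})" .
    also have "{0..v} \<union> {v..} = {0..}"
      using that by auto
    finally show ?thesis
      using has_integral_unique[OF h] by (simp add: algebra_simps)
  qed
  have "continuous_on {0..1} (\<lambda>v. integral {0..v} ?h)"
    by (rule indefinite_integral_continuous_1[OF int])
  then have "((\<lambda>v. integral {0..v} ?h) \<longlongrightarrow> integral {0..0} ?h) (at 0 within {0..1})"
    unfolding continuous_on_def by (rule bspec) simp
  then have "((\<lambda>v. integral {0..v} ?h) \<longlongrightarrow> 0) (at_right 0)"
    by (simp add: at_within_Icc_at_right)
  then have "((\<lambda>v. Gamma s - integral {0..v} ?h) \<longlongrightarrow> Gamma s - 0) (at_right 0)"
    by (intro tendsto_diff tendsto_const)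
  then have "((\<lambda>v. Gamma s - integral {0..v} ?h) \<longlongrightarrow> Gamma s) (at_right 0)"
    by simp
  then show ?thesis
    by (rule Lim_transform_eventually) (auto simp: eventually_at_filter split)
qed

text \<open>The sum D of Gamma(s, v) and v^s M(s; s + 1; -v) / s has derivative 0; its constant
  value is found as v tends to 0 from the right, where the second summand vanishes because Re s >
  0.\<close>

lemma upper_incomplete_Gamma_eq_Re_pos:
  assumes x: "x > 0" and s: "Re s > 0"
  shows "upper_incomplete_Gamma s x = Gamma s - of_real x powr s * kummer_M s (s + 1) (- of_real x) / s"
proof -
  define D where "D v = upper_incomplete_Gamma s v + of_real v powr s * (kummer_M s (s + 1) (- of_real v) / s)" for v
  have sn: "s \<notin> \<int>\<^sub>\<le>\<^sub>0" and s1: "s + 1 \<notin> \<int>\<^sub>\<le>\<^sub>0" and s0: "s \<noteq> 0"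
    using s Re_pos_notin_nonpos_Ints[of s] Re_pos_notin_nonpos_Ints[of "s + 1"] by auto
  have "s + 1 + 1 = s + 2" by simp
  then have M': "(kummer_M s (s + 1) has_field_derivative s / (s + 1) * kummer_M (s + 1) (s + 2) z) (at z)" for z
    using kummer_M_has_field_derivative[OF s1, of s z] by (simp only:)
  have f: "((\<lambda>w. kummer_M s (s + 1) (- w) / s) has_field_derivative - (kummer_M (s + 1) (s + 2) (- w) / (s + 1))) (at w)" for w
  proof -
    have "((\<lambda>w. - w) has_field_derivative - 1) (at w)"
      by (auto intro!: derivative_eq_intros)
    from DERIV_cdivide[OF DERIV_chain2[OF M' this], of s] show ?thesis
      using s0 by simp
  qed
  have "(D has_vector_derivative 0) (at v)" if v: "v > 0" for v
  proof -
    have "(D has_vector_derivative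
        - (of_real v powr (s - 1) * of_real (exp (- v))) +
        (of_real v powr s * - (kummer_M (s + 1) (s + 2) (- of_real v) / (s + 1)) + s * of_real v powr (s - 1) * (kummer_M s (s + 1) (- of_real v) / s))) (at v)"
      unfolding D_def
      by (rule has_vector_derivative_add[OF upper_incomplete_Gamma_has_vector_derivative[OF v]
            has_vector_derivative_mult[OF has_vector_derivative_of_real_powr[OF v] has_vector_derivative_real_field[OF f]]])
    moreover have p: "of_real v powr s = of_real v * of_real v powr (s - 1)"
      using v powr_add[of "complex_of_real v" 1 "s - 1"] by simp
    moreover have e: "complex_of_real (exp (- v)) = exp (- of_real v)"
      using exp_of_real[of "- v", where 'a = complex] by (simp only: of_real_minus)
    have "- (w * E) + (u * w * - (Q / (s + 1)) + s * w * ((E - - u / (s + 1) * Q) / s)) = 0" for u w E Q :: complex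
    proof -
      have "s * w * ((E - - u / (s + 1) * Q) / s) = w * (E - - u / (s + 1) * Q)"
        using s0 by simp
      then show ?thesis by (simp add: algebra_simps)
    qed
    ultimately show ?thesis
      unfolding p e kummer_M_incomplete_Gamma_rec[OF sn] by simp
  qed
  then obtain c where c: "\<And>v. v > 0 \<Longrightarrow> D v = c"
    using zero_derivative_constant_pos by blast
  have "((\<lambda>v. complex_of_real v powr s) \<longlongrightarrow> 0) (at_right 0)"
    by (rule tendsto_powr_complex_0[OF _ tendsto_const s]) (auto intro!: tendsto_eq_intros)
  moreover have "((\<lambda>v. kummer_M s (s + 1) (- of_real v) / s) \<longlongrightarrow> kummer_M s (s + 1) (- 0) / s) (at_right 0)"
  proof -
    have "isCont (\<lambda>w. kummer_M s (s + 1) (- w) / s) 0"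
      using f by (rule DERIV_isCont)
    moreover have "((\<lambda>v. complex_of_real v) \<longlongrightarrow> 0) (at_right 0)"
      by (auto intro!: tendsto_eq_intros)
    ultimately show ?thesis
      by (rule isCont_tendsto_compose)
  qed
  ultimately have "(D \<longlongrightarrow> Gamma s + 0 * (kummer_M s (s + 1) (- 0) / s)) (at_right 0)"
    unfolding D_def by (intro tendsto_add tendsto_mult upper_incomplete_Gamma_tendsto_Gamma s)
  moreover have "(D \<longlongrightarrow> c) (at_right 0)"
    by (rule tendsto_eventually) (auto simp: eventually_at_filter c)
  ultimately have "c = Gamma s"
    using tendsto_unique[of "at_right (0::real)" D] by simp
  then show ?thesis
    using c[OF x] by (simp add: D_def algebra_simps)
qed

text \<open>Both sides satisfy the same recursion between s and s + 1, which brings the identity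
  down from Re s > 0.\<close>

theorem upper_incomplete_Gamma_eq:
  assumes x: "x > 0" and s: "s \<notin> \<int>\<^sub>\<le>\<^sub>0"
  shows "upper_incomplete_Gamma s x = Gamma s - of_real x powr s * kummer_M s (s + 1) (- of_real x) / s"
proof -
  have step: "upper_incomplete_Gamma s x = Gamma s - of_real x powr s * kummer_M s (s + 1) (- of_real x) / s"
    if s: "s \<notin> \<int>\<^sub>\<le>\<^sub>0" and P: "upper_incomplete_Gamma (s + 1) x =
       Gamma (s + 1) - of_real x powr (s + 1) * kummer_M (s + 1) (s + 2) (- of_real x) / (s + 1)" for s
  proof -
    have s0: "s \<noteq> 0" using s by auto
    have "of_real x powr (s + 1) = of_real x powr s * complex_of_real x"
      using x by (simp add: powr_add)
    moreover have "complex_of_real (exp (- x)) = exp (- of_real x)"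
      using exp_of_real[of "- x", where 'a = complex] by (simp only: of_real_minus)
    ultimately have "s * upper_incomplete_Gamma s x = s * Gamma s - of_real x powr s *
        (exp (- of_real x) - (- of_real x) / (s + 1) * kummer_M (s + 1) (s + 2) (- of_real x))"
      using upper_incomplete_Gamma_plus1[OF x, of s] P Gamma_plus1[OF s] by (simp add: algebra_simps)
    also have "\<dots> = s * (Gamma s - of_real x powr s * kummer_M s (s + 1) (- of_real x) / s)"
      unfolding kummer_M_incomplete_Gamma_rec[OF s, symmetric] using s0 by (simp add: right_diff_distrib)
    finally show ?thesis
      using s0 by (simp only: mult_cancel_left simp_thms)
  qed
  define m where "m = nat \<lceil>- Re s\<rceil> + 1"
  have m: "Re (s + of_nat m) > 0"
    unfolding m_def by (simp del: of_nat_Suc) linarith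
  have "s \<notin> \<int>\<^sub>\<le>\<^sub>0 \<Longrightarrow> Re (s + of_nat k) > 0 \<Longrightarrow>
      upper_incomplete_Gamma s x = Gamma s - of_real x powr s * kummer_M s (s + 1) (- of_real x) / s" for k
  proof (induction k arbitrary: s)
    case 0
    then show ?case using upper_incomplete_Gamma_eq_Re_pos[OF x] by simp
  next
    case (Suc k)
    have s1: "s + 1 \<notin> \<int>\<^sub>\<le>\<^sub>0"
      using plus_nat_notin_nonpos_Ints[OF Suc.prems(1), of 1] by simp
    have e: "s + 1 + 1 = s + 2" by simp
    show ?case
      by (rule step[OF Suc.prems(1) Suc.IH[OF s1, unfolded e]]) (use Suc.prems in \<open>simp add: add_ac\<close>)
  qed
  from this[OF s m] show ?thesis .
qed

subsection \<open>The series for the Kummer function of the second kind\<close>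

lemma Gamma_minus_nat:
  assumes c: "c \<notin> \<int>"
  shows "Gamma (c - of_nat k) = (-1) ^ k * Gamma c / pochhammer (1 - c) k"
proof (induction k)
  case (Suc k)
  have ni: "c - of_nat (Suc k) \<notin> \<int>"
    using c Ints_add[of "c - of_nat (Suc k)" "of_nat (Suc k)"] by (metis Ints_of_nat diff_add_cancel)
  then have "Gamma (c - of_nat (Suc k) + 1) = (c - of_nat (Suc k)) * Gamma (c - of_nat (Suc k))"
    by (intro Gamma_plus1) (auto dest: nonpos_Ints_Int)
  moreover have "c - of_nat (Suc k) \<noteq> 0"
    using ni by auto
  moreover have "c - of_nat (Suc k) + 1 = c - of_nat k"
    by simp
  ultimately have "Gamma (c - of_nat (Suc k)) = Gamma (c - of_nat k) / (c - of_nat (Suc k))"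
    by (metis nonzero_mult_div_cancel_left)
  also have "\<dots> = (-1) ^ k * Gamma c / (pochhammer (1 - c) k * (c - of_nat (Suc k)))"
    unfolding Suc.IH by simp
  finally have F: "Gamma (c - of_nat (Suc k)) = (-1) ^ k * Gamma c / (pochhammer (1 - c) k * (c - of_nat (Suc k)))" .
  have e: "c - of_nat (Suc k) = - (1 - c + of_nat k)"
    by simp
  show ?case
    unfolding F pochhammer_Suc power_Suc by (subst e) (simp del: minus_add_distrib)
qed simp

lemma rGamma_minus_nat:
  fixes c :: complex
  shows "rGamma (c - of_nat k) = (-1) ^ k * rGamma c * pochhammer (1 - c) k"
proof (induction k)
  case (Suc k)
  have "c - of_nat (Suc k) + 1 = c - of_nat k"
    by simp
  then have F: "rGamma (c - of_nat (Suc k)) = (c - of_nat (Suc k)) * rGamma (c - of_nat k)"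
    using rGamma_plus1[of "c - of_nat (Suc k)"] by (simp only:)
  have e: "c - of_nat (Suc k) = - (1 - c + of_nat k)"
    by simp
  show ?case
    unfolding F Suc.IH pochhammer_Suc power_Suc by (subst e) (simp del: minus_add_distrib)
qed simp

text \<open>The coefficients of the binomial series (1 - u)^(a-1). With u = 1 - t it expands t^(a-1)
  in powers of 1 - t, that is, a Beta integral in those with a = 1 and d replaced by d + k.\<close>

definition beta_coeff :: "complex \<Rightarrow> nat \<Rightarrow> complex" where
  "beta_coeff a k = pochhammer (1 - a) k / fact k"

text \<open>The coefficients are O(k^(-Re a)); this is where Re a > 1 comes from.\<close>

lemma summable_norm_beta_coeff:
  assumes "Re a > 1"
  shows "summable (\<lambda>k. norm (beta_coeff a k))"
proof -
  obtain K where K: "K > 0"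
      "\<And>n. norm (pochhammer (1 - a) n / pochhammer 1 n) \<le> K * (real n + 1) powr Re (1 - a - 1)"
    using pochhammer_ratio_bound by blast
  show ?thesis
    by (rule summable_comparison_test'[where g = "\<lambda>n. K * (real n + 1) powr Re (1 - a - 1)"])
       (use K assms in \<open>auto simp: beta_coeff_def pochhammer_fact intro!: summable_mult summable_powr_minus\<close>)
qed

lemma dist_Ints_pos:
  assumes "b \<notin> (\<int> :: complex set)"
  obtains \<delta> where "\<delta> > 0" "\<And>n. n \<in> \<int> \<Longrightarrow> norm (b - n) \<ge> \<delta>"
proof -
  have "open (- (\<int> :: complex set))"
    using closed_Ints by (simp add: open_closed)
  then obtain \<delta> where "\<delta> > 0" "ball b \<delta> \<subseteq> - \<int>"
    using assms unfolding open_contains_ball by blast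
  then show ?thesis
    using that[of \<delta>] by (force simp: dist_norm)
qed

text \<open>Each Gamma(s, x) with s = b - 1 - k splits into Gamma(s) and a multiple of M(s; s + 1;
  -x). The Gamma values add up to the summand of U with x^(1-b), the M-parts to the other one, each
  still before Kummer's transformation.\<close>

lemma kummer_U_generic_incomplete_Gamma_series:
  assumes x: "x > 0" and a: "Re a > 1" and b: "b \<notin> \<int>"
  shows "(\<lambda>k. beta_coeff a k * (of_real x powr (1 - b + of_nat k) * exp (of_real x)
      * upper_incomplete_Gamma (b - 1 - of_nat k) x)) sums (Gamma a * kummer_U_generic a b (of_real x))"
proof -
  let ?x = "complex_of_real x"
  have x0: "?x \<noteq> 0" using x by simp
  have ni: "b - 1 - of_nat k \<notin> \<int>" "1 - b - of_nat k \<notin> \<int>" for k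
    using b Ints_add[of "b - 1 - of_nat k" "1 + of_nat k"] Ints_diff[of "1 - of_nat k" "1 - b - of_nat k"]
    by (auto simp: algebra_simps)
  have nn: "z \<notin> \<int>\<^sub>\<le>\<^sub>0" "z \<noteq> 0" "z + 1 \<notin> \<int>\<^sub>\<le>\<^sub>0" if "z \<notin> \<int>" for z :: complex
    using that Ints_diff[of "z + 1" 1] by (auto dest: nonpos_Ints_Int)
  have b2: "2 - b \<notin> \<int>\<^sub>\<le>\<^sub>0" and bn: "b \<notin> \<int>\<^sub>\<le>\<^sub>0"
    using b Ints_diff[of 2 "2 - b"] by (auto dest: nonpos_Ints_Int)
  define A where "A = ?x powr (1 - b) * Gamma (b - 1)"
  define C where "C = Gamma a * Gamma (1 - b) * rGamma (1 - b + a)"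
  define M where "M k = kummer_M (b - 1 - of_nat k) (b - 1 - of_nat k + 1) (- ?x) / (b - 1 - of_nat k)" for k
  have "(\<lambda>k. A * kummer_term (1 - a) (2 - b) (- ?x) k) sums (A * kummer_M (1 - a) (2 - b) (- ?x))"
    by (intro sums_mult kummer_sums)
  moreover have "A * kummer_term (1 - a) (2 - b) (- ?x) k =
      beta_coeff a k * (?x powr (1 - b + of_nat k) * Gamma (b - 1 - of_nat k))" for k
  proof -
    have "Gamma (b - 1 - of_nat k) = (-1) ^ k * Gamma (b - 1) / pochhammer (2 - b) k"
      using Gamma_minus_nat[of "b - 1" k] ni(1)[of 0] by simp
    moreover have "?x powr (1 - b + of_nat k) = ?x powr (1 - b) * ?x ^ k"
      using x0 by (simp add: powr_add powr_nat')
    moreover have "(- ?x) ^ k = (-1) ^ k * ?x ^ k"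
      by (rule power_minus)
    ultimately show ?thesis
      by (simp add: A_def kummer_term_def beta_coeff_def mult_ac)
  qed
  ultimately have part1: "(\<lambda>k. beta_coeff a k * (?x powr (1 - b + of_nat k) * Gamma (b - 1 - of_nat k))) sums
      (A * kummer_M (1 - a) (2 - b) (- ?x))"
    by simp
  \<comment> \<open>The expansion of M k in powers of -x, by (s)_m / (s + 1)_m = s / (s + m) for s =
    b - 1 - k. All denominators differ from b by integers, so they stay away from 0
    uniformly.\<close>
  define f where "f m k = (- ?x) ^ m / fact m * (beta_coeff a k / (b - 1 - of_nat k + of_nat m))" for m k
  obtain \<delta> where \<delta>: "\<delta> > 0" "\<And>n. n \<in> \<int> \<Longrightarrow> norm (b - n) \<ge> \<delta>"
    using dist_Ints_pos[OF b] by blast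
  have bound: "norm (f m k) \<le> (norm ?x ^ m / fact m / \<delta>) * norm (beta_coeff a k)" for m k
  proof -
    have "norm (b - (1 + of_nat k - of_nat m)) \<ge> \<delta>"
      by (intro \<delta>(2)) auto
    then have "norm (b - 1 - of_nat k + of_nat m) \<ge> \<delta>"
      by (simp add: algebra_simps)
    then have "norm (beta_coeff a k) / norm (b - 1 - of_nat k + of_nat m) \<le> norm (beta_coeff a k) / \<delta>"
      using \<delta>(1) by (intro divide_left_mono mult_pos_pos) auto
    then have "norm ?x ^ m / fact m * (norm (beta_coeff a k) / norm (b - 1 - of_nat k + of_nat m)) \<le>
        norm ?x ^ m / fact m * (norm (beta_coeff a k) / \<delta>)"
      by (intro mult_left_mono) auto
    then show ?thesis
      by (simp add: f_def norm_mult norm_divide norm_power)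
  qed
  have su: "summable (\<lambda>m. norm ?x ^ m / fact m / \<delta>)"
    using summable_exp_generic[of "norm ?x"] by (intro summable_divide) (simp add: divide_inverse mult.commute)
  obtain S where S: "(\<lambda>m. \<Sum>k. f m k) sums S" "(\<lambda>k. \<Sum>m. f m k) sums S"
      "(\<lambda>n. \<Sum>m\<le>n. f m (n - m)) sums S"
    by (rule double_series[OF bound su summable_norm_beta_coeff[OF a]]) (use \<delta>(1) in auto)
  have col: "(\<Sum>m. f m k) = beta_coeff a k * M k" for k
  proof -
    define s where "s = b - 1 - of_nat k"
    have s: "s \<noteq> 0" "s \<notin> \<int>\<^sub>\<le>\<^sub>0"
      using nn[OF ni(1)[of k]] by (auto simp: s_def)
    have "f m k = beta_coeff a k / s * kummer_term s (s + 1) (- ?x) m" for m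
    proof -
      have "s + of_nat m \<noteq> 0"
        using plus_nat_notin_nonpos_Ints[OF s(2), of m] by auto
      then show ?thesis
        using s pochhammer_notin_nonpos_Ints[OF s(2), of m]
        by (simp add: f_def kummer_term_def pochhammer_plus_one[OF s(1)] s_def[symmetric] mult_ac)
    qed
    then have "(\<Sum>m. f m k) = beta_coeff a k / s * kummer_M s (s + 1) (- ?x)"
      unfolding kummer_M_eq by (simp only: suminf_mult[OF summable_kummer_term])
    then show ?thesis
      by (simp add: M_def s_def)
  qed
  \<comment> \<open>Gauss's theorem with A = 1 - a, B = e, C = e + 1, since (e)_k / (e + 1)_k = e /
    (e + k); here C - B = 1 and C - A - B = a.\<close>
  have row: "(\<Sum>k. f m k) = - C * kummer_term (b - a) b (- ?x) m" for m
  proof -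
    define e where "e = 1 - b - of_nat m"
    have e: "e \<noteq> 0" "e \<notin> \<int>\<^sub>\<le>\<^sub>0" "e + 1 \<notin> \<int>\<^sub>\<le>\<^sub>0"
      using nn[OF ni(2)[of m]] by (auto simp: e_def)
    have "gauss_term (1 - a) e (e + 1) sums
        (Gamma (e + 1) * Gamma (e + 1 - (1 - a) - e) * rGamma (e + 1 - (1 - a)) * rGamma (e + 1 - e))"
      using a by (intro gauss_sum e) simp
    then have g: "gauss_term (1 - a) e (e + 1) sums (e * Gamma e * Gamma a * rGamma (e + a))"
      using e by (simp add: Gamma_plus1)
    have "f m k = - ((- ?x) ^ m / fact m) / e * gauss_term (1 - a) e (e + 1) k" for k
    proof -
      have ek: "e + of_nat k \<noteq> 0"
        using plus_nat_notin_nonpos_Ints[OF e(2), of k] by auto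
      have "b - 1 - of_nat k + of_nat m = - (e + of_nat k)"
        by (simp add: e_def)
      then have F: "f m k = (- ?x) ^ m / fact m * (beta_coeff a k / - (e + of_nat k))"
        by (simp only: f_def)
      show ?thesis
        unfolding F using e ek pochhammer_notin_nonpos_Ints[OF e(2), of k]
        by (simp add: gauss_term_def beta_coeff_def pochhammer_plus_one[OF e(1)] mult_ac del: minus_add_distrib)
    qed
    with sums_mult[OF g, of "- ((- ?x) ^ m / fact m) / e"]
    have "(\<Sum>k. f m k) = - ((- ?x) ^ m / fact m) / e * (e * Gamma e * Gamma a * rGamma (e + a))"
      by (simp only: sums_iff)
    also have "\<dots> = - ((- ?x) ^ m / fact m) * Gamma a * Gamma e * rGamma (e + a)"
      using e by simp
    also have "Gamma e = (-1) ^ m * Gamma (1 - b) / pochhammer b m"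
      using Gamma_minus_nat[of "1 - b" m] ni(2)[of 0] by (simp add: e_def)
    also have "rGamma (e + a) = (-1) ^ m * rGamma (1 - b + a) * pochhammer (b - a) m"
    proof -
      have "e + a = 1 - b + a - of_nat m" "1 - (1 - b + a) = b - a"
        by (simp_all add: e_def)
      then show ?thesis
        using rGamma_minus_nat[of "1 - b + a" m] by (simp only:)
    qed
    finally show ?thesis
      by (simp add: C_def kummer_term_def mult_ac)
  qed
  have "S = - C * kummer_M (b - a) b (- ?x)"
    using S(1) unfolding row by (rule sums_unique2) (intro sums_mult kummer_sums)
  with S(2) have part2: "(\<lambda>k. beta_coeff a k * M k) sums (- C * kummer_M (b - a) b (- ?x))"
    unfolding col by simp
  have "(\<lambda>k. exp ?x * (beta_coeff a k * (?x powr (1 - b + of_nat k) * Gamma (b - 1 - of_nat k)) - beta_coeff a k * M k)) sums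
      (exp ?x * (A * kummer_M (1 - a) (2 - b) (- ?x) - (- C * kummer_M (b - a) b (- ?x))))"
    by (rule sums_mult[OF sums_diff[OF part1 part2]])
  moreover have "exp ?x * (beta_coeff a k * (?x powr (1 - b + of_nat k) * Gamma (b - 1 - of_nat k)) - beta_coeff a k * M k) =
      beta_coeff a k * (?x powr (1 - b + of_nat k) * exp ?x * upper_incomplete_Gamma (b - 1 - of_nat k) x)" for k
  proof -
    have "?x powr (1 - b + of_nat k) * ?x powr (b - 1 - of_nat k) = 1"
      using x0 by (simp add: powr_add[symmetric])
    then have PM: "?x powr (1 - b + of_nat k) * (?x powr (b - 1 - of_nat k) * M k) = M k"
      by (simp only: mult.assoc[symmetric] mult_1_left)
    have U: "upper_incomplete_Gamma (b - 1 - of_nat k) x = Gamma (b - 1 - of_nat k) - ?x powr (b - 1 - of_nat k) * M k"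
      unfolding upper_incomplete_Gamma_eq[OF x nn(1)[OF ni(1)[of k]]] M_def by simp
    have "q * (P * E * (g - Q * w)) = E * (q * (P * g) - q * (P * (Q * w)))" for q P E g Q w :: complex
      by (simp add: algebra_simps)
    then show ?thesis
      unfolding U by (simp only: PM)
  qed
  moreover have "exp ?x * (A * kummer_M (1 - a) (2 - b) (- ?x) - (- C * kummer_M (b - a) b (- ?x))) =
      Gamma a * kummer_U_generic a b ?x"
  proof -
    have "kummer_M (a - b + 1) (2 - b) ?x = exp ?x * kummer_M (1 - a) (2 - b) (- ?x)"
      using kummer_transformation[OF b2, of "a - b + 1" ?x] by simp
    moreover have "kummer_M a b ?x = exp ?x * kummer_M (b - a) b (- ?x)"
      by (rule kummer_transformation[OF bn])
    moreover have "Gamma a \<noteq> 0"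
      using Re_pos_notin_nonpos_Ints[of a] a by (simp add: Gamma_eq_zero_iff)
    ultimately show ?thesis
      by (simp add: kummer_U_generic_def A_def C_def rGamma_inverse_Gamma divide_inverse algebra_simps)
  qed
  ultimately show ?thesis
    by simp
qed

text \<open>Integrating the binomial series for t^(a-1) termwise would give this; here it is Gauss's
  theorem with A = 1 - a, B = d, C = d + n + 1, where C - A - B = a + n.\<close>

lemma gamma_weight_expansion:
  assumes a: "Re a > 0" and d: "Re d > 0"
  shows "(\<lambda>k. beta_coeff a k * weight 1 (d + of_nat k) n) sums (Gamma a * weight a d n)"
proof -
  define c where "c = d + of_nat n + 1"
  have dn: "d \<notin> \<int>\<^sub>\<le>\<^sub>0" and cn: "c \<notin> \<int>\<^sub>\<le>\<^sub>0" and an: "a \<notin> \<int>\<^sub>\<le>\<^sub>0"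
    using a d by (auto intro!: Re_pos_notin_nonpos_Ints simp: c_def)
  let ?B = "Gamma d * fact n * rGamma c"
  have "gauss_term (1 - a) d c sums
        (Gamma c * Gamma (c - (1 - a) - d) * rGamma (c - (1 - a)) * rGamma (c - d))"
    using a by (intro gauss_sum cn) (simp add: c_def)
  moreover have "c - (1 - a) - d = a + of_nat n" "c - (1 - a) = a + d + of_nat n" "c - d = 1 + of_nat n"
    by (simp_all add: c_def)
  ultimately have "gauss_term (1 - a) d c sums
      (Gamma c * Gamma (a + of_nat n) * rGamma (a + d + of_nat n) * rGamma (1 + of_nat n))"
    by (simp only:)
  from sums_mult[OF this, of ?B]
  have "(\<lambda>k. ?B * gauss_term (1 - a) d c k) sums
      (?B * (Gamma c * Gamma (a + of_nat n) * rGamma (a + d + of_nat n) * rGamma (1 + of_nat n)))" .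
  moreover have "?B * gauss_term (1 - a) d c k = beta_coeff a k * weight 1 (d + of_nat k) n" for k
  proof -
    have "Gamma (d + of_nat k) = pochhammer d k * Gamma d"
      using pochhammer_Gamma[OF dn, of k] dn by (simp add: Gamma_eq_zero_iff)
    moreover have "rGamma (c + of_nat k) = rGamma c / pochhammer c k"
      using pochhammer_rGamma[of c k] pochhammer_notin_nonpos_Ints[OF cn, of k] by (simp add: field_simps)
    moreover have "1 + (d + of_nat k) + of_nat n = c + of_nat k"
      by (simp add: c_def)
    then have "weight 1 (d + of_nat k) n = Gamma (d + of_nat k) * fact n * rGamma (c + of_nat k)"
      by (simp only: weight_def pochhammer_fact[symmetric])
    ultimately show ?thesis
      by (simp add: gauss_term_def beta_coeff_def mult_ac)
  qed
  moreover have "?B * (Gamma c * Gamma (a + of_nat n) * rGamma (a + d + of_nat n) * rGamma (1 + of_nat n)) =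
      Gamma a * weight a d n"
  proof -
    have "Gamma (a + of_nat n) = pochhammer a n * Gamma a"
      using pochhammer_Gamma[OF an, of n] an by (simp add: Gamma_eq_zero_iff)
    moreover have "rGamma c * Gamma c = 1"
      using cn by (simp add: rGamma_inverse_Gamma Gamma_eq_zero_iff)
    moreover have "fact n * rGamma (1 + of_nat n :: complex) = 1"
      by (simp add: rGamma_inverse_Gamma Gamma_fact)
    moreover have "?B * (Gamma c * (pochhammer a n * Gamma a) * rGamma (a + d + of_nat n) * rGamma (1 + of_nat n)) =
       (rGamma c * Gamma c) * (fact n * rGamma (1 + of_nat n)) * (Gamma a * (Gamma d * pochhammer a n * rGamma (a + d + of_nat n)))"
      by (simp only: mult_ac)
    ultimately show ?thesis
      by (simp only: weight_def mult_1_left)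
  qed
  ultimately show ?thesis
    by (simp only:)
qed

lemma weight_1_eq:
  assumes dn: "d \<notin> \<int>\<^sub>\<le>\<^sub>0"
  shows "weight 1 d n = fact n / pochhammer d (Suc n)"
proof -
  have "1 + d + of_nat n = d + of_nat (Suc n)"
    by simp
  then have "weight 1 d n = Gamma d * fact n * rGamma (d + of_nat (Suc n))"
    by (simp only: weight_def pochhammer_fact[symmetric])
  then have "pochhammer d (Suc n) * weight 1 d n = fact n * (Gamma d * rGamma d)"
    using pochhammer_rGamma[of d "Suc n"] by (simp del: of_nat_Suc pochhammer_Suc)
  also have "Gamma d * rGamma d = 1"
    using dn by (simp add: rGamma_inverse_Gamma Gamma_eq_zero_iff)
  finally show ?thesis
    using pochhammer_notin_nonpos_Ints[OF dn, of "Suc n"] by (simp add: eq_divide_eq mult.commute del: pochhammer_Suc)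
qed

text \<open>Provides a majorant that is uniform both in the shift k of d and in the parameter c of a
  half-plane.\<close>

lemma norm_weight_1_le:
  assumes "0 < D" "D \<le> Re d"
  shows "norm (weight 1 d n) \<le> norm (weight 1 (of_real D) n)"
proof -
  have w: "weight 1 d n = fact n / pochhammer d (Suc n)" if "Re d > 0" for d
    using that by (intro weight_1_eq Re_pos_notin_nonpos_Ints)
  have pos: "pochhammer D (Suc n) > 0"
    using assms by (intro pochhammer_pos)
  have "norm (weight 1 d n) = fact n / norm (pochhammer d (Suc n))"
    using assms by (simp add: w norm_divide del: pochhammer_Suc)
  also have "\<dots> \<le> fact n / pochhammer D (Suc n)"
    using assms pos pochhammer_le_norm[of D d "Suc n"] by (intro divide_left_mono mult_pos_pos) (auto simp del: pochhammer_Suc)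
  also have "\<dots> = norm (weight 1 (of_real D) n)"
    using assms pos by (simp add: w norm_divide pochhammer_of_real del: pochhammer_Suc)
  finally show ?thesis .
qed

text \<open>
  The bound \<open>B\<close> on $\Re c$ is quantified because the recursion from \<open>a\<close> to $a - 1$ refers to $c + 1$;
  continuity in \<open>c\<close> is carried along for the integer values of \<open>b\<close>.
\<close>

definition U_expansion :: "complex \<Rightarrow> complex \<Rightarrow> bool" where
  "U_expansion z a \<longleftrightarrow> (\<forall>B. \<exists>N. \<forall>\<alpha>. Re \<alpha> > N \<longrightarrow> (\<exists>G. continuous_on {c. Re c < B} G \<and>
     (\<forall>c. Re c < B \<longrightarrow> (\<lambda>n. laguerre n \<alpha> z * weight a (\<alpha> + 2 - c) n) sums G c) \<and>
     (\<forall>c. Re c < B \<longrightarrow> c \<notin> \<int> \<longrightarrow> kummer_U_generic a c z = G c)))"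

lemma summable_laguerre_weight_1:
  assumes x: "x > 0" and D: "D > Re \<alpha> / 2 + 5 / 4" "D > 0"
  shows "summable (\<lambda>n. norm (laguerre n \<alpha> (of_real x)) * norm (weight 1 (of_real D) n))"
proof -
  obtain K where K: "K > 0" "\<And>n. norm (laguerre n \<alpha> (of_real x)) \<le> K * (real n + 1) powr (Re \<alpha> / 2 + 1 / 4)"
    using laguerre_boundedE[OF laguerre_bound[OF x, of \<alpha>]] by blast
  have "1 + complex_of_real D \<notin> \<int>\<^sub>\<le>\<^sub>0"
    using D by (intro Re_pos_notin_nonpos_Ints) simp
  then obtain L where L: "L > 0" "\<And>n. norm (weight 1 (of_real D) n) \<le> L * (real n + 1) powr (- D)"
    using weight_bound[of 1 "of_real D"] by auto
  show ?thesis
  proof (rule summable_comparison_test'[where g = "\<lambda>n. K * L * (real n + 1) powr (Re \<alpha> / 2 + 1 / 4 - D)"])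
    show "summable (\<lambda>n. K * L * (real n + 1) powr (Re \<alpha> / 2 + 1 / 4 - D))"
      using D by (intro summable_mult summable_powr_minus) simp
    show "norm (norm (laguerre n \<alpha> (of_real x)) * norm (weight 1 (of_real D) n)) \<le> K * L * (real n + 1) powr (Re \<alpha> / 2 + 1 / 4 - D)" for n
    proof -
      have "norm (laguerre n \<alpha> (of_real x)) * norm (weight 1 (of_real D) n) \<le>
          (K * (real n + 1) powr (Re \<alpha> / 2 + 1 / 4)) * (L * (real n + 1) powr (- D))"
        using K L by (intro mult_mono) auto
      also have "\<dots> = K * L * (real n + 1) powr (Re \<alpha> / 2 + 1 / 4 - D)"
        unfolding powr_diff powr_minus_divide by simp
      finally show ?thesis by simp
    qed
  qed
qed

text \<open>One majorant, uniform in c, serves twice: for the interchange of the sums over n and k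
  at fixed c, and for the Weierstrass test that makes the sum continuous in c.\<close>

lemma U_expansion_Re_gt_1:
  assumes x: "x > 0" and a: "Re a > 1"
  shows "U_expansion (of_real x) a"
  unfolding U_expansion_def
proof (rule allI, rule exI, intro allI impI)
  fix B :: real and \<alpha> :: complex
  \<comment> \<open>Re \<alpha> \<ge> 2 B + 5/2 is D \<ge> Re \<alpha> / 2 + 13/4, and Re \<alpha>
    \<ge> B is D \<ge> 2: the hypotheses of the case a = 1.\<close>
  assume \<alpha>: "Re \<alpha> > max (2 * B + 5 / 2) B"
  define D where "D = Re \<alpha> + 2 - B"
  have D: "D \<ge> Re \<alpha> / 2 + 13 / 4" "D \<ge> 2"
    using \<alpha> by (auto simp: D_def)
  define L where "L n = laguerre n \<alpha> (of_real x)" for n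
  define u where "u n = norm (L n) * norm (weight 1 (of_real D) n)" for n
  define v where "v k = norm (beta_coeff a k)" for k
  have su: "summable u"
    unfolding u_def L_def using x D by (intro summable_laguerre_weight_1) auto
  have sv: "summable v"
    unfolding v_def using a by (rule summable_norm_beta_coeff)
  have w: "norm (weight 1 (\<alpha> + 2 - c + of_nat k) n) \<le> norm (weight 1 (of_real D) n)" if "Re c < B" for c k n
    using that D by (intro norm_weight_1_le) (auto simp: D_def)
  have exp: "(\<lambda>k. beta_coeff a k * weight 1 (\<alpha> + 2 - c + of_nat k) n) sums (Gamma a * weight a (\<alpha> + 2 - c) n)"
    if "Re c < B" for c n
    using that a D by (intro gamma_weight_expansion) (auto simp: D_def)
  have Ga: "Gamma a \<noteq> 0"
    using a Re_pos_notin_nonpos_Ints[of a] by (simp add: Gamma_eq_zero_iff)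
  define G where "G c = (\<Sum>n. L n * weight a (\<alpha> + 2 - c) n)" for c
  define M where "M n = suminf v / norm (Gamma a) * u n" for n
  have M: "norm (L n * weight a (\<alpha> + 2 - c) n) \<le> M n" if c: "Re c < B" for c n
  proof -
    have b: "norm (beta_coeff a k * weight 1 (\<alpha> + 2 - c + of_nat k) n) \<le> v k * norm (weight 1 (of_real D) n)" for k
      unfolding norm_mult v_def by (intro mult_left_mono w c) auto
    have s: "summable (\<lambda>k. v k * norm (weight 1 (of_real D) n))"
      by (rule summable_mult2[OF sv])
    have "norm (Gamma a * weight a (\<alpha> + 2 - c) n) = norm (\<Sum>k. beta_coeff a k * weight 1 (\<alpha> + 2 - c + of_nat k) n)"
      using exp[OF c, of n] by (simp only: sums_iff)
    also have "\<dots> \<le> (\<Sum>k. v k * norm (weight 1 (of_real D) n))"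
      by (rule norm_suminf_le[OF b s])
    also have "\<dots> = suminf v * norm (weight 1 (of_real D) n)"
      by (rule suminf_mult2[OF sv, symmetric])
    finally have "norm (L n) * (norm (Gamma a) * norm (weight a (\<alpha> + 2 - c) n)) \<le>
        norm (L n) * (suminf v * norm (weight 1 (of_real D) n))"
      unfolding norm_mult by (intro mult_left_mono) auto
    then show ?thesis
      using Ga by (simp add: M_def u_def norm_mult field_simps)
  qed
  have sM: "summable M"
    unfolding M_def by (rule summable_mult[OF su])
  show "\<exists>G. continuous_on {c. Re c < B} G \<and>
     (\<forall>c. Re c < B \<longrightarrow> (\<lambda>n. laguerre n \<alpha> (of_real x) * weight a (\<alpha> + 2 - c) n) sums G c) \<and>
     (\<forall>c. Re c < B \<longrightarrow> c \<notin> \<int> \<longrightarrow> kummer_U_generic a c (of_real x) = G c)"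
  proof (intro exI[of _ G] conjI allI impI)
    show "continuous_on {c. Re c < B} G"
    proof (rule uniform_limit_theorem)
      show "uniform_limit {c. Re c < B} (\<lambda>N c. \<Sum>n<N. L n * weight a (\<alpha> + 2 - c) n) G sequentially"
        unfolding G_def by (rule Weierstrass_m_test[OF _ sM]) (use M in auto)
      have "\<alpha> + 2 - c \<notin> \<int>\<^sub>\<le>\<^sub>0" if "Re c < B" for c
        using that D by (intro Re_pos_notin_nonpos_Ints) (auto simp: D_def)
      then have "continuous_on {c. Re c < B} (\<lambda>c. \<Sum>n<N. L n * weight a (\<alpha> + 2 - c) n)" for N
        unfolding weight_def by (intro continuous_at_imp_continuous_on ballI continuous_intros) auto
      then show "\<forall>\<^sub>F N in sequentially. continuous_on {c. Re c < B} (\<lambda>c. \<Sum>n<N. L n * weight a (\<alpha> + 2 - c) n)"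
        by simp
    qed simp
    fix c assume c: "Re c < B"
    have "summable (\<lambda>n. L n * weight a (\<alpha> + 2 - c) n)"
      by (rule summable_comparison_test'[OF sM]) (rule M[OF c])
    then have sums: "(\<lambda>n. L n * weight a (\<alpha> + 2 - c) n) sums G c"
      unfolding G_def by (rule summable_sums)
    then show "(\<lambda>n. laguerre n \<alpha> (of_real x) * weight a (\<alpha> + 2 - c) n) sums G c"
      unfolding L_def .
    assume ci: "c \<notin> \<int>"
    \<comment> \<open>Summing over k first gives the weight series for a; summing over n first gives
      the series of incomplete Gamma functions that represents U.\<close>
    define f where "f n k = L n * (beta_coeff a k * weight 1 (\<alpha> + 2 - c + of_nat k) n)" for n k
    have fb: "norm (f n k) \<le> u n * v k" for n k
    proof -
      have "norm (f n k) = norm (L n) * (v k * norm (weight 1 (\<alpha> + 2 - c + of_nat k) n))"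
        by (simp add: f_def norm_mult v_def)
      also have "\<dots> \<le> norm (L n) * (v k * norm (weight 1 (of_real D) n))"
        by (intro mult_left_mono w c) (auto simp: v_def)
      finally show ?thesis by (simp add: u_def mult_ac)
    qed
    obtain S where S: "(\<lambda>n. \<Sum>k. f n k) sums S" "(\<lambda>k. \<Sum>n. f n k) sums S"
        "(\<lambda>n. \<Sum>j\<le>n. f j (n - j)) sums S"
      by (rule double_series[OF fb su sv]) (auto simp: u_def v_def)
    have "(\<Sum>k. f n k) = Gamma a * (L n * weight a (\<alpha> + 2 - c) n)" for n
      using sums_mult[OF exp[OF c, of n], of "L n"] unfolding f_def
      by (simp only: sums_iff mult.left_commute)
    with S(1) have "S = Gamma a * G c"
      using sums_mult[OF sums, of "Gamma a"] sums_unique2 by fastforce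
    moreover have "(\<Sum>n. f n k) = beta_coeff a k * (of_real x powr (1 - c + of_nat k) * exp (of_real x)
        * upper_incomplete_Gamma (c - 1 - of_nat k) x)" for k
    proof -
      have "(\<lambda>n. laguerre n \<alpha> (of_real x) * weight 1 (\<alpha> + 2 - c + of_nat k) n) sums
          (of_real x powr (- (\<alpha> + 1 - (\<alpha> + 2 - c + of_nat k))) * exp (of_real x) *
            upper_incomplete_Gamma (\<alpha> + 1 - (\<alpha> + 2 - c + of_nat k)) x)"
        using c D by (intro incomplete_Gamma_laguerre_series_large x) (auto simp: D_def)
      moreover have "- (\<alpha> + 1 - (\<alpha> + 2 - c + of_nat k)) = 1 - c + of_nat k"
          "\<alpha> + 1 - (\<alpha> + 2 - c + of_nat k) = c - 1 - of_nat k"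
        by simp_all
      ultimately have "(\<lambda>n. L n * weight 1 (\<alpha> + 2 - c + of_nat k) n) sums
          (of_real x powr (1 - c + of_nat k) * exp (of_real x) * upper_incomplete_Gamma (c - 1 - of_nat k) x)"
        unfolding L_def by (simp only:)
      from sums_mult[OF this, of "beta_coeff a k"] show ?thesis
        unfolding f_def by (simp only: sums_iff mult.left_commute)
    qed
    with S(2) have "S = Gamma a * kummer_U_generic a c (of_real x)"
      using kummer_U_generic_incomplete_Gamma_series[OF x a ci] sums_unique2 by fastforce
    ultimately show "kummer_U_generic a c (of_real x) = G c"
      using Ga by simp
  qed
qed

lemma weight_0: "d \<notin> \<int>\<^sub>\<le>\<^sub>0 \<Longrightarrow> weight 0 d n = (if n = 0 then 1 else 0)"
  by (simp add: weight_def pochhammer_0_left rGamma_inverse_Gamma Gamma_eq_zero_iff)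

text \<open>The start for nonpositive integers a, where z is arbitrary: only the weight at n = 0
  survives, and on the other side division by \<open>Gamma 0\<close>, which is 0, removes the second
  summand of U.\<close>

lemma U_expansion_0: "U_expansion z 0"
  unfolding U_expansion_def
proof (rule allI, rule exI, intro allI impI)
  fix B :: real and \<alpha> :: complex
  assume \<alpha>: "Re \<alpha> > B"
  show "\<exists>G. continuous_on {c. Re c < B} G \<and>
     (\<forall>c. Re c < B \<longrightarrow> (\<lambda>n. laguerre n \<alpha> z * weight 0 (\<alpha> + 2 - c) n) sums G c) \<and>
     (\<forall>c. Re c < B \<longrightarrow> c \<notin> \<int> \<longrightarrow> kummer_U_generic 0 c z = G c)"
  proof (intro exI[of _ "\<lambda>_. 1"] conjI allI impI)
    fix c assume c: "Re c < B"
    have "\<alpha> + 2 - c \<notin> \<int>\<^sub>\<le>\<^sub>0"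
      using c \<alpha> by (intro Re_pos_notin_nonpos_Ints) simp
    then have "(\<lambda>n. laguerre n \<alpha> z * weight 0 (\<alpha> + 2 - c) n) = (\<lambda>n. if n = 0 then 1 else 0)"
      by (auto simp: weight_0)
    then show "(\<lambda>n. laguerre n \<alpha> z * weight 0 (\<alpha> + 2 - c) n) sums 1"
      using sums_single[of 0 "\<lambda>_. 1 :: complex"] by (simp add: eq_commute)
    assume ci: "c \<notin> \<int>"
    have "kummer_M 0 c z = (\<Sum>n\<in>{0}. kummer_term 0 c z n)"
      unfolding kummer_M_eq by (rule suminf_finite) (auto simp: kummer_term_def pochhammer_0_left)
    moreover have "Gamma (1 - c) \<noteq> 0"
      using ci Ints_diff[of 1 "1 - c"] by (auto simp: Gamma_eq_zero_iff dest: nonpos_Ints_Int)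
    ultimately show "kummer_U_generic 0 c z = 1"
      by (simp add: kummer_U_generic_def kummer_term_def)
  qed simp
qed

text \<open>The recursion evaluates at c and c + 1, so the assumption is used once for \<alpha>, B
  and once for \<alpha> + 1, B + 1; raising both leaves d = \<alpha> + 2 - c unchanged.\<close>

lemma U_expansion_pred:
  assumes U: "U_expansion z a" and adm: "weight_admissible z a"
  shows "U_expansion z (a - 1)"
  unfolding U_expansion_def
proof
  fix B :: real
  obtain N1 where N1: "\<And>\<alpha>. Re \<alpha> > N1 \<Longrightarrow> \<exists>G. continuous_on {c. Re c < B} G \<and>
     (\<forall>c. Re c < B \<longrightarrow> (\<lambda>n. laguerre n \<alpha> z * weight a (\<alpha> + 2 - c) n) sums G c) \<and>
     (\<forall>c. Re c < B \<longrightarrow> c \<notin> \<int> \<longrightarrow> kummer_U_generic a c z = G c)"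
    using U unfolding U_expansion_def by blast
  obtain N2 where N2: "\<And>\<alpha>. Re \<alpha> > N2 \<Longrightarrow> \<exists>G. continuous_on {c. Re c < B + 1} G \<and>
     (\<forall>c. Re c < B + 1 \<longrightarrow> (\<lambda>n. laguerre n \<alpha> z * weight a (\<alpha> + 2 - c) n) sums G c) \<and>
     (\<forall>c. Re c < B + 1 \<longrightarrow> c \<notin> \<int> \<longrightarrow> kummer_U_generic a c z = G c)"
    using U unfolding U_expansion_def by blast
  \<comment> \<open>2 B - 3/2 makes the boundary term with the factor n + 1 vanish; B - Re a keeps
    Re (a + d) positive.\<close>
  define N where "N = max (max N1 N2) (max (2 * B - 3 / 2) (B - Re a))"
  show "\<exists>N. \<forall>\<alpha>. Re \<alpha> > N \<longrightarrow> (\<exists>G. continuous_on {c. Re c < B} G \<and>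
     (\<forall>c. Re c < B \<longrightarrow> (\<lambda>n. laguerre n \<alpha> z * weight (a - 1) (\<alpha> + 2 - c) n) sums G c) \<and>
     (\<forall>c. Re c < B \<longrightarrow> c \<notin> \<int> \<longrightarrow> kummer_U_generic (a - 1) c z = G c))"
  proof (rule exI[of _ N], intro allI impI)
    fix \<alpha> assume \<alpha>: "Re \<alpha> > N"
    then have "Re \<alpha> > N1" "Re (\<alpha> + 1) > N2"
      by (auto simp: N_def)
    from N1[OF this(1)] N2[OF this(2)] obtain G1 G2 where
      G1: "continuous_on {c. Re c < B} G1"
        "\<And>c. Re c < B \<Longrightarrow> (\<lambda>n. laguerre n \<alpha> z * weight a (\<alpha> + 2 - c) n) sums G1 c"
        "\<And>c. Re c < B \<Longrightarrow> c \<notin> \<int> \<Longrightarrow> kummer_U_generic a c z = G1 c" and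
      G2: "continuous_on {c. Re c < B + 1} G2"
        "\<And>c. Re c < B + 1 \<Longrightarrow> (\<lambda>n. laguerre n (\<alpha> + 1) z * weight a (\<alpha> + 1 + 2 - c) n) sums G2 c"
        "\<And>c. Re c < B + 1 \<Longrightarrow> c \<notin> \<int> \<Longrightarrow> kummer_U_generic a c z = G2 c"
      by blast
    define G where "G c = z * G2 (c + 1) - (c - a) * G1 c" for c
    show "\<exists>G. continuous_on {c. Re c < B} G \<and>
     (\<forall>c. Re c < B \<longrightarrow> (\<lambda>n. laguerre n \<alpha> z * weight (a - 1) (\<alpha> + 2 - c) n) sums G c) \<and>
     (\<forall>c. Re c < B \<longrightarrow> c \<notin> \<int> \<longrightarrow> kummer_U_generic (a - 1) c z = G c)"
    proof (intro exI[of _ G] conjI allI impI)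
      have "continuous_on {c. Re c < B} (\<lambda>c. G2 (c + 1))"
        by (rule continuous_on_compose2[OF G2(1)]) (auto intro!: continuous_intros)
      then show "continuous_on {c. Re c < B} G"
        unfolding G_def by (intro continuous_intros G1(1))
      fix c assume c: "Re c < B"
      have c1: "Re (c + 1) < B + 1" using c by simp
      have "\<alpha> + 1 + 2 - (c + 1) = \<alpha> + 2 - c" by simp
      with G2(2)[OF c1] have S1: "(\<lambda>n. laguerre n (\<alpha> + 1) z * weight a (\<alpha> + 2 - c) n) sums G2 (c + 1)"
        by (simp only:)
      have bd: "(\<lambda>n. of_nat (Suc n) * laguerre (Suc n) \<alpha> z * weight a (\<alpha> + 2 - c) n) \<longlonglongrightarrow> 0"
      proof -
        let ?d = "\<alpha> + 2 - c"
        have ad: "a + ?d \<notin> \<int>\<^sub>\<le>\<^sub>0"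
          using \<alpha> c by (intro Re_pos_notin_nonpos_Ints) (simp add: N_def)
        have 1: "(\<lambda>n. of_real ((real n + 1) powr 1) * laguerre n \<alpha> z * weight a ?d n) \<longlonglongrightarrow> 0"
          using \<alpha> c by (intro laguerre_weight_tendsto_0[OF adm _ ad]) (simp add: N_def)
        have 2: "(\<lambda>n. of_real ((real n + 1) powr 0) * laguerre n (\<alpha> + 1) z * weight a ?d n) \<longlonglongrightarrow> 0"
          using \<alpha> c by (intro laguerre_weight_tendsto_0[OF adm _ ad]) (simp add: N_def)
        have 3: "(\<lambda>n. of_real ((real n + 1) powr 0) * laguerre n \<alpha> z * weight a ?d n) \<longlonglongrightarrow> 0"
          using \<alpha> c by (intro laguerre_weight_tendsto_0[OF adm _ ad]) (simp add: N_def)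
        \<comment> \<open>The recurrence lowers the index of the polynomial to n, where the weight
          lives.\<close>
        have "of_nat (Suc n) * laguerre (Suc n) \<alpha> z * weight a ?d n =
            of_real ((real n + 1) powr 1) * laguerre n \<alpha> z * weight a ?d n
            + \<alpha> * (of_real ((real n + 1) powr 0) * laguerre n \<alpha> z * weight a ?d n)
            - z * (of_real ((real n + 1) powr 0) * laguerre n (\<alpha> + 1) z * weight a ?d n)" for n
          unfolding laguerre_Suc_mult by (simp add: algebra_simps)
        moreover have "(\<lambda>n. of_real ((real n + 1) powr 1) * laguerre n \<alpha> z * weight a ?d n
            + \<alpha> * (of_real ((real n + 1) powr 0) * laguerre n \<alpha> z * weight a ?d n)
            - z * (of_real ((real n + 1) powr 0) * laguerre n (\<alpha> + 1) z * weight a ?d n)) \<longlonglongrightarrow> 0 + \<alpha> * 0 - z * 0"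
          by (intro tendsto_add tendsto_diff tendsto_mult tendsto_const 1 2 3)
        ultimately show ?thesis
          by (simp only: mult_zero_right add_0_left diff_self)
      qed
      from laguerre_weight_sums_pred[OF S1 G1(2)[OF c] bd]
      show "(\<lambda>n. laguerre n \<alpha> z * weight (a - 1) (\<alpha> + 2 - c) n) sums G c"
        by (simp add: G_def)
      assume ci: "c \<notin> \<int>"
      then have c1i: "c + 1 \<notin> \<int>"
        using Ints_diff[of "c + 1" 1] by auto
      have "z \<noteq> 0 \<or> a \<in> \<int>\<^sub>\<le>\<^sub>0"
        using adm by (auto simp: weight_admissible_def)
      from kummer_U_generic_pred[OF ci this]
      show "kummer_U_generic (a - 1) c z = G c"
        unfolding G1(3)[OF c ci] G2(3)[OF c1 c1i] G_def .
    qed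
  qed
qed

lemma U_expansion_admissible:
  assumes "weight_admissible z a"
  shows "U_expansion z a"
  using assms unfolding weight_admissible_def
proof
  assume "\<exists>x>0. z = complex_of_real x"
  then obtain x where x: "x > 0" "z = complex_of_real x" by blast
  \<comment> \<open>The shift m brings the real part to at least 2; the recursion then descends m
    times to a.\<close>
  define m where "m = nat \<lceil>2 - Re a\<rceil>"
  have "Re (a + of_nat m) > 1"
    unfolding m_def by simp linarith
  then have base: "U_expansion z (a + of_nat m)"
    unfolding x(2) by (rule U_expansion_Re_gt_1[OF x(1)])
  have "U_expansion z (a + of_nat m - of_nat k)" for k
  proof (induction k)
    case (Suc k)
    have "weight_admissible z (a + of_nat m - of_nat k)"
      using x by (auto simp: weight_admissible_def)
    from U_expansion_pred[OF Suc.IH this] show ?case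
      by (simp add: algebra_simps)
  qed (use base in simp)
  from this[of m] show ?thesis by simp
next
  assume "a \<in> \<int>\<^sub>\<le>\<^sub>0"
  then obtain k where k: "a = - of_nat k"
    by (elim nonpos_Ints_cases')
  have "U_expansion z (- of_nat k)" for k
  proof (induction k)
    case (Suc k)
    have "weight_admissible z (- of_nat k)"
      by (simp add: weight_admissible_def)
    moreover have "- of_nat (Suc k) = - of_nat k - (1 :: complex)"
      by simp
    ultimately show ?case
      using U_expansion_pred[OF Suc.IH] by (simp only:)
  qed (simp add: U_expansion_0)
  then show ?thesis unfolding k .
qed

section \<open>The series for U and for the incomplete Gamma function under the stated
  hypotheses\<close>

theorem kummer_U_laguerre_weight_sums:
  assumes adm: "weight_admissible z a"
    and re: "Re (\<alpha> - 2 * b) > - 5 / 2" and d: "2 + \<alpha> - b \<notin> \<int>\<^sub>\<le>\<^sub>0" "2 + \<alpha> - b + a \<notin> \<int>\<^sub>\<le>\<^sub>0"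
  shows "(\<lambda>n. laguerre n \<alpha> z * weight a (2 + \<alpha> - b) n) sums kummer_U a b z"
proof -
  \<comment> \<open>With B above Re b, the point b lies in the open half-plane on which G is
    continuous, as the limit at integer b requires.\<close>
  define B where "B = Re b + 1"
  obtain N where N: "\<And>\<alpha>. Re \<alpha> > N \<Longrightarrow> \<exists>G. continuous_on {c. Re c < B} G \<and>
     (\<forall>c. Re c < B \<longrightarrow> (\<lambda>n. laguerre n \<alpha> z * weight a (\<alpha> + 2 - c) n) sums G c) \<and>
     (\<forall>c. Re c < B \<longrightarrow> c \<notin> \<int> \<longrightarrow> kummer_U_generic a c z = G c)"
    using U_expansion_admissible[OF adm] unfolding U_expansion_def by blast
  \<comment> \<open>The expansion is obtained at \<alpha> + m with the same b, that is, at d + m;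
    summation by parts then returns to \<alpha>.\<close>
  define m where "m = nat \<lceil>N - Re \<alpha>\<rceil> + 1"
  have "Re (\<alpha> + of_nat m) > N"
    unfolding m_def by simp linarith
  from N[OF this] obtain G where G: "continuous_on {c. Re c < B} G"
      "\<And>c. Re c < B \<Longrightarrow> (\<lambda>n. laguerre n (\<alpha> + of_nat m) z * weight a (\<alpha> + of_nat m + 2 - c) n) sums G c"
      "\<And>c. Re c < B \<Longrightarrow> c \<notin> \<int> \<Longrightarrow> kummer_U_generic a c z = G c"
    by blast
  have bB: "Re b < B" by (simp add: B_def)
  have "(\<lambda>n. laguerre n \<alpha> z * weight a (2 + \<alpha> - b) n) sums G b"
  proof (rule laguerre_weight_sums_shift_nat[OF adm])
    show "Re (\<alpha> - 2 * (2 + \<alpha> - b)) < - 3 / 2"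
      using re by simp
    have "a + (2 + \<alpha> - b) = 2 + \<alpha> - b + a" by simp
    then show "a + (2 + \<alpha> - b) \<notin> \<int>\<^sub>\<le>\<^sub>0"
      using d(2) by (simp only: not_False_eq_True)
    have "\<alpha> + of_nat m + 2 - b = 2 + \<alpha> - b + of_nat m" by simp
    then show "(\<lambda>n. laguerre n (\<alpha> + of_nat m) z * weight a (2 + \<alpha> - b + of_nat m) n) sums G b"
      using G(2)[OF bB] by (simp only:)
  qed (rule d(1))
  moreover have "kummer_U a b z = G b"
  proof (cases "b \<in> \<int>")
    case True
    have op: "open {c. Re c < B}"
      by (rule open_halfspace_Re_lt)
    then have "isCont G b"
      using G(1) bB by (simp add: continuous_on_eq_continuous_at)
    then have "(G \<longlongrightarrow> G b) (at b)"
      by (simp add: isCont_def)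
    moreover have "eventually (\<lambda>c. G c = kummer_U_generic a c z) (at b)"
    proof -
      have "eventually (\<lambda>c. c \<in> {c. Re c < B}) (at b)"
        using op bB by (intro eventually_at_in_open') auto
      then show ?thesis
        using eventually_notin_Ints[of b] by eventually_elim (use G(3) in simp)
    qed
    ultimately have "((\<lambda>c. kummer_U_generic a c z) \<longlongrightarrow> G b) (at b)"
      by (rule Lim_transform_eventually)
    then have "Lim (at b) (\<lambda>c. kummer_U_generic a c z) = G b"
      by (intro tendsto_Lim) auto
    then show ?thesis
      using True by (simp add: kummer_U_def)
  next
    case False
    then show ?thesis
      using G(3)[OF bB] by (simp add: kummer_U_def)
  qed
  ultimately show ?thesis by simp
qed

theorem kummer_U_laguerre_series:
  fixes a b \<alpha> z :: complex
  assumes adm: "z \<in> \<real> \<and> Re z > 0 \<or> a \<in> \<int>\<^sub>\<le>\<^sub>0"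
    and re: "Re (\<alpha> - 2 * b) > - 5 / 2" and d: "2 + \<alpha> - b \<notin> \<int>\<^sub>\<le>\<^sub>0" "2 + \<alpha> - b + a \<notin> \<int>\<^sub>\<le>\<^sub>0"
  defines "t \<equiv> (\<lambda>i. laguerre i \<alpha> z * (((- a) gchoose i) / ((b - a - \<alpha> - 2) gchoose i)))"
  shows "summable t" "kummer_U a b z = cfact (1 + \<alpha> - b) / cfact (1 + \<alpha> - b + a) * (\<Sum>i. t i)"
proof -
  let ?d = "2 + \<alpha> - b"
  let ?C = "Gamma ?d / Gamma (?d + a)"
  have "weight_admissible z a"
    using adm by (auto simp: weight_admissible_def elim!: Reals_cases)
  from kummer_U_laguerre_weight_sums[OF this re d]
  have S: "(\<lambda>n. laguerre n \<alpha> z * weight a ?d n) sums kummer_U a b z" .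
  have C0: "?C \<noteq> 0"
    using d by (simp add: Gamma_eq_zero_iff)
  \<comment> \<open>The signs and factorials in the two binomial coefficients cancel, leaving (a)_n
    / (d + a)_n; the constant Gamma(d) / Gamma(d + a) is the prefactor.\<close>
  have w: "laguerre n \<alpha> z * weight a ?d n = ?C * t n" for n
  proof -
    have "b - a - \<alpha> - 2 = - (?d + a)" by simp
    then have "((- a) gchoose n) / ((b - a - \<alpha> - 2) gchoose n) = pochhammer a n / pochhammer (?d + a) n"
      by (simp only: gbinomial_pochhammer minus_minus) simp
    moreover have "rGamma (a + ?d + of_nat n) = rGamma (?d + a) / pochhammer (?d + a) n"
      using pochhammer_rGamma[of "?d + a" n] pochhammer_notin_nonpos_Ints[OF d(2), of n]
      by (simp add: eq_divide_eq mult.commute add_ac)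
    ultimately show ?thesis
      by (simp only: weight_def t_def) (simp add: rGamma_inverse_Gamma divide_inverse)
  qed
  have "t sums (kummer_U a b z / ?C)"
    using sums_divide[OF S, of ?C] unfolding w by (simp only: nonzero_mult_div_cancel_left[OF C0])
  then show "summable t" and "kummer_U a b z = cfact (1 + \<alpha> - b) / cfact (1 + \<alpha> - b + a) * (\<Sum>i. t i)"
  proof -
    assume T: "t sums (kummer_U a b z / ?C)"
    then show "summable t" by (rule sums_summable)
    have "1 + \<alpha> - b + 1 = ?d" "1 + \<alpha> - b + a + 1 = ?d + a" by simp_all
    then show "kummer_U a b z = cfact (1 + \<alpha> - b) / cfact (1 + \<alpha> - b + a) * (\<Sum>i. t i)"
      unfolding sums_unique[OF T, symmetric] using C0 by (simp only: nonzero_eq_divide_eq) simp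
  qed
qed

text \<open>The case a = 1, b = s + 1, taken directly from the integral representation rather than
  through U.\<close>

theorem upper_incomplete_Gamma_laguerre_series:
  fixes s \<alpha> :: complex
  assumes re: "Re (s - \<alpha> / 2) < 1 / 4" and x: "x > 0" and d: "1 + \<alpha> - s \<notin> \<int>\<^sub>\<le>\<^sub>0"
  defines "t \<equiv> (\<lambda>k. laguerre k \<alpha> (of_real x) / (of_nat (k + 1) * ((of_nat k + 1 + \<alpha> - s) gchoose (k + 1))))"
  shows "summable t" "upper_incomplete_Gamma s x = of_real x powr s * exp (- of_real x) * (\<Sum>k. t k)"
proof -
  define d where "d = 1 + \<alpha> - s"
  have dn: "d \<notin> \<int>\<^sub>\<le>\<^sub>0" and dn1: "1 + d \<notin> \<int>\<^sub>\<le>\<^sub>0"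
    using d plus_nat_notin_nonpos_Ints[OF d, of 1] by (simp_all add: d_def add_ac)
  \<comment> \<open>Chosen so that, after the shift by m, Re d + m \<ge> 2 and Re d + m \<ge> Re
    (\<alpha> + m) / 2 + 13/4; the second amounts to m \<ge> 13/2 + Re \<alpha> - 2 Re d.\<close>
  define m where "m = nat \<lceil>max (Re \<alpha> / 2 + 13 / 4 - Re d) (2 - Re d)\<rceil> + nat \<lceil>max (13 / 2 + Re \<alpha> - 2 * Re d) 0\<rceil>"
  have m1: "real m \<ge> 2 - Re d" "real m \<ge> 13 / 2 + Re \<alpha> - 2 * Re d"
    unfolding m_def by linarith+
  have "(\<lambda>n. laguerre n (\<alpha> + of_nat m) (of_real x) * weight 1 (d + of_nat m) n) sums
      (of_real x powr (- (\<alpha> + of_nat m + 1 - (d + of_nat m))) * exp (of_real x) *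
        upper_incomplete_Gamma (\<alpha> + of_nat m + 1 - (d + of_nat m)) x)"
    using m1 by (intro incomplete_Gamma_laguerre_series_large x) (simp_all add: field_simps)
  moreover have "\<alpha> + of_nat m + 1 - (d + of_nat m) = s"
    by (simp add: d_def)
  ultimately have "(\<lambda>n. laguerre n (\<alpha> + of_nat m) (of_real x) * weight 1 (d + of_nat m) n) sums
      (of_real x powr (- s) * exp (of_real x) * upper_incomplete_Gamma s x)"
    by (simp only:)
  then have S: "(\<lambda>n. laguerre n \<alpha> (of_real x) * weight 1 d n) sums
      (of_real x powr (- s) * exp (of_real x) * upper_incomplete_Gamma s x)"
  proof (rule laguerre_weight_sums_shift_nat[rotated -1])
    show "weight_admissible (of_real x) 1"
      using x by (auto simp: weight_admissible_def)
    show "Re (\<alpha> - 2 * d) < - 3 / 2"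
      using re by (simp add: d_def)
  qed (use dn dn1 in auto)
  have w: "laguerre n \<alpha> (of_real x) * weight 1 d n = t n" for n
  proof -
    have "(of_nat n + 1 + \<alpha> - s) gchoose (n + 1) = pochhammer d (Suc n) / fact (Suc n)"
    proof -
      have "of_nat n + 1 + \<alpha> - s - of_nat (Suc n) + 1 = d"
        by (simp add: d_def)
      then show ?thesis
        by (simp only: gbinomial_pochhammer' Suc_eq_plus1[symmetric])
    qed
    then have "of_nat (n + 1) * ((of_nat n + 1 + \<alpha> - s) gchoose (n + 1)) = pochhammer d (Suc n) / fact n"
      by (simp add: field_simps del: pochhammer_Suc of_nat_Suc)
    moreover have "weight 1 d n = fact n / pochhammer d (Suc n)"
      using dn by (rule weight_1_eq)
    ultimately show ?thesis
      by (simp add: t_def)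
  qed
  have T: "t sums (of_real x powr (- s) * exp (of_real x) * upper_incomplete_Gamma s x)"
    using S unfolding w .
  then show "summable t" by (rule sums_summable)
  have "complex_of_real x powr s * of_real x powr (- s) = 1"
    using x by (simp add: powr_add[symmetric])
  moreover have "exp (- complex_of_real x) * exp (of_real x) = 1"
    by (simp add: exp_add[symmetric])
  moreover have "of_real x powr s * exp (- of_real x) * (of_real x powr (- s) * exp (of_real x) * upper_incomplete_Gamma s x) =
      (complex_of_real x powr s * of_real x powr (- s)) * (exp (- complex_of_real x) * exp (of_real x)) * upper_incomplete_Gamma s x"
    by (simp only: mult_ac)
  ultimately show "upper_incomplete_Gamma s x = of_real x powr s * exp (- of_real x) * (\<Sum>k. t k)"
    unfolding sums_unique[OF T, symmetric] by (simp only: mult_1_left)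
qed

text \<open>The excluded nonpositive integers keep the Gamma values and the binomial denominators
  away from poles and zeros. The M-series converges for every complex z, because its inner sums are
  Gauss series independent of z; the other two rely on the growth of the Laguerre polynomials on the
  positive axis, or on termination.\<close>

theorem theorem1:
  fixes a b \<alpha> \<beta> s z :: complex and x :: real
  shows
    "(Re (b - a) > 0 \<and> Re (\<alpha> - 2 * b) > - 5 / 2 \<longrightarrow>
        (b \<notin> \<int>\<^sub>\<le>\<^sub>0 \<and> b - \<beta> \<notin> \<int>\<^sub>\<le>\<^sub>0 \<and> b - \<beta> - a \<notin> \<int>\<^sub>\<le>\<^sub>0 \<longrightarrow>
           summable (\<lambda>i. (- 1) ^ i * laguerre i (\<beta> - of_nat i) z
                           * (((- a) gchoose i) / ((\<beta> - b) gchoose i))) \<and>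
           kummer_M a b z = binomial_quotient (b - 1) (b - \<beta> - 1) a
             * (\<Sum>i. (- 1) ^ i * laguerre i (\<beta> - of_nat i) z
                       * (((- a) gchoose i) / ((\<beta> - b) gchoose i)))) \<and>
        ((z \<in> \<real> \<and> Re z > 0 \<or> a \<in> \<int>\<^sub>\<le>\<^sub>0) \<and>
         2 + \<alpha> - b \<notin> \<int>\<^sub>\<le>\<^sub>0 \<and> 2 + \<alpha> - b + a \<notin> \<int>\<^sub>\<le>\<^sub>0 \<longrightarrow>
           summable (\<lambda>i. laguerre i \<alpha> z
                           * (((- a) gchoose i) / ((b - a - \<alpha> - 2) gchoose i))) \<and>
           kummer_U a b z = cfact (1 + \<alpha> - b) / cfact (1 + \<alpha> - b + a)
             * (\<Sum>i. laguerre i \<alpha> z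
                       * (((- a) gchoose i) / ((b - a - \<alpha> - 2) gchoose i))))) \<and>
     (Re (s - \<alpha> / 2) < 1 / 4 \<and> x > 0 \<and> 1 + \<alpha> - s \<notin> \<int>\<^sub>\<le>\<^sub>0 \<longrightarrow>
        summable (\<lambda>k. laguerre k \<alpha> (of_real x)
                        / (of_nat (k + 1) * ((of_nat k + 1 + \<alpha> - s) gchoose (k + 1)))) \<and>
        upper_incomplete_Gamma s x = of_real x powr s * exp (- of_real x)
          * (\<Sum>k. laguerre k \<alpha> (of_real x)
                    / (of_nat (k + 1) * ((of_nat k + 1 + \<alpha> - s) gchoose (k + 1)))))"
proof (intro conjI impI, goal_cases)
  case 1
  then show ?case
    by (intro kummer_M_laguerre_series(1)) auto
next
  case 2
  then show ?case
    by (intro kummer_M_laguerre_series(2)) auto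
next
  case 3
  then show ?case
    by (intro kummer_U_laguerre_series(1)) auto
next
  case 4
  then show ?case
    by (intro kummer_U_laguerre_series(2)) auto
next
  case 5
  then show ?case
    by (intro upper_incomplete_Gamma_laguerre_series(1)) auto
next
  case 6
  then show ?case
    by (intro upper_incomplete_Gamma_laguerre_series(2)) auto
qed

end
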